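(* Let $(X,A)$ be a metric pair and let $1\le p<\infty$. Then the following assertions hold: (1) If $X$ is complete, then $\mathcal D_p(X,A)$ is complete. (2) If $X$ is separable, then $\mathcal D_p(X,A)$ is separable. (3) If $X$ is a proper geodesic space, then $\mathcal D_p(X,A)$ is a geodesic space. (4) If $X$ is a proper Alexandrov space with non-negative curvature, then $\mathcal D_2(X,A)$ is an Alexandrov space with non-negative curvature.
   Context: A metric pair $(X,A)$ is a metric space $(X,d)$ together with a non-empty closed subset $A\subseteq X$. Persistence diagrams ($1\le p<\infty$): for a set $Y$, let $\widetilde{\mathcal D}(Y)$ be the set of countable (finite or countably infinite) multisets of elements of $Y$; the sum of two multisets is their disjoint union. For $\widetilde\sigma,\widetilde\tau\in\widetilde{\mathcal D}(X)$ put $\widetilde d_p(\widetilde\sigma,\widetilde\tau)=\inf_\phi\big(\sum_{x\in\widetilde\sigma}d(x,\phi(x))^p\big)^{1/p}$, the infimum being over all bijections $\phi\colon\widetilde\sigma\to\widetilde\tau$ of multisets ($\inf\varnothing=\infty$). Write $\widetilde\sigma\sim_A\widetilde\tau$ if $\widetilde\sigma+\widetilde\alpha=\widetilde\tau+\widetilde\beta$ for some $\widetilde\alpha,\widetilde\beta\in\widetilde{\mathcal D}(A)$; let $\mathcal D(X,A)=\widetilde{\mathcal D}(X)/\!\sim_A$, with $\sigma$ the class of $\widetilde\sigma$ and $\sigma_\varnothing$ the class of the empty multiset. Put $d_p(\sigma,\tau)=\inf_{\widetilde\alpha,\widetilde\beta\in\widetilde{\mathcal D}(A)}\widetilde d_p(\widetilde\sigma+\widetilde\alpha,\widetilde\tau+\widetilde\beta)$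 and $\mathcal D_p(X,A)=\{\sigma\in\mathcal D(X,A): d_p(\sigma,\sigma_\varnothing)<\infty\}$, equipped with the metric $d_p$. A metric space is proper if its closed bounded subsets are compact. It is geodesic if any two points $x,y$ are joined by a continuous path of length $d(x,y)$ (a minimizing geodesic). A metric space is an Alexandrov space with non-negative curvature if it is complete, geodesic, and can be covered by open sets such that for every geodesic triangle $\triangle pqr$ (three points with three minimizing geodesics $[pq],[qr],[rp]$) contained in one of these open sets, every comparison triangle $\triangle\widetilde p\widetilde q\widetilde r$ in the Euclidean plane $\mathbb R^2$ (with the same side lengths), every $x\in[qr]$ and the point $\widetilde x\in[\widetilde q\widetilde r]$ with $d(\widetilde q,\widetilde x)=d(q,x)$, one has $d(p,x)\ge d(\widetilde p,\widetilde x)$. *)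

theory Defs
  imports "HOL-Analysis.Analysis" "HOL-Library.Function_Algebras" "HOL-Library.Equipollence"
begin

section \<open>Metric spaces\<close>

locale metric_pair = Metric_space M d for M :: "'a set" and d :: "'a \<Rightarrow> 'a \<Rightarrow> real" +
  fixes A :: "'a set"
  assumes closed_A: "closedin mtopology A"
    and nonempty_A: "A \<noteq> {}"

definition proper_space :: "'a set \<Rightarrow> ('a \<Rightarrow> 'a \<Rightarrow> real) \<Rightarrow> bool" where
  "proper_space M d \<longleftrightarrow>
     (\<forall>S. closedin (Metric_space.mtopology M d) S \<and> Metric_space.mbounded M d S
        \<longrightarrow> compactin (Metric_space.mtopology M d) S)"

text \<open>Length of a curve parametrized by \<open>{0..1}\<close>: the supremum over all partitions
  \<open>0 = t 0 \<le> \<dots> \<le> t n = 1\<close>.\<close>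

definition curve_length :: "('a \<Rightarrow> 'a \<Rightarrow> real) \<Rightarrow> (real \<Rightarrow> 'a) \<Rightarrow> ennreal" where
  "curve_length d g =
     (SUP (n, t) \<in> {(n::nat, t::nat \<Rightarrow> real). t 0 = 0 \<and> t n = 1 \<and> mono_on {..n} t}.
        \<Sum>i<n. ennreal (d (g (t i)) (g (t (Suc i)))))"

definition minimizing_geodesic ::
  "'a set \<Rightarrow> ('a \<Rightarrow> 'a \<Rightarrow> real) \<Rightarrow> 'a \<Rightarrow> 'a \<Rightarrow> (real \<Rightarrow> 'a) \<Rightarrow> bool" where
  "minimizing_geodesic M d x y g \<longleftrightarrow>
     pathin (Metric_space.mtopology M d) g \<and> g 0 = x \<and> g 1 = y \<and>
     curve_length d g = ennreal (d x y)"

definition geodesic_space :: "'a set \<Rightarrow> ('a \<Rightarrow> 'a \<Rightarrow> real) \<Rightarrow> bool" where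
  "geodesic_space M d \<longleftrightarrow> (\<forall>x\<in>M. \<forall>y\<in>M. \<exists>g. minimizing_geodesic M d x y g)"

definition triangle_comparison_in :: "'a set \<Rightarrow> ('a \<Rightarrow> 'a \<Rightarrow> real) \<Rightarrow> 'a set \<Rightarrow> bool" where
  "triangle_comparison_in M d U \<longleftrightarrow>
     (\<forall>p q r g\<^sub>p\<^sub>q g\<^sub>q\<^sub>r g\<^sub>r\<^sub>p.
        minimizing_geodesic M d p q g\<^sub>p\<^sub>q \<and>
        minimizing_geodesic M d q r g\<^sub>q\<^sub>r \<and>
        minimizing_geodesic M d r p g\<^sub>r\<^sub>p \<and>
        g\<^sub>p\<^sub>q ` {0..1} \<union> g\<^sub>q\<^sub>r ` {0..1} \<union> g\<^sub>r\<^sub>p ` {0..1} \<subseteq> U \<longrightarrow>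
        (\<forall>(p'::real^2) q' r'.
           dist p' q' = d p q \<and> dist q' r' = d q r \<and> dist r' p' = d r p \<longrightarrow>
           (\<forall>x \<in> g\<^sub>q\<^sub>r ` {0..1}. \<forall>x' \<in> closed_segment q' r'.
              dist q' x' = d q x \<longrightarrow> d p x \<ge> dist p' x')))"

definition alexandrov_nonneg :: "'a set \<Rightarrow> ('a \<Rightarrow> 'a \<Rightarrow> real) \<Rightarrow> bool" where
  "alexandrov_nonneg M d \<longleftrightarrow>
     Metric_space.mcomplete M d \<and> geodesic_space M d \<and>
     (\<exists>\<U>. (\<forall>U\<in>\<U>. openin (Metric_space.mtopology M d) U) \<and> \<Union>\<U> = M \<and>
          (\<forall>U\<in>\<U>. triangle_comparison_in M d U))"

section \<open>Persistence diagrams\<close>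

text \<open>A countable multiset is given by its multiplicity function, which may take the value
  \<open>\<infinity>\<close>. The sum of multisets is the pointwise sum and the empty multiset is \<open>0\<close>
  (see \<^theory>\<open>HOL-Library.Function_Algebras\<close>).\<close>

definition cmsets :: "'a set \<Rightarrow> ('a \<Rightarrow> enat) set" where
  "cmsets Y = {s. countable {x. s x \<noteq> 0} \<and> {x. s x \<noteq> 0} \<subseteq> Y}"

text \<open>The elements of a multiset counted with multiplicity: the copies of \<open>x\<close> are the pairs
  \<open>(x, i)\<close> with \<open>i < s x\<close>. Bijections of multisets are bijections between these sets.\<close>

definition copies :: "('a \<Rightarrow> enat) \<Rightarrow> ('a \<times> nat) set" where
  "copies s = {(x, i). enat i < s x}"

definition pth_root :: "real \<Rightarrow> ennreal \<Rightarrow> ennreal" where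
  "pth_root p x = (if x = \<infinity> then \<infinity> else ennreal (enn2real x powr (1 / p)))"

definition mset_dist ::
  "real \<Rightarrow> ('a \<Rightarrow> 'a \<Rightarrow> real) \<Rightarrow> ('a \<Rightarrow> enat) \<Rightarrow> ('a \<Rightarrow> enat) \<Rightarrow> ennreal" where
  "mset_dist p d s t =
     (INF \<phi> \<in> {\<phi>. bij_betw \<phi> (copies s) (copies t)}.
        pth_root p (\<Sum>\<^sub>\<infinity>e\<in>copies s. ennreal (d (fst e) (fst (\<phi> e)) powr p)))"

definition diag_rel :: "'a set \<Rightarrow> 'a set \<Rightarrow> (('a \<Rightarrow> enat) \<times> ('a \<Rightarrow> enat)) set" where
  "diag_rel M A =
     {(s, t) \<in> cmsets M \<times> cmsets M. \<exists>a\<in>cmsets A. \<exists>b\<in>cmsets A. s + a = t + b}"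

definition diagrams :: "'a set \<Rightarrow> 'a set \<Rightarrow> ('a \<Rightarrow> enat) set set" where
  "diagrams M A = cmsets M // diag_rel M A"

definition empty_diagram :: "'a set \<Rightarrow> 'a set \<Rightarrow> ('a \<Rightarrow> enat) set" where
  "empty_diagram M A = diag_rel M A `` {0}"

definition rep_dist ::
  "real \<Rightarrow> ('a \<Rightarrow> 'a \<Rightarrow> real) \<Rightarrow> 'a set \<Rightarrow> ('a \<Rightarrow> enat) \<Rightarrow> ('a \<Rightarrow> enat) \<Rightarrow> ennreal" where
  "rep_dist p d A s t = (INF a\<in>cmsets A. INF b\<in>cmsets A. mset_dist p d (s + a) (t + b))"

text \<open>The value of \<^const>\<open>rep_dist\<close> does not depend on the representatives
  (lemma \<open>diag_edist_eq\<close> below); taking the infimum avoids a choice.\<close>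

definition diag_edist ::
  "real \<Rightarrow> ('a \<Rightarrow> 'a \<Rightarrow> real) \<Rightarrow> 'a set \<Rightarrow> ('a \<Rightarrow> enat) set \<Rightarrow> ('a \<Rightarrow> enat) set \<Rightarrow> ennreal" where
  "diag_edist p d A S T = (INF s\<in>S. INF t\<in>T. rep_dist p d A s t)"

definition pdiagrams ::
  "real \<Rightarrow> 'a set \<Rightarrow> ('a \<Rightarrow> 'a \<Rightarrow> real) \<Rightarrow> 'a set \<Rightarrow> ('a \<Rightarrow> enat) set set" where
  "pdiagrams p M d A =
     {S \<in> diagrams M A. diag_edist p d A S (empty_diagram M A) < \<infinity>}"

definition pdist ::
  "real \<Rightarrow> ('a \<Rightarrow> 'a \<Rightarrow> real) \<Rightarrow> 'a set \<Rightarrow> ('a \<Rightarrow> enat) set \<Rightarrow> ('a \<Rightarrow> enat) set \<Rightarrow> real" where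
  "pdist p d A S T = enn2real (diag_edist p d A S T)"


section \<open>Persistence diagrams form a metric space\<close>

lemma powr_convex_nonneg:
  fixes x y u v p :: real
  assumes "1 \<le> p" "0 \<le> x" "0 \<le> y" "0 \<le> u" "0 \<le> v" "u + v = 1"
  shows "(u * x + v * y) powr p \<le> u * x powr p + v * y powr p"
proof -
  have aux: "(w * z) powr p \<le> w * z powr p" if "0 \<le> w" "w \<le> 1" "0 \<le> z" for w z :: real
  proof -
    have "w powr p \<le> w"
    proof (cases "w = 0")
      case False
      then have "w powr p \<le> w powr 1" using that assms(1) by (intro powr_mono') auto
      then show ?thesis using that by simp
    qed (use assms in auto)
    then show ?thesis using that by (simp add: powr_mult mult_right_mono)
  qed
  show ?thesis
  proof (cases "x = 0 \<or> y = 0")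
    case True
    then show ?thesis using aux[of u x] aux[of v y] assms by auto
  next
    case False
    have "convex_on {0<..} (\<lambda>x::real. x powr p)" using assms(1) by (rule powr_convex)
    moreover have u: "u = 1 - v" using assms by auto
    ultimately show ?thesis
      using convex_onD[of "{0<..}" "\<lambda>x. x powr p" v x y] False assms(2-5) unfolding u by auto
  qed
qed

lemma minkowski_powr:
  fixes f g :: "'i \<Rightarrow> real" and a b p :: real
  assumes "1 \<le> p" "finite F" "0 < a" "0 < b"
    and nn: "\<And>i. i \<in> F \<Longrightarrow> 0 \<le> f i" "\<And>i. i \<in> F \<Longrightarrow> 0 \<le> g i"
    and fa: "(\<Sum>i\<in>F. f i powr p) \<le> a powr p"
    and gb: "(\<Sum>i\<in>F. g i powr p) \<le> b powr p"
  shows "(\<Sum>i\<in>F. (f i + g i) powr p) \<le> (a + b) powr p"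
proof -
  let ?u = "a / (a + b)" and ?v = "b / (a + b)"
  have uv: "?u + ?v = 1" "0 \<le> ?u" "0 \<le> ?v"
    using assms(3,4) by (auto simp: add_divide_distrib[symmetric])
  have pt: "((f i + g i) / (a + b)) powr p
      \<le> ?u * (f i powr p / a powr p) + ?v * (g i powr p / b powr p)" if "i \<in> F" for i
  proof -
    have "(f i + g i) / (a + b) = ?u * (f i / a) + ?v * (g i / b)"
      using assms(3,4) by (simp add: add_divide_distrib)
    moreover have "(?u * (f i / a) + ?v * (g i / b)) powr p
        \<le> ?u * (f i / a) powr p + ?v * (g i / b) powr p"
      using assms nn[OF that] uv by (intro powr_convex_nonneg) auto
    ultimately show ?thesis
      using nn[OF that] assms(3,4) by (simp add: powr_divide)
  qed
  have "(\<Sum>i\<in>F. (f i + g i) powr p) / (a + b) powr p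
      = (\<Sum>i\<in>F. ((f i + g i) / (a + b)) powr p)"
    unfolding sum_divide_distrib using assms(3,4) nn
    by (intro sum.cong refl) (simp add: powr_divide)
  also have "\<dots> \<le> (\<Sum>i\<in>F. ?u * (f i powr p / a powr p) + ?v * (g i powr p / b powr p))"
    by (intro sum_mono pt)
  also have "\<dots> = ?u * ((\<Sum>i\<in>F. f i powr p) / a powr p) + ?v * ((\<Sum>i\<in>F. g i powr p) / b powr p)"
    by (simp add: sum.distrib sum_distrib_left sum_divide_distrib)
  also have "\<dots> \<le> ?u * 1 + ?v * 1"
    using assms(3,4) fa gb uv by (intro add_mono mult_left_mono) auto
  also have "\<dots> = 1" using uv by simp
  finally show ?thesis using assms(3,4) by (simp add: divide_le_eq)
qed

lemma pth_root_le_iff: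
  assumes "1 \<le> p" "0 \<le> c"
  shows "pth_root p x \<le> ennreal c \<longleftrightarrow> x \<le> ennreal (c powr p)"
proof (cases x)
  case (real r)
  have "r powr (1 / p) \<le> c \<longleftrightarrow> r \<le> c powr p"
  proof
    assume "r powr (1 / p) \<le> c"
    then have "(r powr (1 / p)) powr p \<le> c powr p" using assms by (intro powr_mono2) auto
    then show "r \<le> c powr p" using real assms by (simp add: powr_powr)
  next
    assume "r \<le> c powr p"
    then have "r powr (1 / p) \<le> (c powr p) powr (1 / p)"
      using assms real by (intro powr_mono2) auto
    then show "r powr (1 / p) \<le> c" using assms by (simp add: powr_powr)
  qed
  then show ?thesis using real assms by (simp add: pth_root_def ennreal_le_iff)
qed (use assms in \<open>auto simp: pth_root_def top_unique\<close>)

lemma infsum_ennreal_le_iff: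
  fixes f :: "'i \<Rightarrow> real"
  assumes "\<And>i. 0 \<le> f i" "0 \<le> c"
  shows "(\<Sum>\<^sub>\<infinity>i\<in>I. ennreal (f i)) \<le> ennreal c
           \<longleftrightarrow> (\<forall>F. finite F \<and> F \<subseteq> I \<longrightarrow> (\<Sum>i\<in>F. f i) \<le> c)"
  using assms
  by (subst nonneg_infsum_complete) (auto simp: SUP_le_iff sum_ennreal)

lemma ennreal_le_of_less:
  fixes X Y :: ennreal
  assumes "\<And>c::real. 0 \<le> c \<Longrightarrow> Y < ennreal c \<Longrightarrow> X \<le> ennreal c"
  shows "X \<le> Y"
proof (cases Y)
  case (real y)
  show ?thesis
  proof (rule ennreal_le_epsilon)
    fix e :: real assume "0 < e"
    then have "X \<le> ennreal (y + e)" using real by (intro assms) (auto simp: ennreal_lessI)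
    then show "X \<le> Y + ennreal e" using real \<open>0 < e\<close> by simp
  qed
qed simp

lemma ennreal_le_add_of_less:
  fixes X Y Z :: ennreal
  assumes "\<And>a b::real. 0 < a \<Longrightarrow> 0 < b \<Longrightarrow> Y < ennreal a \<Longrightarrow> Z < ennreal b \<Longrightarrow> X \<le> ennreal (a + b)"
  shows "X \<le> Y + Z"
proof (cases "Y = top \<or> Z = top")
  case False
  then obtain y z where yz: "0 \<le> y" "Y = ennreal y" "0 \<le> z" "Z = ennreal z"
    by (metis ennreal_cases)
  show ?thesis
  proof (rule ennreal_le_epsilon)
    fix e :: real assume e: "0 < e"
    then have "X \<le> ennreal ((y + e / 2) + (z + e / 2))"
      using yz by (intro assms) (auto simp: ennreal_lessI)
    also have "\<dots> = Y + Z + ennreal e" using yz e by (simp add: ennreal_plus[symmetric] del: ennreal_plus)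
    finally show "X \<le> Y + Z + ennreal e" .
  qed
qed auto

text \<open>A family \<open>u\<close> indexed by \<open>I\<close> enumerates the multiset \<open>s\<close>.\<close>

definition enumerates :: "'i set \<Rightarrow> ('i \<Rightarrow> 'a) \<Rightarrow> ('a \<Rightarrow> enat) \<Rightarrow> bool" where
  "enumerates I u s \<longleftrightarrow> (\<forall>x. {i \<in> I. u i = x} \<approx> {k::nat. enat k < s x})"

lemma enumerates_iff:
  "enumerates I u s \<longleftrightarrow> (\<exists>h. bij_betw h I (copies s) \<and> (\<forall>i\<in>I. fst (h i) = u i))"
proof
  assume "enumerates I u s"
  then have "\<forall>x. \<exists>g. bij_betw g {i \<in> I. u i = x} {k::nat. enat k < s x}"
    unfolding enumerates_def eqpoll_def .
  then obtain g where g: "\<And>x. bij_betw (g x) {i \<in> I. u i = x} {k::nat. enat k < s x}"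
    by metis
  let ?h = "\<lambda>i. (u i, g (u i) i)"
  have "inj_on ?h I"
    using g by (auto simp: inj_on_def bij_betw_def)
  moreover have "?h ` I = copies s"
  proof
    show "?h ` I \<subseteq> copies s"
      using bij_betwE[OF g] by (auto simp: copies_def)
    show "copies s \<subseteq> ?h ` I"
    proof
      fix e assume "e \<in> copies s"
      then obtain x k where e: "e = (x, k)" "k \<in> {k. enat k < s x}"
        by (auto simp: copies_def)
      then have "k \<in> g x ` {i \<in> I. u i = x}" using g[of x] by (simp add: bij_betw_def)
      then show "e \<in> ?h ` I" using e by auto
    qed
  qed
  ultimately show "\<exists>h. bij_betw h I (copies s) \<and> (\<forall>i\<in>I. fst (h i) = u i)"
    by (intro exI[of _ ?h]) (auto simp: bij_betw_def)
next
  assume "\<exists>h. bij_betw h I (copies s) \<and> (\<forall>i\<in>I. fst (h i) = u i)"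
  then obtain h where h: "bij_betw h I (copies s)" "\<And>i. i \<in> I \<Longrightarrow> fst (h i) = u i" by auto
  have "bij_betw (snd \<circ> h) {i \<in> I. u i = x} {k::nat. enat k < s x}" for x
    unfolding bij_betw_def
  proof
    show "inj_on (snd \<circ> h) {i \<in> I. u i = x}"
    proof (rule inj_onI)
      fix i j assume ij: "i \<in> {i \<in> I. u i = x}" "j \<in> {i \<in> I. u i = x}" "(snd \<circ> h) i = (snd \<circ> h) j"
      then have "h i = h j" using h(2)[of i] h(2)[of j] by (simp add: prod_eq_iff)
      then show "i = j" using h(1) ij by (auto simp: bij_betw_def inj_on_def)
    qed
    show "(snd \<circ> h) ` {i \<in> I. u i = x} = {k. enat k < s x}"
    proof
      show "(snd \<circ> h) ` {i \<in> I. u i = x} \<subseteq> {k. enat k < s x}"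
      proof
        fix k assume "k \<in> (snd \<circ> h) ` {i \<in> I. u i = x}"
        then obtain i where i: "i \<in> I" "u i = x" "k = snd (h i)" by auto
        have "h i \<in> copies s" using bij_betwE[OF h(1)] i by auto
        then show "k \<in> {k. enat k < s x}" using h(2)[of i] i by (auto simp: copies_def)
      qed
      show "{k. enat k < s x} \<subseteq> (snd \<circ> h) ` {i \<in> I. u i = x}"
      proof
        fix k assume "k \<in> {k. enat k < s x}"
        then have "(x, k) \<in> h ` I" using h(1) by (auto simp: copies_def bij_betw_def)
        then obtain i where i: "i \<in> I" "h i = (x, k)" by auto
        then show "k \<in> (snd \<circ> h) ` {i \<in> I. u i = x}" using h(2)[of i] by (force simp: image_iff)
      qed
    qed
  qed
  then show "enumerates I u s" unfolding enumerates_def eqpoll_def by blast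
qed

lemma enumerates_copies: "enumerates (copies s) fst s"
  unfolding enumerates_iff by (intro exI[of _ id]) auto

lemma enumerates_bij:
  assumes "bij_betw \<phi> (copies s) (copies t)"
  shows "enumerates (copies s) (\<lambda>e. fst (\<phi> e)) t"
  unfolding enumerates_iff using assms by auto

lemma enumerates_comp:
  assumes "enumerates J v t" "bij_betw h I J"
  shows "enumerates I (\<lambda>i. v (h i)) t"
proof -
  obtain g where "bij_betw g J (copies t)" "\<forall>i\<in>J. fst (g i) = v i"
    using assms(1) unfolding enumerates_iff by auto
  then show ?thesis
    unfolding enumerates_iff using bij_betw_trans[OF assms(2), of g] bij_betwE[OF assms(2)]
    by (intro exI[of _ "g \<circ> h"]) auto
qed

lemma eqpoll_enat_plus:
  fixes a b :: enat
  shows "{k::nat. enat k < a} <+> {k::nat. enat k < b} \<approx> {k::nat. enat k < a + b}"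
proof (cases "a = \<infinity> \<or> b = \<infinity>")
  case True
  have inf: "infinite ({k::nat. enat k < a} <+> {k::nat. enat k < b})"
    using True by (auto simp: finite_Plus_iff)
  have "a + b = \<infinity>" using True by auto
  then have "{k::nat. enat k < a + b} = UNIV" by simp
  moreover obtain e :: "nat + nat \<Rightarrow> nat"
    where "bij_betw e ({k::nat. enat k < a} <+> {k::nat. enat k < b}) UNIV"
    using inf by (rule countableE_infinite[rotated]) auto
  ultimately show ?thesis unfolding eqpoll_def by auto
next
  case False
  then obtain m n where "a = enat m" "b = enat n" by auto
  then show ?thesis
    by (intro finite_same_card_bij[folded eqpoll_def, unfolded])
       (auto simp: card_Plus lessThan_def[symmetric] eqpoll_iff_card)
qed

lemma enumerates_plus:
  assumes "enumerates I u s" "enumerates J v t"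
  shows "enumerates (I <+> J) (case_sum u v) (s + t)"
proof -
  have "{i \<in> I <+> J. case_sum u v i = x} \<approx> {k::nat. enat k < (s + t) x}" for x
  proof -
    obtain g h where
      "bij_betw g {i \<in> I. u i = x} {k::nat. enat k < s x}"
      "bij_betw h {j \<in> J. v j = x} {k::nat. enat k < t x}"
      using assms unfolding enumerates_def eqpoll_def by meson
    then have "{i \<in> I. u i = x} <+> {j \<in> J. v j = x}
        \<approx> {k::nat. enat k < s x} <+> {k::nat. enat k < t x}"
      unfolding eqpoll_def
      by (intro exI[of _ "map_sum g h"]) (auto simp: bij_betw_def inj_on_def Plus_def image_Un image_image)
    also have "\<dots> \<approx> {k::nat. enat k < (s + t) x}"
      unfolding plus_fun_apply by (rule eqpoll_enat_plus)
    also have "{i \<in> I. u i = x} <+> {j \<in> J. v j = x} = {i \<in> I <+> J. case_sum u v i = x}" by auto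
    finally show ?thesis .
  qed
  then show ?thesis unfolding enumerates_def by blast
qed

context Metric_space
begin

lemma mset_dist_leI:
  assumes p: "1 \<le> p" and c: "0 \<le> c" and u: "enumerates I u s" and v: "enumerates I v t"
    and le: "\<And>F. finite F \<Longrightarrow> F \<subseteq> I \<Longrightarrow> (\<Sum>i\<in>F. d (u i) (v i) powr p) \<le> c powr p"
  shows "mset_dist p d s t \<le> ennreal c"
proof -
  obtain g where g: "bij_betw g I (copies s)" "\<And>i. i \<in> I \<Longrightarrow> fst (g i) = u i"
    using u unfolding enumerates_iff by auto
  obtain h where h: "bij_betw h I (copies t)" "\<And>i. i \<in> I \<Longrightarrow> fst (h i) = v i"
    using v unfolding enumerates_iff by auto
  let ?g' = "inv_into I g"
  have bg: "bij_betw ?g' (copies s) I" using g(1) by (rule bij_betw_inv_into)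
  have bij: "bij_betw (h \<circ> ?g') (copies s) (copies t)"
    using bij_betw_trans[OF bg h(1)] .
  have "(\<Sum>\<^sub>\<infinity>e\<in>copies s. ennreal (d (fst e) (fst ((h \<circ> ?g') e)) powr p))
      \<le> ennreal (c powr p)"
  proof (subst infsum_ennreal_le_iff, goal_cases)
    case 3
    show ?case
    proof (intro allI impI, elim conjE)
      fix F assume F: "finite F" "F \<subseteq> copies s"
      have mem: "?g' e \<in> I" if "e \<in> F" for e using bij_betwE[OF bg] F that by auto
      have ge: "g (?g' e) = e" if "e \<in> F" for e
        using g(1) F that by (auto intro: bij_betw_inv_into_right)
      have inj: "inj_on ?g' F" using bg F by (meson bij_betw_def inj_on_subset)
      have "(\<Sum>e\<in>F. d (fst e) (fst ((h \<circ> ?g') e)) powr p)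
          = (\<Sum>e\<in>F. d (u (?g' e)) (v (?g' e)) powr p)"
      proof (rule sum.cong)
        fix e assume "e \<in> F"
        then show "d (fst e) (fst ((h \<circ> ?g') e)) powr p = d (u (?g' e)) (v (?g' e)) powr p"
          using g(2)[OF mem, of e] h(2)[OF mem, of e] ge by simp
      qed simp
      also have "\<dots> = (\<Sum>i\<in>?g' ` F. d (u i) (v i) powr p)"
        using inj by (simp add: sum.reindex)
      also have "\<dots> \<le> c powr p" using F mem by (intro le) auto
      finally show "(\<Sum>e\<in>F. d (fst e) (fst ((h \<circ> ?g') e)) powr p) \<le> c powr p" .
    qed
  qed auto
  then have "pth_root p (\<Sum>\<^sub>\<infinity>e\<in>copies s. ennreal (d (fst e) (fst ((h \<circ> ?g') e)) powr p))
      \<le> ennreal c"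
    using pth_root_le_iff[OF p c] by simp
  then show ?thesis
    unfolding mset_dist_def using bij by (intro INF_lower2[of "h \<circ> ?g'"]) auto
qed

lemma mset_dist_lessE:
  assumes p: "1 \<le> p" and c: "0 \<le> c" and less: "mset_dist p d s t < ennreal c"
  obtains \<phi> where "bij_betw \<phi> (copies s) (copies t)"
    "\<And>F. finite F \<Longrightarrow> F \<subseteq> copies s \<Longrightarrow> (\<Sum>e\<in>F. d (fst e) (fst (\<phi> e)) powr p) \<le> c powr p"
proof -
  obtain \<phi> where \<phi>: "bij_betw \<phi> (copies s) (copies t)"
    "pth_root p (\<Sum>\<^sub>\<infinity>e\<in>copies s. ennreal (d (fst e) (fst (\<phi> e)) powr p)) < ennreal c"
    using less unfolding mset_dist_def INF_less_iff by auto
  then have "(\<Sum>\<^sub>\<infinity>e\<in>copies s. ennreal (d (fst e) (fst (\<phi> e)) powr p)) \<le> ennreal (c powr p)"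
    using pth_root_le_iff[OF p c] by (meson less_imp_le)
  then show thesis
    using that[OF \<phi>(1)] by (subst (asm) infsum_ennreal_le_iff) auto
qed

lemma mset_dist_sym_le:
  assumes p: "1 \<le> p" shows "mset_dist p d t s \<le> mset_dist p d s t"
proof (rule ennreal_le_of_less)
  fix c :: real assume c: "0 \<le> c" "mset_dist p d s t < ennreal c"
  then obtain \<phi> where \<phi>: "bij_betw \<phi> (copies s) (copies t)"
    "\<And>F. finite F \<Longrightarrow> F \<subseteq> copies s \<Longrightarrow> (\<Sum>e\<in>F. d (fst e) (fst (\<phi> e)) powr p) \<le> c powr p"
    using mset_dist_lessE[OF p] by blast
  show "mset_dist p d t s \<le> ennreal c"
    using enumerates_bij[OF \<phi>(1)] enumerates_copies[of s] \<phi>(2) c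
    by (intro mset_dist_leI[OF p, of _ "copies s" "\<lambda>e. fst (\<phi> e)" t fst s]) (auto simp: commute)
qed

lemma mset_dist_commute: "1 \<le> p \<Longrightarrow> mset_dist p d s t = mset_dist p d t s"
  by (intro antisym mset_dist_sym_le)

lemma mset_dist_plus_le:
  assumes p: "1 \<le> p" and r: "r \<in> cmsets M"
  shows "mset_dist p d (s + r) (t + r) \<le> mset_dist p d s t"
proof (rule ennreal_le_of_less)
  fix c :: real assume c: "0 \<le> c" "mset_dist p d s t < ennreal c"
  then obtain \<phi> where \<phi>: "bij_betw \<phi> (copies s) (copies t)"
    "\<And>F. finite F \<Longrightarrow> F \<subseteq> copies s \<Longrightarrow> (\<Sum>e\<in>F. d (fst e) (fst (\<phi> e)) powr p) \<le> c powr p"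
    using mset_dist_lessE[OF p] by blast
  let ?I = "copies s <+> copies r"
  let ?u = "case_sum fst fst :: ('a \<times> nat) + ('a \<times> nat) \<Rightarrow> 'a"
  let ?v = "case_sum (\<lambda>e. fst (\<phi> e)) fst :: ('a \<times> nat) + ('a \<times> nat) \<Rightarrow> 'a"
  show "mset_dist p d (s + r) (t + r) \<le> ennreal c"
  proof (rule mset_dist_leI[OF p c(1)])
    show "enumerates ?I ?u (s + r)" by (intro enumerates_plus enumerates_copies)
    show "enumerates ?I ?v (t + r)" by (intro enumerates_plus enumerates_copies enumerates_bij \<phi>(1))
    fix F assume F: "finite F" "F \<subseteq> ?I"
    have "(\<Sum>i\<in>F. d (?u i) (?v i) powr p) = (\<Sum>i\<in>Inl ` (Inl -` F). d (?u i) (?v i) powr p)"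
    proof (rule sum.mono_neutral_right)
      show "\<forall>i\<in>F - Inl ` (Inl -` F). d (?u i) (?v i) powr p = 0"
      proof
        fix i assume i: "i \<in> F - Inl ` (Inl -` F)"
        then obtain e where e: "i = Inr e" by (cases i) auto
        then have "e \<in> copies r" using i F by auto
        then have "fst e \<in> M" using r by (auto simp: copies_def cmsets_def)
        then show "d (?u i) (?v i) powr p = 0" using e by simp
      qed
    qed (use F in auto)
    also have "\<dots> = (\<Sum>e\<in>Inl -` F. d (fst e) (fst (\<phi> e)) powr p)"
      by (subst sum.reindex) (auto simp: inj_on_def)
    also have "\<dots> \<le> c powr p"
      using F by (intro \<phi>(2)) (auto intro: finite_vimageI)
    finally show "(\<Sum>i\<in>F. d (?u i) (?v i) powr p) \<le> c powr p" .
  qed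
qed

lemma mset_dist_triangle:
  assumes p: "1 \<le> p" and M: "s \<in> cmsets M" "t \<in> cmsets M" "r \<in> cmsets M"
  shows "mset_dist p d s r \<le> mset_dist p d s t + mset_dist p d t r"
proof (rule ennreal_le_add_of_less)
  fix a b :: real
  assume ab: "0 < a" "0 < b" "mset_dist p d s t < ennreal a" "mset_dist p d t r < ennreal b"
  obtain \<phi> where \<phi>: "bij_betw \<phi> (copies s) (copies t)"
    "\<And>F. finite F \<Longrightarrow> F \<subseteq> copies s \<Longrightarrow> (\<Sum>e\<in>F. d (fst e) (fst (\<phi> e)) powr p) \<le> a powr p"
    using mset_dist_lessE[OF p less_imp_le[OF ab(1)] ab(3)] by blast
  obtain \<psi> where \<psi>: "bij_betw \<psi> (copies t) (copies r)"
    "\<And>F. finite F \<Longrightarrow> F \<subseteq> copies t \<Longrightarrow> (\<Sum>e\<in>F. d (fst e) (fst (\<psi> e)) powr p) \<le> b powr p"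
    using mset_dist_lessE[OF p less_imp_le[OF ab(2)] ab(4)] by blast
  show "mset_dist p d s r \<le> ennreal (a + b)"
  proof (rule mset_dist_leI[OF p])
    show "enumerates (copies s) fst s" by (rule enumerates_copies)
    show "enumerates (copies s) (\<lambda>e. fst (\<psi> (\<phi> e))) r"
      using enumerates_bij[OF \<psi>(1)] \<phi>(1) by (rule enumerates_comp)
    fix F assume F: "finite F" "F \<subseteq> copies s"
    have inM: "fst e \<in> M" if "e \<in> copies q" "q \<in> cmsets M" for e q
      using that by (auto simp: copies_def cmsets_def)
    have \<phi>F: "\<phi> e \<in> copies t" if "e \<in> F" for e using bij_betwE[OF \<phi>(1)] F that by auto
    have \<psi>F: "\<psi> (\<phi> e) \<in> copies r" if "e \<in> F" for e
      using bij_betwE[OF \<psi>(1)] \<phi>F that by auto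
    have inj: "inj_on \<phi> F" using \<phi>(1) F by (meson bij_betw_def inj_on_subset)
    have "(\<Sum>e\<in>F. d (fst e) (fst (\<psi> (\<phi> e))) powr p)
        \<le> (\<Sum>e\<in>F. (d (fst e) (fst (\<phi> e)) + d (fst (\<phi> e)) (fst (\<psi> (\<phi> e)))) powr p)"
    proof (rule sum_mono)
      fix e assume e: "e \<in> F"
      have "d (fst e) (fst (\<psi> (\<phi> e))) \<le> d (fst e) (fst (\<phi> e)) + d (fst (\<phi> e)) (fst (\<psi> (\<phi> e)))"
        using e F \<phi>F[OF e] \<psi>F[OF e] M by (intro triangle) (auto intro: inM)
      then show "d (fst e) (fst (\<psi> (\<phi> e))) powr p
          \<le> (d (fst e) (fst (\<phi> e)) + d (fst (\<phi> e)) (fst (\<psi> (\<phi> e)))) powr p"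
        using p by (intro powr_mono2) auto
    qed
    also have "\<dots> \<le> (a + b) powr p"
    proof (rule minkowski_powr[OF p F(1) ab(1,2)])
      show "(\<Sum>e\<in>F. d (fst e) (fst (\<phi> e)) powr p) \<le> a powr p" using F by (rule \<phi>(2))
      have "(\<Sum>e\<in>F. d (fst (\<phi> e)) (fst (\<psi> (\<phi> e))) powr p)
          = (\<Sum>e\<in>\<phi> ` F. d (fst e) (fst (\<psi> e)) powr p)"
        using inj by (simp add: sum.reindex)
      also have "\<dots> \<le> b powr p" using F \<phi>F by (intro \<psi>(2)) auto
      finally show "(\<Sum>e\<in>F. d (fst (\<phi> e)) (fst (\<psi> (\<phi> e))) powr p) \<le> b powr p" .
    qed auto
    finally show "(\<Sum>e\<in>F. d (fst e) (fst (\<psi> (\<phi> e))) powr p) \<le> (a + b) powr p" .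
  qed (use ab in auto)
qed

end

lemma cmsets_plus: "s \<in> cmsets Y \<Longrightarrow> t \<in> cmsets Y \<Longrightarrow> s + t \<in> cmsets Y"
proof -
  assume st: "s \<in> cmsets Y" "t \<in> cmsets Y"
  have "{x. (s + t) x \<noteq> 0} = {x. s x \<noteq> 0} \<union> {x. t x \<noteq> 0}" by auto
  then show ?thesis using st by (simp add: cmsets_def)
qed

lemma cmsets_zero: "0 \<in> cmsets Y"
  by (simp add: cmsets_def)

lemma cmsets_mono: "Y \<subseteq> Z \<Longrightarrow> s \<in> cmsets Y \<Longrightarrow> s \<in> cmsets Z"
  by (auto simp: cmsets_def)

lemma equiv_diag_rel: "equiv (cmsets M) (diag_rel M A)"
proof (rule equivI)
  show "diag_rel M A \<subseteq> cmsets M \<times> cmsets M" by (auto simp: diag_rel_def)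
  show "refl_on (cmsets M) (diag_rel M A)"
    using cmsets_zero by (auto simp: refl_on_def diag_rel_def)
  show "sym (diag_rel M A)" by (auto simp: sym_def diag_rel_def) metis
  show "trans (diag_rel M A)"
  proof (rule transI)
    fix s t r assume "(s, t) \<in> diag_rel M A" "(t, r) \<in> diag_rel M A"
    then obtain a b a' b' where *: "s \<in> cmsets M" "t \<in> cmsets M" "r \<in> cmsets M"
      "a \<in> cmsets A" "b \<in> cmsets A" "a' \<in> cmsets A" "b' \<in> cmsets A"
      "s + a = t + b" "t + a' = r + b'"
      by (auto simp: diag_rel_def)
    have "s + (a + a') = (t + b) + a'" using *(8) by (simp add: add.assoc[symmetric])
    also have "\<dots> = (t + a') + b" by (simp add: ac_simps)
    also have "\<dots> = r + (b' + b)" using *(9) by (simp add: add.assoc)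
    finally have "s + (a + a') = r + (b' + b)" .
    then show "(s, r) \<in> diag_rel M A" using * cmsets_plus unfolding diag_rel_def by blast
  qed
qed

context metric_pair
begin

lemma A_subset: "A \<subseteq> M"
  using closed_A closedin_subset by fastforce

lemma rep_dist_commute: "1 \<le> p \<Longrightarrow> rep_dist p d A s t = rep_dist p d A t s"
  unfolding rep_dist_def by (subst INF_commute) (simp add: mset_dist_commute)

lemma rep_dist_lessE:
  assumes "rep_dist p d A s t < c"
  obtains a b where "a \<in> cmsets A" "b \<in> cmsets A" "mset_dist p d (s + a) (t + b) < c"
  using assms unfolding rep_dist_def INF_less_iff by auto

lemma rep_dist_leI:
  assumes "a \<in> cmsets A" "b \<in> cmsets A" "mset_dist p d (s + a) (t + b) \<le> c"
  shows "rep_dist p d A s t \<le> c"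
  unfolding rep_dist_def by (rule INF_lower2[OF assms(1)], rule INF_lower2[OF assms(2)]) fact

lemma rep_dist_triangle:
  assumes p: "1 \<le> p" and M: "s \<in> cmsets M" "t \<in> cmsets M" "r \<in> cmsets M"
  shows "rep_dist p d A s r \<le> rep_dist p d A s t + rep_dist p d A t r"
proof (rule ennreal_le_add_of_less)
  fix x y :: real
  assume xy: "0 < x" "0 < y" "rep_dist p d A s t < ennreal x" "rep_dist p d A t r < ennreal y"
  obtain a b where ab: "a \<in> cmsets A" "b \<in> cmsets A" "mset_dist p d (s + a) (t + b) < ennreal x"
    using rep_dist_lessE[OF xy(3)] .
  obtain a' b' where ab': "a' \<in> cmsets A" "b' \<in> cmsets A" "mset_dist p d (t + a') (r + b') < ennreal y"
    using rep_dist_lessE[OF xy(4)] .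
  have inM: "q \<in> cmsets M" if "q \<in> cmsets A" for q using cmsets_mono[OF A_subset that] .
  have 1: "mset_dist p d (s + a + a') (t + b + a') \<le> mset_dist p d (s + a) (t + b)"
    using inM ab' by (intro mset_dist_plus_le[OF p])
  have 2: "mset_dist p d (t + a' + b) (r + b' + b) \<le> mset_dist p d (t + a') (r + b')"
    using inM ab by (intro mset_dist_plus_le[OF p])
  have "mset_dist p d (s + a + a') (r + b' + b)
      \<le> mset_dist p d (s + a + a') (t + b + a') + mset_dist p d (t + b + a') (r + b' + b)"
    using M ab ab' inM by (intro mset_dist_triangle[OF p] cmsets_plus) auto
  also have "\<dots> \<le> mset_dist p d (s + a) (t + b) + mset_dist p d (t + a') (r + b')"
    using 1 2 by (intro add_mono) (auto simp: ac_simps)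
  also have "\<dots> \<le> ennreal x + ennreal y" using ab ab' by (intro add_mono) auto
  also have "\<dots> = ennreal (x + y)" using xy by simp
  finally show "rep_dist p d A s r \<le> ennreal (x + y)"
    using ab ab' cmsets_plus
    by (intro rep_dist_leI[of "a + a'" "b' + b"]) (auto simp: add.assoc)
qed

lemma rep_dist_rel:
  assumes p: "1 \<le> p" and "(s, t) \<in> diag_rel M A"
  shows "rep_dist p d A s t = 0"
proof -
  obtain a b where ab: "s \<in> cmsets M" "t \<in> cmsets M" "a \<in> cmsets A" "b \<in> cmsets A" "s + a = t + b"
    using assms(2) by (auto simp: diag_rel_def)
  have "s + a \<in> cmsets M" using ab A_subset cmsets_mono cmsets_plus by blast
  then have "fst e \<in> M" if "e \<in> copies (s + a)" for e
    using that by (auto simp: cmsets_def copies_def)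
  then have "mset_dist p d (s + a) (s + a) \<le> ennreal 0"
    by (intro mset_dist_leI[OF p _ enumerates_copies enumerates_copies])
       (auto intro!: sum_nonpos)
  then have "rep_dist p d A s t \<le> ennreal 0" using ab by (intro rep_dist_leI[of a b]) auto
  then show ?thesis by simp
qed

lemma rep_dist_cong:
  assumes p: "1 \<le> p" and "(s, s') \<in> diag_rel M A" "(t, t') \<in> diag_rel M A"
  shows "rep_dist p d A s t = rep_dist p d A s' t'"
proof -
  have le: "rep_dist p d A s t \<le> rep_dist p d A s' t'"
    if "(s, s') \<in> diag_rel M A" "(t, t') \<in> diag_rel M A" for s s' t t'
  proof -
    have M: "s \<in> cmsets M" "s' \<in> cmsets M" "t \<in> cmsets M" "t' \<in> cmsets M"
      using that by (auto simp: diag_rel_def)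
    have "rep_dist p d A s t \<le> rep_dist p d A s s' + (rep_dist p d A s' t' + rep_dist p d A t' t)"
      using rep_dist_triangle[OF p, of s s' t] rep_dist_triangle[OF p, of s' t' t] M
      by (meson add_left_mono order_trans)
    then show ?thesis
      using rep_dist_rel[OF p that(1)] rep_dist_rel[OF p that(2)] rep_dist_commute[OF p, of t' t]
      by simp
  qed
  have "(s', s) \<in> diag_rel M A" "(t', t) \<in> diag_rel M A"
    using assms(2,3) equiv_diag_rel[of M A] by (auto elim: equivE dest: symD)
  then show ?thesis using le assms(2,3) by (intro antisym) auto
qed

text \<open>Off \<open>A\<close>, a multiset at finite distance from the empty diagram accumulates only at \<open>A\<close>.\<close>

lemma finite_far:
  assumes p: "1 \<le> p" and s: "s \<in> cmsets M" and fin: "rep_dist p d A s 0 < \<infinity>" and \<delta>: "0 < \<delta>"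
  shows "finite {x. s x \<noteq> 0 \<and> (\<forall>a\<in>A. \<delta> \<le> d x a)}"
proof -
  obtain a b where ab: "a \<in> cmsets A" "b \<in> cmsets A" "mset_dist p d (s + a) (0 + b) < \<infinity>"
    using rep_dist_lessE[OF fin] .
  then obtain r where r: "0 \<le> r" "mset_dist p d (s + a) b = ennreal r"
    by (cases "mset_dist p d (s + a) b") auto
  define c where "c = r + 1"
  have c: "0 \<le> c" "mset_dist p d (s + a) b < ennreal c"
    using r by (auto simp: c_def ennreal_lessI simp del: ennreal_plus)
  obtain \<phi> where \<phi>: "bij_betw \<phi> (copies (s + a)) (copies b)"
    "\<And>F. finite F \<Longrightarrow> F \<subseteq> copies (s + a) \<Longrightarrow> (\<Sum>e\<in>F. d (fst e) (fst (\<phi> e)) powr p) \<le> c powr p"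
    using mset_dist_lessE[OF p c] by blast
  let ?E = "(\<lambda>x. (x, 0::nat)) ` {x. s x \<noteq> 0 \<and> (\<forall>a\<in>A. \<delta> \<le> d x a)}"
  have E: "?E \<subseteq> copies (s + a)"
  proof
    fix e assume "e \<in> ?E"
    then obtain x where x: "e = (x, 0)" "s x \<noteq> 0" by auto
    then have "0 < s x + a x" by simp
    then show "e \<in> copies (s + a)" using x by (simp add: copies_def zero_enat_def)
  qed
  have "finite ?E"
  proof (rule ccontr)
    assume "infinite ?E"
    have "0 < \<delta> powr p" using \<delta> by simp
    then obtain n :: nat where n: "c powr p < real n * \<delta> powr p"
      using reals_Archimedean3 by blast
    from infinite_arbitrarily_large[OF \<open>infinite ?E\<close>, of n]
    obtain F where "finite F \<and> card F = n \<and> F \<subseteq> ?E" ..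
    then have F: "finite F" "F \<subseteq> ?E" "card F = n" by simp_all
    have "real n * \<delta> powr p = (\<Sum>e\<in>F. \<delta> powr p)" using F by simp
    also have "\<dots> \<le> (\<Sum>e\<in>F. d (fst e) (fst (\<phi> e)) powr p)"
    proof (rule sum_mono)
      fix e assume e: "e \<in> F"
      have "e \<in> copies (s + a)" using e F(2) E by (rule subsetD[OF subset_trans, rotated 2])
      then have "\<phi> e \<in> copies b" using bij_betwE[OF \<phi>(1)] by simp
      then have "fst (\<phi> e) \<in> A" using ab by (auto simp: copies_def cmsets_def)
      then have "\<delta> \<le> d (fst e) (fst (\<phi> e))" using e F by auto
      then show "\<delta> powr p \<le> d (fst e) (fst (\<phi> e)) powr p" using \<delta> p by (intro powr_mono2) auto
    qed
    also have "\<dots> \<le> c powr p" using F E by (intro \<phi>(2)) auto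
    finally show False using n by simp
  qed
  then show ?thesis by (rule finite_imageD) (auto simp: inj_on_def)
qed

lemma rep_dist_zero_le:
  assumes p: "1 \<le> p" and M: "s \<in> cmsets M" "t \<in> cmsets M"
    and fin: "rep_dist p d A t 0 < \<infinity>" and eq0: "rep_dist p d A s t = 0"
    and x: "x \<in> M" "x \<notin> A"
  shows "s x \<le> t x"
proof -
  have "openin mtopology (M - A)"
    using closed_A by (metis openin_diff openin_topspace topspace_mtopology)
  then obtain \<delta> where \<delta>: "0 < \<delta>" "mball x \<delta> \<subseteq> M - A"
    using x by (auto simp: openin_mtopology)
  let ?S = "{y. t y \<noteq> 0 \<and> (\<forall>a\<in>A. \<delta> / 2 \<le> d y a)}"
  have finS: "finite ?S" using finite_far[OF p M(2) fin, of "\<delta> / 2"] \<delta> by simp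
  let ?T = "insert (\<delta> / 2) ((\<lambda>y. d x y) ` (?S - {x}))"
  define \<epsilon> where "\<epsilon> = Min ?T"
  have finT: "finite ?T" "?T \<noteq> {}" using finS by auto
  have S_M: "y \<in> M" if "y \<in> ?S" for y using that M(2) by (auto simp: cmsets_def)
  have pos: "0 < z" if z: "z \<in> ?T" for z
  proof (cases "z = \<delta> / 2")
    case False
    then obtain y where y: "y \<in> ?S" "y \<noteq> x" "z = d x y" using z by auto
    then have "d x y \<noteq> 0" using zero[of x y] S_M x by auto
    then have "0 < d x y" using nonneg[of x y] by linarith
    then show ?thesis using y(3) by blast
  qed (use \<delta> in auto)
  have \<epsilon>: "0 < \<epsilon>" "\<epsilon> \<le> \<delta> / 2" "\<And>y. y \<in> ?S \<Longrightarrow> y \<noteq> x \<Longrightarrow> \<epsilon> \<le> d x y"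
  proof -
    show "0 < \<epsilon>" unfolding \<epsilon>_def using pos[OF Min_in[OF finT]] .
    show "\<epsilon> \<le> \<delta> / 2" unfolding \<epsilon>_def using finT by (intro Min_le) auto
    show "\<epsilon> \<le> d x y" if "y \<in> ?S" "y \<noteq> x" for y
      unfolding \<epsilon>_def using finT that by (intro Min_le) auto
  qed
  obtain a b where ab: "a \<in> cmsets A" "b \<in> cmsets A" "mset_dist p d (s + a) (t + b) < ennreal (\<epsilon> / 2)"
    using rep_dist_lessE[of p s t "ennreal (\<epsilon> / 2)"] assms(5) \<epsilon>(1) by auto
  have half_ge0: "0 \<le> \<epsilon> / 2" using \<epsilon>(1) by simp
  obtain \<phi> where \<phi>: "bij_betw \<phi> (copies (s + a)) (copies (t + b))"
    "\<And>F. finite F \<Longrightarrow> F \<subseteq> copies (s + a) \<Longrightarrow> (\<Sum>e\<in>F. d (fst e) (fst (\<phi> e)) powr p) \<le> (\<epsilon> / 2) powr p"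
    using mset_dist_lessE[OF p half_ge0 ab(3)] by blast
  have a0: "a x = 0" using ab x by (auto simp: cmsets_def)
  have key: "fst (\<phi> (x, k)) = x \<and> enat (snd (\<phi> (x, k))) < t x" if "enat k < s x" for k
  proof -
    have mem: "(x, k) \<in> copies (s + a)" using that a0 by (simp add: copies_def)
    obtain y j where yj: "\<phi> (x, k) = (y, j)" by fastforce
    have "\<phi> (x, k) \<in> copies (t + b)" using bij_betwE[OF \<phi>(1)] mem by simp
    then have yj': "enat j < t y + b y" using yj by (simp add: copies_def)
    have "y \<in> M"
    proof (rule ccontr)
      assume "y \<notin> M"
      then have "t y = 0" "b y = 0" using M(2) ab A_subset by (auto simp: cmsets_def)
      then show False using yj' by simp
    qed
    have "d x y powr p \<le> (\<epsilon> / 2) powr p" using \<phi>(2)[of "{(x, k)}"] mem yj by simp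
    then have dxy: "d x y \<le> \<epsilon> / 2"
      using p \<epsilon>(1) powr_less_mono2[of p "\<epsilon> / 2" "d x y"] by (auto simp: not_le[symmetric])
    have "y \<in> mball x \<delta>" using dxy \<epsilon> \<delta>(1) x \<open>y \<in> M\<close> by auto
    then have yA: "y \<notin> A" using \<delta> by auto
    then have b0: "b y = 0" using ab by (auto simp: cmsets_def)
    then have ty: "enat j < t y" using yj' by simp
    have "\<delta> / 2 \<le> d y z" if "z \<in> A" for z
    proof -
      have "z \<in> M" using that A_subset by auto
      then have "\<delta> \<le> d x z" using \<delta>(2) that x by (meson DiffD2 in_mball linorder_not_le subsetD)
      moreover have "d x z \<le> d x y + d y z" using x \<open>y \<in> M\<close> \<open>z \<in> M\<close> by (intro triangle)
      ultimately show ?thesis using dxy \<epsilon>(1,2) by linarith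
    qed
    moreover have "t y \<noteq> 0" using ty by auto
    ultimately have "y \<in> ?S" by auto
    then have "y = x" using \<epsilon>(3)[of y] dxy \<epsilon>(1) by fastforce
    then show ?thesis using yj ty by simp
  qed
  have inj: "inj_on (\<lambda>k. snd (\<phi> (x, k))) {k. enat k < s x}"
  proof (rule inj_onI)
    fix k l assume kl: "k \<in> {k. enat k < s x}" "l \<in> {k. enat k < s x}"
      "snd (\<phi> (x, k)) = snd (\<phi> (x, l))"
    then have eq: "\<phi> (x, k) = \<phi> (x, l)" using key[of k] key[of l] by (simp add: prod_eq_iff)
    have "(x, k) \<in> copies (s + a)" "(x, l) \<in> copies (s + a)" using kl a0 by (auto simp: copies_def)
    then have "(x, k) = (x, l)" using eq \<phi>(1) unfolding bij_betw_def by (meson inj_onD)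
    then show "k = l" by simp
  qed
  show ?thesis
  proof (cases "t x")
    case (enat n)
    show ?thesis
    proof (rule ccontr)
      assume "\<not> s x \<le> t x"
      then have sub: "{..n} \<subseteq> {k. enat k < s x}"
        using enat by (auto simp: not_le intro: le_less_trans[of "enat _" "enat n"])
      have "(\<lambda>k. snd (\<phi> (x, k))) ` {..n} \<subseteq> {..<n}"
      proof
        fix j assume "j \<in> (\<lambda>k. snd (\<phi> (x, k))) ` {..n}"
        then obtain k where k: "k \<in> {..n}" "j = snd (\<phi> (x, k))" by auto
        then have "enat k < s x" using sub by auto
        then show "j \<in> {..<n}" using key[of k] k enat by simp
      qed
      then have "card {..n} \<le> card {..<n}"
        using inj_on_subset[OF inj sub] by (intro card_inj_on_le) auto
      then show False by simp
    qed
  qed auto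
qed

lemma rep_dist_zero_imp_rel:
  assumes p: "1 \<le> p" and M: "s \<in> cmsets M" "t \<in> cmsets M"
    and fin: "rep_dist p d A s 0 < \<infinity>" "rep_dist p d A t 0 < \<infinity>" and eq0: "rep_dist p d A s t = 0"
  shows "(s, t) \<in> diag_rel M A"
proof -
  have eq: "s x = t x" if "x \<notin> A" for x
  proof (cases "x \<in> M")
    case True
    have "rep_dist p d A t s = 0" using eq0 rep_dist_commute[OF p] by simp
    then show ?thesis
      using rep_dist_zero_le[OF p M fin(2) eq0 True that]
        rep_dist_zero_le[OF p M(2,1) fin(1) _ True that] by simp
  next
    case False
    then have "s x = 0" "t x = 0" using M by (auto simp: cmsets_def)
    then show ?thesis by simp
  qed
  let ?a = "\<lambda>x. if x \<in> A then t x else 0" and ?b = "\<lambda>x. if x \<in> A then s x else 0"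
  have "?a \<in> cmsets A" "?b \<in> cmsets A"
    using M unfolding cmsets_def by (auto elim: countable_subset[rotated] split: if_splits)
  moreover have "s + ?a = t + ?b" using eq by (auto simp: fun_eq_iff add.commute)
  ultimately show ?thesis using M unfolding diag_rel_def by blast
qed

lemma diag_edist_eq:
  assumes p: "1 \<le> p" and "S \<in> diagrams M A" "T \<in> diagrams M A" "s \<in> S" "t \<in> T"
  shows "diag_edist p d A S T = rep_dist p d A s t"
proof -
  have rel: "(x, y) \<in> diag_rel M A" if "Q \<in> diagrams M A" "x \<in> Q" "y \<in> Q" for Q x y
    using that quotient_eq_iff[OF equiv_diag_rel, of Q M A Q x y] by (simp add: diagrams_def)
  have "rep_dist p d A s' t' = rep_dist p d A s t" if "s' \<in> S" "t' \<in> T" for s' t'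
    using rel assms that by (intro rep_dist_cong[OF p]) auto
  then have "diag_edist p d A S T = (INF s'\<in>S. INF t'\<in>T. rep_dist p d A s t)"
    unfolding diag_edist_def by simp
  then show ?thesis using assms(4,5) by (auto simp: INF_constant)
qed

lemma Metric_space_pdiagrams:
  assumes p: "1 \<le> p"
  shows "Metric_space (pdiagrams p M d A) (pdist p d A)"
proof -
  let ?E = "empty_diagram M A"
  have E: "?E \<in> diagrams M A" "0 \<in> ?E"
    using equiv_class_self[OF equiv_diag_rel cmsets_zero]
    by (auto simp: empty_diagram_def diagrams_def quotientI cmsets_zero)
  have rep: "\<exists>s. s \<in> S \<and> s \<in> cmsets M \<and> S \<in> diagrams M A \<and> rep_dist p d A s 0 < \<infinity>"
    if "S \<in> pdiagrams p M d A" for S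
  proof -
    have S: "S \<in> diagrams M A" "diag_edist p d A S ?E < \<infinity>" using that by (auto simp: pdiagrams_def)
    then obtain s where s: "s \<in> cmsets M" "S = diag_rel M A `` {s}"
      by (auto simp: diagrams_def elim: quotientE)
    then have "s \<in> S" using equiv_class_self[OF equiv_diag_rel] by blast
    then show ?thesis using S s diag_edist_eq[OF p S(1) E(1) _ E(2)] by auto
  qed
  have finite: "rep_dist p d A s t < \<infinity>"
    if "s \<in> cmsets M" "t \<in> cmsets M" "rep_dist p d A s 0 < \<infinity>" "rep_dist p d A t 0 < \<infinity>" for s t
  proof -
    have "rep_dist p d A s t \<le> rep_dist p d A s 0 + rep_dist p d A 0 t"
      using that by (intro rep_dist_triangle[OF p] cmsets_zero)
    also have "\<dots> < \<infinity>" using that rep_dist_commute[OF p, of 0 t] by (simp add: ennreal_add_less_top)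
    finally show ?thesis .
  qed
  show ?thesis
  proof
    fix S T R
    show "0 \<le> pdist p d A S T" by (simp add: pdist_def)
    show "pdist p d A S T = pdist p d A T S"
      unfolding pdist_def diag_edist_def by (subst INF_commute) (simp add: rep_dist_commute[OF p])
    assume S: "S \<in> pdiagrams p M d A" and T: "T \<in> pdiagrams p M d A"
    obtain s where s: "s \<in> S" "s \<in> cmsets M" "S \<in> diagrams M A" "rep_dist p d A s 0 < \<infinity>"
      using rep[OF S] by auto
    obtain t where t: "t \<in> T" "t \<in> cmsets M" "T \<in> diagrams M A" "rep_dist p d A t 0 < \<infinity>"
      using rep[OF T] by auto
    have st: "diag_edist p d A S T = rep_dist p d A s t"
      using s t by (intro diag_edist_eq[OF p])
    show "pdist p d A S T = 0 \<longleftrightarrow> S = T"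
    proof
      assume "pdist p d A S T = 0"
      then have "rep_dist p d A s t = 0"
        using st finite[OF s(2) t(2) s(4) t(4)] by (auto simp: pdist_def enn2real_eq_0_iff)
      then have "(s, t) \<in> diag_rel M A" using rep_dist_zero_imp_rel[OF p s(2) t(2) s(4) t(4)] by simp
      then show "S = T"
        using quotient_eq_iff[OF equiv_diag_rel, of S M A T s t] s t by (simp add: diagrams_def)
    next
      assume "S = T"
      then have "(s, t) \<in> diag_rel M A"
        using quotient_eq_iff[OF equiv_diag_rel, of S M A T s t] s t by (simp add: diagrams_def)
      then show "pdist p d A S T = 0" using st rep_dist_rel[OF p] by (simp add: pdist_def)
    qed
    assume R: "R \<in> pdiagrams p M d A"
    obtain r where r: "r \<in> R" "r \<in> cmsets M" "R \<in> diagrams M A" "rep_dist p d A r 0 < \<infinity>"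
      using rep[OF R] by auto
    have "rep_dist p d A s r \<le> rep_dist p d A s t + rep_dist p d A t r"
      using s t r by (intro rep_dist_triangle[OF p])
    then have "enn2real (rep_dist p d A s r) \<le> enn2real (rep_dist p d A s t + rep_dist p d A t r)"
      using finite s t r by (intro enn2real_mono) (auto simp: ennreal_add_less_top)
    also have "\<dots> = enn2real (rep_dist p d A s t) + enn2real (rep_dist p d A t r)"
      using finite s t r by (intro enn2real_plus) auto
    finally show "pdist p d A S R \<le> pdist p d A S T + pdist p d A T R"
      using st diag_edist_eq[OF p s(3) r(3) s(1) r(1)] diag_edist_eq[OF p t(3) r(3) t(1) r(1)]
      by (simp add: pdist_def)
  qed
qed

end

end

theory Submission
  imports Defs "HOL-Complex_Analysis.Great_Picard"
begin

text \<open>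
  Diagrams are represented by families of points of \<open>M\<close>; two families represent the same diagram
  iff they agree off \<open>A\<close> up to a bijection, and \<open>d\<^sub>p\<close> is the infimum of the \<open>\<ell>\<^sup>p\<close>-distances of
  families representing the two diagrams. Couplings that share a diagram can be glued. Gluing along a
  chain reduces completeness to pointwise limits. If \<open>M\<close> is proper, couplings have a compactness
  property, so optimal couplings exist, and interpolating along geodesics of \<open>M\<close> gives geodesics of
  diagrams.

  For (4), Toponogov's globalization argument shows that a proper Alexandrov space \<open>M\<close>
  satisfies the inequality
  \<open>(\<Sum>i<j. l\<^sub>i * l\<^sub>j * (d y\<^sub>i y\<^sub>j)\<^sup>2) \<le> (\<Sum>i. l\<^sub>i) * (\<Sum>i. l\<^sub>i * (d x y\<^sub>i)\<^sup>2)\<close>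
  for any four points \<open>x, y\<^sub>1, y\<^sub>2, y\<^sub>3\<close> and weights \<open>l\<^sub>i \<ge> 0\<close>. It is quadratic in the distances, so it
  passes to diagrams by gluing three almost optimal couplings along \<open>x\<close>, and it implies the
  triangle comparison, even globally.
\<close>

section \<open>Unit speed geodesics\<close>

text \<open>For (4) the obstacle is that the space of diagrams need not be proper, so the
  globalization argument cannot be run there, and that little more than distances is known about its
  geodesics. What is carried over must therefore speak of points and distances alone. In the four
  point inequality the distances among the three outer points stand on the smaller side and those to
  the centre on the larger side: any families representing the outer diagrams bound the former from
  above, while almost optimal couplings with the centre control the latter. Its proof in
  \<open>M\<close> needs a direction opposite to one of the three; hence the centre is first pushed
  a little along a geodesic towards \<open>y\<^sub>3\<close>. For (3) the obstacle is that
  representatives change with the coupling and that partners may escape to infinity in a limit.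
  Fixing both families leaves partial matchings of natural numbers, among which subsequences
  converge. As only finitely many points of a diagram lie further than a given distance from
  \<open>A\<close>, whatever escapes is absorbed by projecting to \<open>A\<close> at no extra
  cost.\<close>

context Metric_space
begin

definition unit_speed :: "real \<Rightarrow> (real \<Rightarrow> 'a) \<Rightarrow> bool" where
  "unit_speed L \<gamma> \<longleftrightarrow>
     0 \<le> L \<and> (\<forall>t\<in>{0..L}. \<gamma> t \<in> M) \<and> (\<forall>s\<in>{0..L}. \<forall>t\<in>{0..L}. d (\<gamma> s) (\<gamma> t) = \<bar>s - t\<bar>)"

lemma unit_speed_in: "unit_speed L \<gamma> \<Longrightarrow> 0 \<le> t \<Longrightarrow> t \<le> L \<Longrightarrow> \<gamma> t \<in> M"
  by (simp add: unit_speed_def)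

lemma unit_speed_dist:
  "unit_speed L \<gamma> \<Longrightarrow> 0 \<le> s \<Longrightarrow> s \<le> L \<Longrightarrow> 0 \<le> t \<Longrightarrow> t \<le> L \<Longrightarrow> d (\<gamma> s) (\<gamma> t) = \<bar>s - t\<bar>"
  by (simp add: unit_speed_def)

lemma unit_speed_shift:
  "unit_speed L \<gamma> \<Longrightarrow> 0 \<le> a \<Longrightarrow> a \<le> L \<Longrightarrow> 0 \<le> L' \<Longrightarrow> a + L' \<le> L \<Longrightarrow> unit_speed L' (\<lambda>t. \<gamma> (a + t))"
  by (auto simp: unit_speed_def)

lemma unit_speed_reverse:
  assumes "unit_speed L \<gamma>" "0 \<le> L'" "L' \<le> a" "a \<le> L"
  shows "unit_speed L' (\<lambda>t. \<gamma> (a - t))"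
  using assms by (auto simp: unit_speed_def)

lemma unit_speed_mono: "unit_speed L \<gamma> \<Longrightarrow> 0 \<le> L' \<Longrightarrow> L' \<le> L \<Longrightarrow> unit_speed L' \<gamma>"
  by (auto simp: unit_speed_def)

lemma minimizing_geodesic_add:
  assumes g: "minimizing_geodesic M d x y g" and st: "0 \<le> s" "s \<le> t" "t \<le> 1"
  shows "d x (g s) + d (g s) (g t) + d (g t) y \<le> d x y"
proof -
  have g': "g 0 = x" "g 1 = y" "curve_length d g = ennreal (d x y)"
    using g by (auto simp: minimizing_geodesic_def)
  \<comment> \<open>The partition 0, \<open>s\<close>, \<open>t\<close>, 1; the sum over it is one
    of those under the supremum in \<open>curve_length\<close>.\<close>
  let ?t = "\<lambda>i::nat. if i = 0 then 0 else if i = 1 then s else if i = 2 then t else (1::real)"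
  have "(\<Sum>i<3. ennreal (d (g (?t i)) (g (?t (Suc i))))) \<le> curve_length d g"
    unfolding curve_length_def
    by (rule SUP_upper2[of "(3, ?t)"]) (use st in \<open>auto simp: mono_on_def\<close>)
  moreover have "(\<Sum>i<3. ennreal (d (g (?t i)) (g (?t (Suc i)))))
      = ennreal (d x (g s) + d (g s) (g t) + d (g t) y)"
    using g' by (simp add: eval_nat_numeral)
  ultimately have "ennreal (d x (g s) + d (g s) (g t) + d (g t) y) \<le> ennreal (d x y)"
    using g'(3) by argo
  then show ?thesis by (subst (asm) ennreal_le_iff) auto
qed

lemma minimizing_geodesic_in:
  assumes g: "minimizing_geodesic M d x y g" and "0 \<le> t" "t \<le> 1"
  shows "g t \<in> M"
proof -
  have "continuous_map (top_of_set {0..1}) mtopology g"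
    using g by (simp add: minimizing_geodesic_def pathin_def)
  then show ?thesis using continuous_map_image_subset_topspace assms(2,3) by fastforce
qed

lemma minimizing_geodesic_between:
  assumes g: "minimizing_geodesic M d x y g" and "z \<in> g ` {0..1}"
  shows "z \<in> M" "d x z + d z y = d x y"
proof -
  obtain t where t: "0 \<le> t" "t \<le> 1" "z = g t" using assms(2) by auto
  show zM: "z \<in> M" using minimizing_geodesic_in[OF g] t by simp
  have "x \<in> M" "y \<in> M"
    using minimizing_geodesic_in[OF g, of 0] minimizing_geodesic_in[OF g, of 1] g
    by (auto simp: minimizing_geodesic_def)
  then show "d x z + d z y = d x y"
    using minimizing_geodesic_add[OF g t(1) order_refl t(2)] t zM triangle[of x z y] by simp
qed

text \<open>Distance from \<open>x\<close> serves as arc length: along a minimizing geodesic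
  \<open>d (g s) (g t)\<close> is the difference of the values of \<open>\<phi>\<close>. Hence any
  right inverse \<open>\<sigma>\<close> of \<open>\<phi>\<close>, continuous or not, gives the
  reparametrization.\<close>

lemma minimizing_geodesic_unit_speed:
  assumes g: "minimizing_geodesic M d x y g"
  obtains \<gamma> where "unit_speed (d x y) \<gamma>" "\<gamma> 0 = x" "\<gamma> (d x y) = y"
proof -
  define \<phi> where "\<phi> s = d x (g s)" for s
  have gM: "g t \<in> M" if "0 \<le> t" "t \<le> 1" for t
    using minimizing_geodesic_in[OF g that] .
  have ends: "g 0 = x" "g 1 = y" using g by (auto simp: minimizing_geodesic_def)
  then have xy: "x \<in> M" "y \<in> M" using gM[of 0] gM[of 1] by auto
  have sum: "d x (g s) + d (g s) (g t) + d (g t) y \<le> d x y" if "0 \<le> s" "s \<le> t" "t \<le> 1" for s t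
    using minimizing_geodesic_add[OF g that] .
  have dist: "d (g s) (g t) = \<phi> t - \<phi> s" if "0 \<le> s" "s \<le> t" "t \<le> 1" for s t
    using sum[OF that] triangle[of x "g s" "g t"] triangle[of x "g t" y] gM that xy
    by (simp add: \<phi>_def)
  have cont: "continuous_on {0..1} \<phi>"
    unfolding continuous_on_iff
  proof (intro ballI allI impI)
    fix s e :: real assume s: "s \<in> {0..1}" and e: "0 < e"
    have "continuous_map (top_of_set {0..1}) mtopology g"
      using g by (simp add: minimizing_geodesic_def pathin_def)
    then obtain U where U: "openin (top_of_set {0..1}) U" "s \<in> U" "\<And>t. t \<in> U \<Longrightarrow> g t \<in> mball (g s) e"
      using s e unfolding continuous_map_to_metric by (metis topspace_euclidean_subtopology)
    then obtain \<delta> where \<delta>: "0 < \<delta>" "\<And>t. t \<in> {0..1} \<Longrightarrow> dist t s < \<delta> \<Longrightarrow> t \<in> U"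
      by (metis openin_euclidean_subtopology_iff)
    show "\<exists>\<delta>>0. \<forall>t\<in>{0..1}. dist t s < \<delta> \<longrightarrow> dist (\<phi> t) (\<phi> s) < e"
    proof (intro exI[of _ \<delta>] conjI ballI impI)
      fix t assume t: "t \<in> {0..1}" "dist t s < \<delta>"
      have "d (g s) (g t) < e" using U(3)[OF \<delta>(2)[OF t]] by simp
      then show "dist (\<phi> t) (\<phi> s) < e"
        using dist[of s t] dist[of t s] s t commute[of "g s" "g t"]
          nonneg[of "g s" "g t"]
        by (cases "s \<le> t") (auto simp: dist_real_def abs_if)
    qed (rule \<delta>)
  qed
  have ends': "\<phi> 0 = 0" "\<phi> 1 = d x y" using ends xy by (auto simp: \<phi>_def)
  have "\<exists>s. 0 \<le> s \<and> s \<le> 1 \<and> \<phi> s = t" if "0 \<le> t" "t \<le> d x y" for t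
    using IVT'[of \<phi> 0 t 1] cont ends' that by auto
  then obtain \<sigma> where \<sigma>: "\<And>t. 0 \<le> t \<Longrightarrow> t \<le> d x y \<Longrightarrow> 0 \<le> \<sigma> t \<and> \<sigma> t \<le> 1 \<and> \<phi> (\<sigma> t) = t"
    by metis
  show ?thesis
  proof
    have "d (g (\<sigma> s)) (g (\<sigma> t)) = \<bar>s - t\<bar>" if st: "0 \<le> s" "s \<le> d x y" "0 \<le> t" "t \<le> d x y" for s t
    proof (cases "\<sigma> s \<le> \<sigma> t")
      case True
      then have "d (g (\<sigma> s)) (g (\<sigma> t)) = t - s" using dist \<sigma> st by metis
      then show ?thesis using nonneg[of "g (\<sigma> s)" "g (\<sigma> t)"] by linarith
    next
      case False
      then have "\<sigma> t \<le> \<sigma> s" by simp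
      then have "d (g (\<sigma> t)) (g (\<sigma> s)) = s - t" using dist \<sigma> st by metis
      then show ?thesis using nonneg[of "g (\<sigma> t)" "g (\<sigma> s)"] commute[of "g (\<sigma> t)" "g (\<sigma> s)"]
        by linarith
    qed
    then show "unit_speed (d x y) (\<lambda>t. g (\<sigma> t))"
      using \<sigma> gM by (auto simp: unit_speed_def)
    have "d x (g (\<sigma> 0)) = 0" using \<sigma>[of 0] by (simp add: \<phi>_def)
    then show "g (\<sigma> 0) = x" using zero[of x "g (\<sigma> 0)"] gM \<sigma>[of 0] xy by auto
    have "d (g (\<sigma> (d x y))) y = 0"
      using dist[of "\<sigma> (d x y)" 1] \<sigma>[of "d x y"] ends ends' by auto
    then show "g (\<sigma> (d x y)) = y" using zero[of "g (\<sigma> (d x y))" y] gM \<sigma>[of "d x y"] xy by auto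
  qed
qed

lemma constant_speed_minimizing_geodesic:
  assumes gM: "\<And>t. 0 \<le> t \<Longrightarrow> t \<le> 1 \<Longrightarrow> g t \<in> M"
    and g: "\<And>s t. 0 \<le> s \<Longrightarrow> s \<le> t \<Longrightarrow> t \<le> 1 \<Longrightarrow> d (g s) (g t) = (t - s) * d (g 0) (g 1)"
  shows "minimizing_geodesic M d (g 0) (g 1) g"
proof -
  let ?L = "d (g 0) (g 1)"
  have abs: "d (g s) (g t) = \<bar>s - t\<bar> * ?L" if "s \<in> {0..1}" "t \<in> {0..1}" for s t
    using g[of s t] g[of t s] that commute[of "g s" "g t"] by (cases "s \<le> t") auto
  have "pathin mtopology g"
    unfolding pathin_def continuous_map_to_metric
  proof (intro ballI allI impI)
    fix s e :: real assume "s \<in> topspace (top_of_set {0..1})" "0 < e"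
    then have s: "s \<in> {0..1}" and e: "0 < e" by auto
    \<comment> \<open>The summand 1 keeps the divisor positive when the curve is constant.\<close>
    let ?\<delta> = "e / (?L + 1)"
    have L1: "0 < ?L + 1" using nonneg[of "g 0" "g 1"] by linarith
    show "\<exists>U. openin (top_of_set {0..1}) U \<and> s \<in> U \<and> (\<forall>y\<in>U. g y \<in> mball (g s) e)"
    proof (intro exI conjI ballI)
      show "openin (top_of_set {0..1}) ({0..1} \<inter> ball s ?\<delta>)" by (simp add: openin_open_Int)
      show "s \<in> {0..1} \<inter> ball s ?\<delta>" using s divide_pos_pos[OF e L1] by (simp del: zero_less_divide_iff)
      fix t assume t: "t \<in> {0..1} \<inter> ball s ?\<delta>"
      then have "\<bar>s - t\<bar> < ?\<delta>" by (simp add: dist_real_def)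
      then have "\<bar>s - t\<bar> * (?L + 1) < e" using L1 by (simp add: pos_less_divide_eq)
      moreover have "d (g s) (g t) \<le> \<bar>s - t\<bar> * (?L + 1)"
        using abs[of s t] s t by (simp add: algebra_simps)
      ultimately show "g t \<in> mball (g s) e" using gM s t by auto
    qed
  qed
  moreover have "curve_length d g = ennreal ?L"
  proof (rule antisym)
    have le: "(\<Sum>i<n. ennreal (d (g (t i)) (g (t (Suc i))))) \<le> ennreal ?L"
      if t: "t 0 = 0" "t n = 1" "mono_on {..n} t" for n and t :: "nat \<Rightarrow> real"
    proof -
      have mono: "t i \<le> t j" if "i \<le> j" "j \<le> n" for i j using t(3) that by (auto simp: mono_on_def)
      have "d (g (t i)) (g (t (Suc i))) = (t (Suc i) - t i) * ?L" if "i < n" for i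
        using g[of "t i" "t (Suc i)"] mono[of 0 i] mono[of i "Suc i"] mono[of "Suc i" n] that t by simp
      then have "(\<Sum>i<n. d (g (t i)) (g (t (Suc i)))) = (\<Sum>i<n. (t (Suc i) - t i) * ?L)"
        by (intro sum.cong) auto
      also have "(\<Sum>i<n. (t (Suc i) - t i) * ?L) = ?L"
        using t by (simp add: sum_distrib_right[symmetric] sum_lessThan_telescope)
      finally show ?thesis by (simp add: sum_ennreal)
    qed
    then show "curve_length d g \<le> ennreal ?L"
      unfolding curve_length_def by (auto intro!: SUP_least)
    let ?t = "\<lambda>i::nat. if i = 0 then 0 else (1::real)"
    have "(\<Sum>i<1. ennreal (d (g (?t i)) (g (?t (Suc i))))) \<le> curve_length d g"
      unfolding curve_length_def
      by (rule SUP_upper2[of "(1, ?t)"]) (auto simp: mono_on_def)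
    then show "ennreal ?L \<le> curve_length d g" by simp
  qed
  ultimately show ?thesis by (simp add: minimizing_geodesic_def)
qed

lemma unit_speed_minimizing_geodesic:
  assumes \<gamma>: "unit_speed L \<gamma>"
  shows "minimizing_geodesic M d (\<gamma> 0) (\<gamma> L) (\<lambda>t. \<gamma> (L * t))"
proof -
  have L: "0 \<le> L" using \<gamma> by (simp add: unit_speed_def)
  have Lt: "0 \<le> L * t" "L * t \<le> L" if "0 \<le> t" "t \<le> 1" for t
    using that L by (auto simp: mult_left_le)
  have "minimizing_geodesic M d (\<gamma> (L * 0)) (\<gamma> (L * 1)) (\<lambda>t. \<gamma> (L * t))"
  proof (rule constant_speed_minimizing_geodesic)
    show "\<gamma> (L * t) \<in> M" if "0 \<le> t" "t \<le> 1" for t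
      using unit_speed_in[OF \<gamma> Lt[OF that]] .
    fix s t :: real assume st: "0 \<le> s" "s \<le> t" "t \<le> 1"
    then have "L * s \<le> L * t" using L by (simp add: mult_left_mono)
    then show "d (\<gamma> (L * s)) (\<gamma> (L * t)) = (t - s) * d (\<gamma> (L * 0)) (\<gamma> (L * 1))"
      using unit_speed_dist[OF \<gamma>, of "L * s" "L * t"] unit_speed_dist[OF \<gamma>, of 0 L] Lt[of s] Lt[of t] st L
      by (simp add: algebra_simps)
  qed
  then show ?thesis by simp
qed

end

section \<open>Triangle comparison as a concavity inequality\<close>

text \<open>Stewart's identity; it evaluates the planar side of the triangle comparison, both when
  the comparison is assumed and when it is derived.\<close>

lemma dist_segment_point:
  fixes p q r :: "'a::real_inner"
  assumes "x = (1 - u) *\<^sub>R q + u *\<^sub>R r"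
  shows "(dist p x)\<^sup>2 = (1 - u) * (dist p q)\<^sup>2 + u * (dist p r)\<^sup>2 - u * (1 - u) * (dist q r)\<^sup>2"
  unfolding assms dist_norm power2_norm_eq_inner
  by (simp add: inner_diff_left inner_diff_right inner_add_left inner_add_right inner_commute
      algebra_simps power2_eq_square)

lemma ex_comparison_triangle:
  fixes a b c :: real
  assumes "0 \<le> a" "0 \<le> b" "0 < c" "a \<le> b + c" "b \<le> a + c" "c \<le> a + b"
  obtains p q r :: "real^2" where "dist p q = a" "dist q r = c" "dist r p = b"
proof -
  \<comment> \<open>With \<open>q\<close> at the origin and \<open>r\<close> at
    \<open>(c, 0)\<close>, the law of cosines forces this first coordinate of \<open>p\<close>; the
    triangle inequalities give \<open>\<bar>x\<bar> \<le> a\<close>, so the second coordinate is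
    real.\<close>
  define x where "x = (a\<^sup>2 + c\<^sup>2 - b\<^sup>2) / (2 * c)"
  have "\<bar>a\<^sup>2 + c\<^sup>2 - b\<^sup>2\<bar> \<le> a * (2 * c)"
  proof (rule abs_leI)
    have "(a - c)\<^sup>2 \<le> b\<^sup>2" using assms by (intro power2_le_iff_abs_le[THEN iffD2]) auto
    then show "a\<^sup>2 + c\<^sup>2 - b\<^sup>2 \<le> a * (2 * c)" by (simp add: power2_diff)
    have "b\<^sup>2 \<le> (a + c)\<^sup>2" using assms by (intro power_mono) auto
    then show "- (a\<^sup>2 + c\<^sup>2 - b\<^sup>2) \<le> a * (2 * c)" by (simp add: power2_sum)
  qed
  then have "\<bar>x\<bar> \<le> a" using assms(3) by (simp add: x_def abs_divide divide_le_eq)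
  then have x2: "x\<^sup>2 \<le> a\<^sup>2" using assms(1) by (simp add: abs_le_square_iff[symmetric])
  define y where "y = sqrt (a\<^sup>2 - x\<^sup>2)"
  have y2: "y\<^sup>2 = a\<^sup>2 - x\<^sup>2" using x2 by (simp add: y_def)
  have norm: "norm (vector [u, v] :: real^2) = sqrt (u\<^sup>2 + v\<^sup>2)" for u v :: real
    by (simp add: norm_vec_def L2_set_def sum_2)
  have diff: "(vector [u, v] :: real^2) - vector [u', v'] = vector [u - u', v - v']" for u v u' v' :: real
    by (simp add: vec_eq_iff forall_2)
  have "(c - x)\<^sup>2 + y\<^sup>2 = c\<^sup>2 - 2 * c * x + a\<^sup>2"
    using y2 by (simp add: power2_diff)
  also have "2 * c * x = a\<^sup>2 + c\<^sup>2 - b\<^sup>2" using assms(3) by (simp add: x_def)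
  finally have cx: "(c - x)\<^sup>2 + y\<^sup>2 = b\<^sup>2" by simp
  show ?thesis
  proof
    show "dist (vector [x, y] :: real^2) (vector [0, 0]) = a"
      using y2 assms(1) by (simp add: dist_norm diff norm)
    show "dist (vector [0, 0] :: real^2) (vector [c, 0]) = c"
      using assms(3) by (simp add: dist_norm diff norm)
    show "dist (vector [c, 0] :: real^2) (vector [x, y]) = b"
      using cx assms(2) by (simp add: dist_norm diff norm)
  qed
qed

context Metric_space
begin

text \<open>Triangle comparison with the denominator \<open>L\<close> cleared: the function
  \<open>(d p (\<gamma> t))\<^sup>2 - t\<^sup>2\<close> lies above its chord. Membership in
  \<open>U\<close> is asked of \<open>p\<close> and the two endpoints, so the condition passes to
  subsets.\<close>

definition semiconcave_in :: "'a set \<Rightarrow> bool" where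
  "semiconcave_in U \<longleftrightarrow>
     (\<forall>p L \<gamma> t. p \<in> U \<and> unit_speed L \<gamma> \<and> \<gamma> 0 \<in> U \<and> \<gamma> L \<in> U \<and> 0 \<le> t \<and> t \<le> L \<longrightarrow>
        (L - t) * (d p (\<gamma> 0))\<^sup>2 + t * (d p (\<gamma> L))\<^sup>2 - t * (L - t) * L \<le> L * (d p (\<gamma> t))\<^sup>2)"

lemma semiconcave_inD:
  assumes "semiconcave_in U" "p \<in> U" "unit_speed L \<gamma>" "\<gamma> 0 \<in> U" "\<gamma> L \<in> U" "0 \<le> t" "t \<le> L"
  shows "(L - t) * (d p (\<gamma> 0))\<^sup>2 + t * (d p (\<gamma> L))\<^sup>2 - t * (L - t) * L \<le> L * (d p (\<gamma> t))\<^sup>2"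
  using assms unfolding semiconcave_in_def by blast

lemma semiconcave_in_subset: "semiconcave_in U \<Longrightarrow> V \<subseteq> U \<Longrightarrow> semiconcave_in V"
  unfolding semiconcave_in_def by blast

text \<open>The mean of the two bounds for \<open>d z (\<gamma> t)\<close> through the endpoints is
  independent of \<open>t\<close>, and \<open>L\<close> is at most the sum of the distances of the
  endpoints from \<open>z\<close>.\<close>

lemma unit_speed_in_mball:
  assumes \<gamma>: "unit_speed L \<gamma>" and "\<gamma> 0 \<in> mball z \<delta>" "\<gamma> L \<in> mball z \<delta>" and t: "0 \<le> t" "t \<le> L"
  shows "\<gamma> t \<in> mball z (2 * \<delta>)"
proof -
  have L: "0 \<le> L" using \<gamma> by (simp add: unit_speed_def)
  have M: "z \<in> M" "\<gamma> 0 \<in> M" "\<gamma> L \<in> M" "\<gamma> t \<in> M" using assms unit_speed_in[OF \<gamma> t] by auto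
  have dt: "d (\<gamma> 0) (\<gamma> t) = t" "d (\<gamma> L) (\<gamma> t) = L - t" "d (\<gamma> 0) (\<gamma> L) = L"
    using unit_speed_dist[OF \<gamma>, of 0 t] unit_speed_dist[OF \<gamma>, of L t] unit_speed_dist[OF \<gamma>, of 0 L] t L
    by auto
  have "d z (\<gamma> t) \<le> d z (\<gamma> 0) + t" "d z (\<gamma> t) \<le> d z (\<gamma> L) + (L - t)"
    using triangle[of z "\<gamma> 0" "\<gamma> t"] triangle[of z "\<gamma> L" "\<gamma> t"] M dt by auto
  moreover have "L \<le> d z (\<gamma> 0) + d z (\<gamma> L)"
    using triangle[of "\<gamma> 0" z "\<gamma> L"] M dt commute[of "\<gamma> 0" z] by simp
  moreover have "d z (\<gamma> 0) < \<delta>" "d z (\<gamma> L) < \<delta>" using assms(2,3) by auto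
  ultimately show ?thesis using M by auto
qed

text \<open>Sides of a triangle with vertices in the smaller ball stay in the doubled ball, where
  comparison is available; Stewart's identity then computes the planar distance.\<close>

lemma triangle_comparison_semiconcave:
  assumes geo: "geodesic_space M d" and tc: "triangle_comparison_in M d U" and sub: "mball z (2 * \<delta>) \<subseteq> U"
  shows "semiconcave_in (mball z \<delta>)"
  unfolding semiconcave_in_def
proof (intro allI impI, elim conjE)
  fix p L \<gamma> t
  assume p: "p \<in> mball z \<delta>" and \<gamma>: "unit_speed L \<gamma>" and ends: "\<gamma> 0 \<in> mball z \<delta>" "\<gamma> L \<in> mball z \<delta>"
    and t: "0 \<le> t" "t \<le> L"
  have geo': "\<exists>\<beta>. unit_speed (d x y) \<beta> \<and> \<beta> 0 = x \<and> \<beta> (d x y) = y" if "x \<in> M" "y \<in> M" for x y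
    using geo that minimizing_geodesic_unit_speed unfolding geodesic_space_def by metis
  let ?q = "\<gamma> 0" and ?r = "\<gamma> L"
  have M: "p \<in> M" "?q \<in> M" "?r \<in> M" using p ends by auto
  have L: "0 \<le> L" "d ?q ?r = L" using \<gamma> unit_speed_dist[OF \<gamma>, of 0 L] by (auto simp: unit_speed_def)
  show "(L - t) * (d p ?q)\<^sup>2 + t * (d p ?r)\<^sup>2 - t * (L - t) * L \<le> L * (d p (\<gamma> t))\<^sup>2"
  proof (cases "L = 0")
    case False
    then have L0: "0 < L" using L by simp
    obtain \<alpha> where \<alpha>: "unit_speed (d p ?q) \<alpha>" "\<alpha> 0 = p" "\<alpha> (d p ?q) = ?q" using geo' M by blast
    obtain \<beta> where \<beta>: "unit_speed (d ?r p) \<beta>" "\<beta> 0 = ?r" "\<beta> (d ?r p) = p" using geo' M by blast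
    have img: "(\<lambda>t. \<eta> (l * t)) ` {0..1} \<subseteq> U"
      if "unit_speed l \<eta>" "\<eta> 0 \<in> mball z \<delta>" "\<eta> l \<in> mball z \<delta>" for l \<eta>
    proof -
      have "0 \<le> l" using that by (simp add: unit_speed_def)
      then have "\<eta> (l * t) \<in> mball z (2 * \<delta>)" if "t \<in> {0..1}" for t
        using that \<open>unit_speed l \<eta>\<close> \<open>\<eta> 0 \<in> mball z \<delta>\<close> \<open>\<eta> l \<in> mball z \<delta>\<close>
        by (intro unit_speed_in_mball[of l]) (auto simp: mult_left_le)
      then show ?thesis using sub by auto
    qed
    have "d p ?q \<le> d ?r p + L" "d ?r p \<le> d p ?q + L" "L \<le> d p ?q + d ?r p"
      using triangle[of p ?r ?q] triangle[of ?r ?q p] triangle[of ?q p ?r] M L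
      by (auto simp: commute)
    then obtain p' q' r' :: "real^2" where T: "dist p' q' = d p ?q" "dist q' r' = L" "dist r' p' = d ?r p"
      using ex_comparison_triangle[of "d p ?q" "d ?r p" L] L0 by auto
    define x' where "x' = (1 - t / L) *\<^sub>R q' + (t / L) *\<^sub>R r'"
    have x': "x' \<in> closed_segment q' r'"
      unfolding x'_def closed_segment_def using t L0 by auto
    have "q' - x' = (t / L) *\<^sub>R (q' - r')" by (simp add: x'_def algebra_simps)
    then have "dist q' x' = t" using T(2) L0 t by (simp add: dist_norm)
    moreover have "d ?q (\<gamma> t) = t" using unit_speed_dist[OF \<gamma>, of 0 t] t by simp
    moreover have "\<gamma> t \<in> (\<lambda>t. \<gamma> (L * t)) ` {0..1}"
      using t L0 by (intro image_eqI[of _ _ "t / L"]) auto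
    moreover have "minimizing_geodesic M d p ?q (\<lambda>t. \<alpha> (d p ?q * t))"
      "minimizing_geodesic M d ?q ?r (\<lambda>t. \<gamma> (L * t))" "minimizing_geodesic M d ?r p (\<lambda>t. \<beta> (d ?r p * t))"
      using unit_speed_minimizing_geodesic[OF \<alpha>(1)] unit_speed_minimizing_geodesic[OF \<gamma>]
        unit_speed_minimizing_geodesic[OF \<beta>(1)] \<alpha> \<beta> by auto
    moreover have "(\<lambda>t. \<alpha> (d p ?q * t)) ` {0..1} \<union> (\<lambda>t. \<gamma> (L * t)) ` {0..1}
        \<union> (\<lambda>t. \<beta> (d ?r p * t)) ` {0..1} \<subseteq> U"
      using img[OF \<alpha>(1)] img[OF \<gamma>] img[OF \<beta>(1)] \<alpha> \<beta> p ends by simp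
    ultimately have "dist p' x' \<le> d p (\<gamma> t)"
      using tc x' T L(2) unfolding triangle_comparison_in_def by metis
    then have "L * (dist p' x')\<^sup>2 \<le> L * (d p (\<gamma> t))\<^sup>2"
      using L0 by (intro mult_left_mono power_mono) auto
    moreover have "L * (dist p' x')\<^sup>2 = (L - t) * (d p ?q)\<^sup>2 + t * (d p ?r)\<^sup>2 - t * (L - t) * L"
    proof -
      have "(dist p' x')\<^sup>2 = (1 - t / L) * (d p ?q)\<^sup>2 + t / L * (d p ?r)\<^sup>2 - t / L * (1 - t / L) * L\<^sup>2"
        using dist_segment_point[OF x'_def, of p'] T by (simp add: dist_commute commute)
      then show ?thesis using L0 by (simp only:) (simp add: field_simps power2_eq_square)
    qed
    ultimately show ?thesis by simp
  qed (use t in auto)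
qed

section \<open>Hinges\<close>

text \<open>The cosine of the Euclidean comparison angle at the common starting point of
  \<open>\<alpha>\<close> and \<open>\<beta>\<close>.\<close>

definition comp_cos :: "(real \<Rightarrow> 'a) \<Rightarrow> (real \<Rightarrow> 'a) \<Rightarrow> real \<Rightarrow> real \<Rightarrow> real" where
  "comp_cos \<alpha> \<beta> s t = (s\<^sup>2 + t\<^sup>2 - (d (\<alpha> s) (\<beta> t))\<^sup>2) / (2 * s * t)"

text \<open>\<open>s\<close> and \<open>t\<close> tend to 0 independently, so that
  \<open>has_cos_triangle\<close> may send them to 0 at different rates.\<close>

definition has_cos :: "(real \<Rightarrow> 'a) \<Rightarrow> (real \<Rightarrow> 'a) \<Rightarrow> real \<Rightarrow> bool" where
  "has_cos \<alpha> \<beta> C \<longleftrightarrow>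
     (\<forall>\<epsilon>>0. \<exists>\<eta>>0. \<forall>s t. 0 < s \<and> s < \<eta> \<and> 0 < t \<and> t < \<eta> \<longrightarrow> \<bar>comp_cos \<alpha> \<beta> s t - C\<bar> < \<epsilon>)"

lemma comp_cos_commute: "comp_cos \<alpha> \<beta> s t = comp_cos \<beta> \<alpha> t s"
  by (simp add: comp_cos_def commute[of "\<alpha> s"] mult.commute add.commute)

lemma has_cos_commute: "has_cos \<alpha> \<beta> C \<longleftrightarrow> has_cos \<beta> \<alpha> C"
  unfolding has_cos_def by (subst comp_cos_commute) metis

lemma has_cosE:
  assumes "has_cos \<alpha> \<beta> C" "0 < \<epsilon>"
  obtains \<eta> where "0 < \<eta>" "\<And>s t. 0 < s \<Longrightarrow> s < \<eta> \<Longrightarrow> 0 < t \<Longrightarrow> t < \<eta> \<Longrightarrow> \<bar>comp_cos \<alpha> \<beta> s t - C\<bar> < \<epsilon>"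
  using assms unfolding has_cos_def by metis

lemma has_cos_unique:
  assumes "has_cos \<alpha> \<beta> C" "has_cos \<alpha> \<beta> C'"
  shows "C = C'"
proof (rule ccontr)
  assume "C \<noteq> C'"
  then have e: "0 < \<bar>C - C'\<bar> / 2" by simp
  obtain \<eta> \<eta>' where \<eta>: "0 < \<eta>" "\<And>s t. 0 < s \<Longrightarrow> s < \<eta> \<Longrightarrow> 0 < t \<Longrightarrow> t < \<eta> \<Longrightarrow> \<bar>comp_cos \<alpha> \<beta> s t - C\<bar> < \<bar>C - C'\<bar> / 2"
    and \<eta>': "0 < \<eta>'" "\<And>s t. 0 < s \<Longrightarrow> s < \<eta>' \<Longrightarrow> 0 < t \<Longrightarrow> t < \<eta>' \<Longrightarrow> \<bar>comp_cos \<alpha> \<beta> s t - C'\<bar> < \<bar>C - C'\<bar> / 2"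
    using has_cosE[OF assms(1) e] has_cosE[OF assms(2) e] by metis
  define s where "s = min \<eta> \<eta>' / 2"
  have "0 < s" "s < \<eta>" "s < \<eta>'" using \<eta>(1) \<eta>'(1) by (auto simp: s_def)
  then have "\<bar>comp_cos \<alpha> \<beta> s s - C\<bar> < \<bar>C - C'\<bar> / 2" "\<bar>comp_cos \<alpha> \<beta> s s - C'\<bar> < \<bar>C - C'\<bar> / 2"
    using \<eta>(2) \<eta>'(2) by auto
  then show False by argo
qed

lemma comp_cos_bounds:
  assumes \<alpha>: "unit_speed a \<alpha>" and \<beta>: "unit_speed b \<beta>" and x: "\<alpha> 0 = \<beta> 0"
    and st: "0 < s" "s \<le> a" "0 < t" "t \<le> b"
  shows "\<bar>comp_cos \<alpha> \<beta> s t\<bar> \<le> 1"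
proof -
  have M: "\<alpha> 0 \<in> M" "\<alpha> s \<in> M" "\<beta> t \<in> M"
    using unit_speed_in[OF \<alpha>] unit_speed_in[OF \<beta>] st by auto
  have "d (\<alpha> 0) (\<alpha> s) = s" "d (\<alpha> 0) (\<beta> t) = t"
    using unit_speed_dist[OF \<alpha>, of 0 s] unit_speed_dist[OF \<beta>, of 0 t] st x by auto
  then have "d (\<alpha> s) (\<beta> t) \<le> s + t" "\<bar>s - t\<bar> \<le> d (\<alpha> s) (\<beta> t)"
    using triangle[of "\<alpha> s" "\<alpha> 0" "\<beta> t"] triangle[of "\<alpha> 0" "\<alpha> s" "\<beta> t"] triangle[of "\<alpha> 0" "\<beta> t" "\<alpha> s"] M
    by (auto simp: commute)
  then have "(d (\<alpha> s) (\<beta> t))\<^sup>2 \<le> (s + t)\<^sup>2" "(s - t)\<^sup>2 \<le> (d (\<alpha> s) (\<beta> t))\<^sup>2"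
    by (auto intro: power_mono simp: abs_le_square_iff[symmetric])
  then have "\<bar>s\<^sup>2 + t\<^sup>2 - (d (\<alpha> s) (\<beta> t))\<^sup>2\<bar> \<le> 2 * s * t"
    by (simp add: abs_le_iff power2_sum power2_diff)
  then show ?thesis using st by (simp add: comp_cos_def abs_divide divide_le_eq abs_mult)
qed

text \<open>This is semiconcavity seen from the apex \<open>\<beta> t\<close>, divided by
  \<open>2 * t * s * s'\<close>: comparison angles shrink as a side grows.\<close>

lemma comp_cos_mono1:
  assumes sc: "semiconcave_in U" and \<alpha>: "unit_speed a \<alpha>" and U: "\<alpha> 0 \<in> U" "\<alpha> s \<in> U" "\<beta> t \<in> U"
    and t0: "d (\<beta> t) (\<alpha> 0) = t" and st: "0 < s'" "s' \<le> s" "s \<le> a" "0 < t"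
  shows "comp_cos \<alpha> \<beta> s' t \<le> comp_cos \<alpha> \<beta> s t"
proof -
  have "unit_speed s \<alpha>" using unit_speed_mono[OF \<alpha>] st by auto
  from semiconcave_inD[OF sc U(3) this U(1,2), of s']
  have "s * (s'\<^sup>2 + t\<^sup>2 - (d (\<alpha> s') (\<beta> t))\<^sup>2) \<le> s' * (s\<^sup>2 + t\<^sup>2 - (d (\<alpha> s) (\<beta> t))\<^sup>2)"
    using st t0 by (simp add: commute[of "\<beta> t"] algebra_simps power2_eq_square)
  then have "s * (s'\<^sup>2 + t\<^sup>2 - (d (\<alpha> s') (\<beta> t))\<^sup>2) / (2 * t * s * s')
      \<le> s' * (s\<^sup>2 + t\<^sup>2 - (d (\<alpha> s) (\<beta> t))\<^sup>2) / (2 * t * s * s')"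
    using st by (intro divide_right_mono) auto
  then show ?thesis using st by (simp add: comp_cos_def mult_ac)
qed

lemma comp_cos_mono:
  assumes sc: "semiconcave_in U" and \<alpha>: "unit_speed a \<alpha>" and \<beta>: "unit_speed b \<beta>" and x: "\<alpha> 0 = \<beta> 0" "\<alpha> 0 \<in> U"
    and U: "\<alpha> s \<in> U" "\<alpha> s' \<in> U" "\<beta> t \<in> U"
    and st: "0 < s'" "s' \<le> s" "s \<le> a" "0 < t'" "t' \<le> t" "t \<le> b"
  shows "comp_cos \<alpha> \<beta> s' t' \<le> comp_cos \<alpha> \<beta> s t"
proof -
  have d: "d (\<alpha> s') (\<beta> 0) = s'" "d (\<beta> t) (\<alpha> 0) = t"
    using unit_speed_dist[OF \<alpha>, of s' 0] unit_speed_dist[OF \<beta>, of t 0] st x by auto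
  have "comp_cos \<beta> \<alpha> t' s' \<le> comp_cos \<beta> \<alpha> t s'"
    using x U st d by (intro comp_cos_mono1[OF sc \<beta>]) auto
  moreover have "comp_cos \<alpha> \<beta> s' t \<le> comp_cos \<alpha> \<beta> s t"
    using x U st d by (intro comp_cos_mono1[OF sc \<alpha>]) auto
  ultimately show ?thesis
    using comp_cos_commute[of \<beta> \<alpha> t' s'] comp_cos_commute[of \<beta> \<alpha> t s'] by linarith
qed

text \<open>By monotonicity the infimum of the comparison cosines over small hinges is also their
  limit; \<open>comp_cos_bounds\<close> keeps it finite.\<close>

lemma has_cos_exists:
  assumes sc: "semiconcave_in (mball z \<delta>)" and \<alpha>: "unit_speed a \<alpha>" and \<beta>: "unit_speed b \<beta>"
    and x: "\<alpha> 0 = \<beta> 0" "\<alpha> 0 = z" and ab: "0 < a" "0 < b" "0 < \<delta>"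
  obtains C where "has_cos \<alpha> \<beta> C"
    "\<And>s t. 0 < s \<Longrightarrow> s \<le> a \<Longrightarrow> s < \<delta> \<Longrightarrow> 0 < t \<Longrightarrow> t \<le> b \<Longrightarrow> t < \<delta> \<Longrightarrow> C \<le> comp_cos \<alpha> \<beta> s t"
proof -
  have zM: "z \<in> M" using unit_speed_in[OF \<alpha>, of 0] ab x by simp
  have U: "\<alpha> s \<in> mball z \<delta>" if "0 \<le> s" "s \<le> a" "s < \<delta>" for s
    using unit_speed_in[OF \<alpha>] unit_speed_dist[OF \<alpha>, of 0 s] that ab x zM by auto
  have V: "\<beta> s \<in> mball z \<delta>" if "0 \<le> s" "s \<le> b" "s < \<delta>" for s
    using unit_speed_in[OF \<beta>] unit_speed_dist[OF \<beta>, of 0 s] that ab x zM by auto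
  define P where "P = {(s, t). 0 < s \<and> s \<le> a \<and> s < \<delta> \<and> 0 < t \<and> t \<le> b \<and> t < \<delta>}"
  let ?k = "\<lambda>(s, t). comp_cos \<alpha> \<beta> s t"
  have "(min a (\<delta> / 2), min b (\<delta> / 2)) \<in> P" using ab by (auto simp: P_def)
  then have ne: "P \<noteq> {}" by blast
  have bdd: "bdd_below (?k ` P)"
    using comp_cos_bounds[OF \<alpha> \<beta> x(1)] by (intro bdd_belowI[of _ "-1"]) (auto simp: P_def abs_le_iff)
  define C where "C = (INF e\<in>P. ?k e)"
  have lower: "C \<le> comp_cos \<alpha> \<beta> s t" if "(s, t) \<in> P" for s t
    unfolding C_def using cINF_lower[OF bdd that] by simp
  have "has_cos \<alpha> \<beta> C"
    unfolding has_cos_def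
  proof (intro allI impI)
    fix \<epsilon> :: real assume "0 < \<epsilon>"
    then have "(INF e\<in>P. ?k e) < C + \<epsilon>" by (simp add: C_def)
    then obtain s t where st: "(s, t) \<in> P" "comp_cos \<alpha> \<beta> s t < C + \<epsilon>"
      using ne bdd by (auto simp: cINF_less_iff)
    show "\<exists>\<eta>>0. \<forall>s t. 0 < s \<and> s < \<eta> \<and> 0 < t \<and> t < \<eta> \<longrightarrow> \<bar>comp_cos \<alpha> \<beta> s t - C\<bar> < \<epsilon>"
    proof (intro exI[of _ "min s t"] conjI allI impI)
      show "0 < min s t" using st by (auto simp: P_def)
      fix s' t' assume st': "0 < s' \<and> s' < min s t \<and> 0 < t' \<and> t' < min s t"
      then have "comp_cos \<alpha> \<beta> s' t' \<le> comp_cos \<alpha> \<beta> s t"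
        using st x U[of s] U[of s'] V[of t] zM ab by (intro comp_cos_mono[OF sc \<alpha> \<beta>]) (auto simp: P_def)
      moreover have "C \<le> comp_cos \<alpha> \<beta> s' t'" using st st' by (intro lower) (auto simp: P_def)
      ultimately show "\<bar>comp_cos \<alpha> \<beta> s' t' - C\<bar> < \<epsilon>" using st(2) by linarith
    qed
  qed
  then show ?thesis using that lower by (auto simp: P_def)
qed

lemma has_cos_bounds:
  assumes "has_cos \<alpha> \<beta> C" and \<alpha>: "unit_speed a \<alpha>" and \<beta>: "unit_speed b \<beta>"
    and x: "\<alpha> 0 = \<beta> 0" and ab: "0 < a" "0 < b"
  shows "- 1 \<le> C" "C \<le> 1"
proof -
  have "- 1 \<le> C \<and> C \<le> 1"
  proof (rule ccontr)
    assume "\<not> ?thesis"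
    then have "0 < \<bar>C\<bar> - 1" by linarith
    then obtain \<eta> where \<eta>: "0 < \<eta>" "\<And>s t. 0 < s \<Longrightarrow> s < \<eta> \<Longrightarrow> 0 < t \<Longrightarrow> t < \<eta> \<Longrightarrow> \<bar>comp_cos \<alpha> \<beta> s t - C\<bar> < \<bar>C\<bar> - 1"
      using has_cosE[OF assms(1)] by metis
    define s where "s = min (\<eta> / 2) (min a b)"
    have s: "0 < s" "s < \<eta>" "s \<le> a" "s \<le> b" using \<eta>(1) ab by (auto simp: s_def)
    show False using \<eta>(2)[OF s(1,2) s(1,2)] comp_cos_bounds[OF \<alpha> \<beta> x s(1,3) s(1,4)] by linarith
  qed
  then show "- 1 \<le> C" "C \<le> 1" by auto
qed

text \<open>Semiconcavity seen from \<open>\<beta> s\<close>, along the piece of \<gamma> of length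
  \<open>2 * s\<close> centred at \<open>\<gamma> \<tau>\<close>, makes the sum of the two
  comparison cosines non-negative; in the limit, adjacent angles add up to at most \<pi>.\<close>

lemma has_cos_adjacent:
  assumes sc: "semiconcave_in (mball (\<gamma> \<tau>) \<delta>)" "0 < \<delta>" and \<gamma>: "unit_speed L \<gamma>" and \<tau>: "0 < \<tau>" "\<tau> < L"
    and \<beta>: "unit_speed b \<beta>" "\<beta> 0 = \<gamma> \<tau>" "0 < b"
    and C: "has_cos (\<lambda>t. \<gamma> (\<tau> + t)) \<beta> C" "has_cos (\<lambda>t. \<gamma> (\<tau> - t)) \<beta> C'"
  shows "0 \<le> C + C'"
proof (rule ccontr)
  assume "\<not> ?thesis"
  then have e: "0 < - (C + C') / 2" by simp
  obtain \<eta> \<eta>' where \<eta>: "0 < \<eta>" "\<And>s t. 0 < s \<Longrightarrow> s < \<eta> \<Longrightarrow> 0 < t \<Longrightarrow> t < \<eta> \<Longrightarrow> \<bar>comp_cos (\<lambda>t. \<gamma> (\<tau> + t)) \<beta> s t - C\<bar> < - (C + C') / 2"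
    and \<eta>': "0 < \<eta>'" "\<And>s t. 0 < s \<Longrightarrow> s < \<eta>' \<Longrightarrow> 0 < t \<Longrightarrow> t < \<eta>' \<Longrightarrow> \<bar>comp_cos (\<lambda>t. \<gamma> (\<tau> - t)) \<beta> s t - C'\<bar> < - (C + C') / 2"
    using has_cosE[OF C(1) e] has_cosE[OF C(2) e] by metis
  define s where "s = Min {\<eta> / 2, \<eta>' / 2, \<delta> / 2, b, \<tau>, L - \<tau>}"
  have s: "0 < s" "s < \<eta>" "s < \<eta>'" "s < \<delta>" "s \<le> b" "s \<le> \<tau>" "s \<le> L - \<tau>"
    using \<eta>(1) \<eta>'(1) sc(2) \<beta>(3) \<tau> by (auto simp: s_def min_def)
  let ?\<gamma> = "\<lambda>t. \<gamma> (\<tau> - s + t)"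
  have us: "unit_speed (2 * s) ?\<gamma>" using s by (intro unit_speed_shift[OF \<gamma>]) auto
  have M: "\<gamma> \<tau> \<in> M" "\<gamma> (\<tau> - s) \<in> M" "\<gamma> (\<tau> + s) \<in> M" "\<beta> s \<in> M"
    using unit_speed_in[OF \<gamma>] unit_speed_in[OF \<beta>(1)] s \<tau> by auto
  have D: "d (\<gamma> \<tau>) (\<gamma> (\<tau> - s)) = s" "d (\<gamma> \<tau>) (\<gamma> (\<tau> + s)) = s" "d (\<gamma> \<tau>) (\<beta> s) = s"
    using unit_speed_dist[OF \<gamma>, of \<tau> "\<tau> - s"] unit_speed_dist[OF \<gamma>, of \<tau> "\<tau> + s"]
      unit_speed_dist[OF \<beta>(1), of 0 s] s \<tau> \<beta> by auto
  have "(2 * s - s) * (d (\<beta> s) (?\<gamma> 0))\<^sup>2 + s * (d (\<beta> s) (?\<gamma> (2 * s)))\<^sup>2 - s * (2 * s - s) * (2 * s)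
      \<le> 2 * s * (d (\<beta> s) (?\<gamma> s))\<^sup>2"
    using M D s by (intro semiconcave_inD[OF sc(1) _ us]) (auto simp: algebra_simps)
  then have "s * ((d (\<beta> s) (\<gamma> (\<tau> - s)))\<^sup>2 + (d (\<beta> s) (\<gamma> (\<tau> + s)))\<^sup>2) \<le> s * (4 * s\<^sup>2)"
    using D(3) by (simp add: algebra_simps commute[of "\<gamma> \<tau>"] power2_eq_square)
  then have "(d (\<beta> s) (\<gamma> (\<tau> - s)))\<^sup>2 + (d (\<beta> s) (\<gamma> (\<tau> + s)))\<^sup>2 \<le> 4 * s\<^sup>2"
    using s(1) by simp
  then have "0 \<le> comp_cos (\<lambda>t. \<gamma> (\<tau> + t)) \<beta> s s + comp_cos (\<lambda>t. \<gamma> (\<tau> - t)) \<beta> s s"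
    using s(1) by (simp add: comp_cos_def commute[of "\<beta> s"] add_divide_distrib[symmetric])
  moreover have "\<bar>comp_cos (\<lambda>t. \<gamma> (\<tau> + t)) \<beta> s s - C\<bar> < - (C + C') / 2"
    "\<bar>comp_cos (\<lambda>t. \<gamma> (\<tau> - t)) \<beta> s s - C'\<bar> < - (C + C') / 2"
    using \<eta>(2) \<eta>'(2) s by auto
  ultimately show False by argo
qed

section \<open>Globalization\<close>

text \<open>The size of a hinge is measured by \<open>a + b\<close>, which bounds the distance of
  its endpoints. Globalization raises \<rho> at the price of a smaller region \<open>V\<close> for
  the vertices.\<close>

definition hinge_comparison :: "'a set \<Rightarrow> real \<Rightarrow> bool" where
  "hinge_comparison V \<rho> \<longleftrightarrow>
     (\<forall>a b \<alpha> \<beta> C. unit_speed a \<alpha> \<and> unit_speed b \<beta> \<and> \<alpha> 0 = \<beta> 0 \<and> \<alpha> 0 \<in> V \<and> 0 < a \<and> 0 < b \<and>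
        a + b < \<rho> \<and> has_cos \<alpha> \<beta> C \<longrightarrow> C \<le> comp_cos \<alpha> \<beta> a b)"

lemma hinge_comparisonD:
  "hinge_comparison V \<rho> \<Longrightarrow> unit_speed a \<alpha> \<Longrightarrow> unit_speed b \<beta> \<Longrightarrow> \<alpha> 0 = \<beta> 0 \<Longrightarrow> \<alpha> 0 \<in> V \<Longrightarrow>
   0 < a \<Longrightarrow> 0 < b \<Longrightarrow> a + b < \<rho> \<Longrightarrow> has_cos \<alpha> \<beta> C \<Longrightarrow> C \<le> comp_cos \<alpha> \<beta> a b"
  unfolding hinge_comparison_def by blast

lemma hinge_comparison_mono:
  "hinge_comparison V \<rho> \<Longrightarrow> V' \<subseteq> V \<Longrightarrow> \<rho>' \<le> \<rho> \<Longrightarrow> hinge_comparison V' \<rho>'"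
  unfolding hinge_comparison_def by (meson less_le_trans subsetD)

lemma hinge_comparison_local:
  assumes "\<And>x. x \<in> V \<Longrightarrow> semiconcave_in (mball x \<epsilon>)" "0 < \<epsilon>"
  shows "hinge_comparison V \<epsilon>"
  unfolding hinge_comparison_def
proof (intro allI impI, elim conjE)
  fix a b \<alpha> \<beta> C
  assume *: "unit_speed a \<alpha>" "unit_speed b \<beta>" "\<alpha> 0 = \<beta> 0" "\<alpha> 0 \<in> V" "0 < a" "0 < b" "a + b < \<epsilon>" "has_cos \<alpha> \<beta> C"
  obtain C' where C': "has_cos \<alpha> \<beta> C'"
    "\<And>s t. 0 < s \<Longrightarrow> s \<le> a \<Longrightarrow> s < \<epsilon> \<Longrightarrow> 0 < t \<Longrightarrow> t \<le> b \<Longrightarrow> t < \<epsilon> \<Longrightarrow> C' \<le> comp_cos \<alpha> \<beta> s t"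
    using has_cos_exists[OF assms(1)[OF *(4)] *(1-3) refl *(5,6) assms(2)] by blast
  have "C' = C" using has_cos_unique[OF C'(1) *(8)] .
  then show "C \<le> comp_cos \<alpha> \<beta> a b" using C'(2)[of a b] * by auto
qed

end

locale locally_nonneg_curved = Metric_space M d for M :: "'a set" and d :: "'a \<Rightarrow> 'a \<Rightarrow> real" +
  assumes geodesic: "x \<in> M \<Longrightarrow> y \<in> M \<Longrightarrow> \<exists>\<gamma>. unit_speed (d x y) \<gamma> \<and> \<gamma> 0 = x \<and> \<gamma> (d x y) = y"
    and locally_semiconcave: "z \<in> M \<Longrightarrow> \<exists>\<delta>>0. semiconcave_in (mball z \<delta>)"
begin

lemma ex_has_cos:
  assumes "unit_speed a \<alpha>" "unit_speed b \<beta>" "\<alpha> 0 = \<beta> 0" "0 < a" "0 < b"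
  obtains C where "has_cos \<alpha> \<beta> C"
proof -
  have "\<alpha> 0 \<in> M" using unit_speed_in[OF assms(1), of 0] assms(4) by simp
  then obtain \<delta> where \<delta>: "0 < \<delta>" "semiconcave_in (mball (\<alpha> 0) \<delta>)"
    using locally_semiconcave by metis
  show ?thesis
    using has_cos_exists[OF \<delta>(2) assms(1-3) refl assms(4,5) \<delta>(1)] that by metis
qed

lemma has_cos_adjacent':
  assumes \<gamma>: "unit_speed L \<gamma>" and \<tau>: "0 < \<tau>" "\<tau> < L"
    and \<beta>: "unit_speed b \<beta>" "\<beta> 0 = \<gamma> \<tau>" "0 < b"
    and C: "has_cos (\<lambda>t. \<gamma> (\<tau> + t)) \<beta> C" "has_cos (\<lambda>t. \<gamma> (\<tau> - t)) \<beta> C'"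
  shows "0 \<le> C + C'"
proof -
  have "\<gamma> \<tau> \<in> M" using unit_speed_in[OF \<gamma>, of \<tau>] \<tau> by simp
  then obtain \<delta> where \<delta>: "0 < \<delta>" "semiconcave_in (mball (\<gamma> \<tau>) \<delta>)"
    using locally_semiconcave by metis
  show ?thesis by (rule has_cos_adjacent[OF \<delta>(2,1) \<gamma> \<tau> \<beta> C])
qed

text \<open>The length of the side opposite to a planar hinge does not increase when the vertex is moved
  from \<open>x\<close> to \<open>x' = \<beta> s\<close>: with \<open>e = d x' p\<close>, the intermediate value \<open>W\<close> is the squared
  distance from \<open>p\<close> to the point at distance \<open>b\<close> from \<open>x\<close> on the ray \<open>x x'\<close> in the plane
  of the comparison triangle of \<open>x, x', p\<close>.\<close>

lemma hinge_step:
  assumes hc: "hinge_comparison V \<rho>" and \<alpha>: "unit_speed a \<alpha>" and \<beta>: "unit_speed b \<beta>"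
    and x: "\<alpha> 0 = \<beta> 0" "\<alpha> 0 \<in> V" "\<beta> s \<in> V" and ab: "0 < a" "0 < b" "0 < s" "s < b"
    and \<rho>: "a + 2 * s < \<rho>" and C: "has_cos \<alpha> \<beta> C"
  defines "e \<equiv> d (\<beta> s) (\<alpha> a)"
  defines "W \<equiv> a\<^sup>2 + b\<^sup>2 - b * (a\<^sup>2 + s\<^sup>2 - e\<^sup>2) / s"
  shows "W \<le> a\<^sup>2 + b\<^sup>2 - 2 * a * b * C"
    and "e = 0 \<Longrightarrow> W = (d (\<alpha> a) (\<beta> b))\<^sup>2"
    and "0 < e \<Longrightarrow> \<exists>\<alpha>' \<beta>' C'. unit_speed e \<alpha>' \<and> unit_speed (b - s) \<beta>' \<and> \<alpha>' 0 = \<beta>' 0 \<and>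
       \<alpha>' e = \<alpha> a \<and> \<beta>' (b - s) = \<beta> b \<and> has_cos \<alpha>' \<beta>' C' \<and> e\<^sup>2 + (b - s)\<^sup>2 - 2 * e * (b - s) * C' \<le> W"
proof -
  have M: "\<alpha> 0 \<in> M" "\<alpha> a \<in> M" "\<beta> s \<in> M" using unit_speed_in[OF \<alpha>] unit_speed_in[OF \<beta>] ab by auto
  have dist: "d (\<alpha> 0) (\<alpha> a) = a" "d (\<alpha> 0) (\<beta> s) = s"
    using unit_speed_dist[OF \<alpha>, of 0 a] unit_speed_dist[OF \<beta>, of 0 s] ab x by auto
  have "C \<le> comp_cos \<alpha> \<beta> a s"
    using unit_speed_mono[OF \<beta>, of s] ab x \<rho> C by (intro hinge_comparisonD[OF hc \<alpha>]) auto
  then have "C * (2 * a * s) \<le> a\<^sup>2 + s\<^sup>2 - e\<^sup>2"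
    using ab by (simp add: comp_cos_def e_def commute pos_le_divide_eq)
  then have "b * (C * (2 * a * s)) / s \<le> b * (a\<^sup>2 + s\<^sup>2 - e\<^sup>2) / s"
    using ab by (intro divide_right_mono mult_left_mono) auto
  then show "W \<le> a\<^sup>2 + b\<^sup>2 - 2 * a * b * C" using ab by (simp add: W_def mult_ac)
  \<comment> \<open>The same planar squared distance, now computed from \<open>x'\<close>.\<close>
  have W: "W = e\<^sup>2 + (b - s)\<^sup>2 + (b - s) * (e\<^sup>2 + s\<^sup>2 - a\<^sup>2) / s"
    using ab by (simp add: W_def field_simps power2_eq_square)
  show "W = (d (\<alpha> a) (\<beta> b))\<^sup>2" if "e = 0"
  proof -
    have eq: "\<beta> s = \<alpha> a" using that M by (simp add: e_def)
    then have "a = s" using dist by simp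
    moreover have "d (\<alpha> a) (\<beta> b) = b - s" using unit_speed_dist[OF \<beta>, of s b] ab eq by simp
    ultimately show ?thesis using W that by simp
  qed
  assume e: "0 < e"
  \<comment> \<open>Together with \<open>a + 2 * s < \<rho>\<close> this makes the hinge at
    \<open>x'\<close> with sides \<open>e\<close> and \<open>s\<close> short enough for
    \<open>hc\<close>.\<close>
  have e_le: "e \<le> a + s" using triangle[of "\<beta> s" "\<alpha> 0" "\<alpha> a"] M dist by (simp add: e_def commute)
  obtain \<alpha>' where \<alpha>': "unit_speed e \<alpha>'" "\<alpha>' 0 = \<beta> s" "\<alpha>' e = \<alpha> a"
    using geodesic[OF M(3,2)] unfolding e_def by blast
  have \<beta>': "unit_speed (b - s) (\<lambda>t. \<beta> (s + t))" "unit_speed s (\<lambda>t. \<beta> (s - t))"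
    using ab by (auto intro: unit_speed_shift[OF \<beta>] unit_speed_reverse[OF \<beta>])
  obtain C' where C': "has_cos \<alpha>' (\<lambda>t. \<beta> (s + t)) C'"
    using ex_has_cos[OF \<alpha>'(1) \<beta>'(1)] \<alpha>' ab e by auto
  obtain C'' where C'': "has_cos \<alpha>' (\<lambda>t. \<beta> (s - t)) C''"
    using ex_has_cos[OF \<alpha>'(1) \<beta>'(2)] \<alpha>' ab e by auto
  have "C'' \<le> comp_cos \<alpha>' (\<lambda>t. \<beta> (s - t)) e s"
    using \<alpha>' \<beta>'(2) ab x \<rho> C'' e e_le by (intro hinge_comparisonD[OF hc \<alpha>'(1)]) auto
  then have "C'' * (2 * e * s) \<le> e\<^sup>2 + s\<^sup>2 - a\<^sup>2"
    using ab e \<alpha>'(3) x dist by (simp add: comp_cos_def commute pos_le_divide_eq)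
  \<comment> \<open>At \<open>x'\<close> the directions forward along \<beta> and back to
    \<open>x\<close> are opposite, so the bound for the backward hinge becomes one for the forward
    hinge.\<close>
  moreover have "- C' \<le> C''"
    using has_cos_adjacent'[OF \<beta> ab(3,4) \<alpha>'(1,2) e has_cos_commute[THEN iffD1, OF C']
        has_cos_commute[THEN iffD1, OF C'']] by linarith
  then have "- C' * (2 * e * s) \<le> C'' * (2 * e * s)"
    using e ab by (intro mult_right_mono) auto
  ultimately have "- C' * (2 * e * s) \<le> e\<^sup>2 + s\<^sup>2 - a\<^sup>2" by linarith
  then have "(b - s) * (- C' * (2 * e * s)) / s \<le> (b - s) * (e\<^sup>2 + s\<^sup>2 - a\<^sup>2) / s"
    using ab by (intro divide_right_mono mult_left_mono) auto
  moreover have "(b - s) * (- C' * (2 * e * s)) / s = - (2 * e * (b - s) * C')"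
    using ab by (simp add: field_simps)
  ultimately have "e\<^sup>2 + (b - s)\<^sup>2 - 2 * e * (b - s) * C' \<le> W" using W by linarith
  then show "\<exists>\<alpha>' \<beta>' C'. unit_speed e \<alpha>' \<and> unit_speed (b - s) \<beta>' \<and> \<alpha>' 0 = \<beta>' 0 \<and>
       \<alpha>' e = \<alpha> a \<and> \<beta>' (b - s) = \<beta> b \<and> has_cos \<alpha>' \<beta>' C' \<and> e\<^sup>2 + (b - s)\<^sup>2 - 2 * e * (b - s) * C' \<le> W"
    using \<alpha>' \<beta>'(1) C' by (intro exI[of _ \<alpha>'] exI[of _ "\<lambda>t. \<beta> (s + t)"] exI[of _ C']) auto
qed

text \<open>Among the hinges between two given points that violate the comparison by a fixed amount,
  take one whose total length \<open>a + b\<close> is almost minimal. Moving the vertex by \<open>s\<close> along the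
  longer side yields another one, so \<open>a + s\<close> is almost \<open>e\<close>; but then the planar
  hinge is almost straight and there was no violation.\<close>

lemma hinge_comparison_extend:
  assumes hc: "hinge_comparison V (2 / 3 * l)" and V': "\<And>x. x \<in> V' \<Longrightarrow> mball x (2 * l) \<subseteq> V"
  shows "hinge_comparison V' l"
  unfolding hinge_comparison_def
proof (intro allI impI, elim conjE, rule ccontr)
  fix a\<^sub>0 b\<^sub>0 \<alpha>\<^sub>0 \<beta>\<^sub>0 C\<^sub>0
  assume h0: "unit_speed a\<^sub>0 \<alpha>\<^sub>0" "unit_speed b\<^sub>0 \<beta>\<^sub>0" "\<alpha>\<^sub>0 0 = \<beta>\<^sub>0 0" "\<alpha>\<^sub>0 0 \<in> V'" "0 < a\<^sub>0" "0 < b\<^sub>0"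
    "a\<^sub>0 + b\<^sub>0 < l" "has_cos \<alpha>\<^sub>0 \<beta>\<^sub>0 C\<^sub>0" and bad0: "\<not> C\<^sub>0 \<le> comp_cos \<alpha>\<^sub>0 \<beta>\<^sub>0 a\<^sub>0 b\<^sub>0"
  define p q x where "p = \<alpha>\<^sub>0 a\<^sub>0" and "q = \<beta>\<^sub>0 b\<^sub>0" and "x = \<alpha>\<^sub>0 0"
  define V0 where "V0 = a\<^sub>0\<^sup>2 + b\<^sub>0\<^sup>2 - 2 * a\<^sub>0 * b\<^sub>0 * C\<^sub>0"
  have l: "0 < l" using h0 by simp
  have M0: "p \<in> M" "q \<in> M" "x \<in> M"
    using unit_speed_in[OF h0(1)] unit_speed_in[OF h0(2)] h0(5,6) by (auto simp: p_def q_def x_def)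
  have dx: "d x p < l" "d x q < l"
    using unit_speed_dist[OF h0(1), of 0 a\<^sub>0] unit_speed_dist[OF h0(2), of 0 b\<^sub>0] h0
    by (auto simp: p_def q_def x_def)
  have "V0 < (d p q)\<^sup>2"
    using bad0 h0(5,6) by (simp add: comp_cos_def V0_def p_def q_def not_le pos_divide_less_eq mult_ac)
  define D where "D = (d p q)\<^sup>2 - V0"
  have D: "0 < D" using \<open>V0 < (d p q)\<^sup>2\<close> by (simp add: D_def)
  \<comment> \<open>The endpoints form an unordered pair, so that the sides may be exchanged to
    obtain \<open>a \<le> b\<close>; the common bound \<open>V0\<close> preserves the amount of
    violation.\<close>
  define hinge where "hinge a b \<alpha> \<beta> C \<longleftrightarrow> unit_speed a \<alpha> \<and> unit_speed b \<beta> \<and> \<alpha> 0 = \<beta> 0 \<and> 0 < a \<and> 0 < b \<and>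
      {\<alpha> a, \<beta> b} = {p, q} \<and> has_cos \<alpha> \<beta> C \<and> a\<^sup>2 + b\<^sup>2 - 2 * a * b * C \<le> V0 \<and> a + b < l" for a b \<alpha> \<beta> C
  define B where "B = {\<sigma>. \<exists>a b \<alpha> \<beta> C. hinge a b \<alpha> \<beta> C \<and> \<sigma> = a + b}"
  have "hinge a\<^sub>0 b\<^sub>0 \<alpha>\<^sub>0 \<beta>\<^sub>0 C\<^sub>0" using h0 by (auto simp: hinge_def V0_def p_def q_def)
  then have ne: "B \<noteq> {}" unfolding B_def by blast
  have bdd: "bdd_below B" by (intro bdd_belowI[of _ 0]) (auto simp: B_def hinge_def)
  \<comment> \<open>The tolerance is such that
    \<open>2 * l * l * (D / (36 * l)) = l / 18 * D\<close>, where \<open>l / 18\<close> is a lower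
    bound for the \<open>s\<close> chosen below.\<close>
  have "Inf B < Inf B + D / (36 * l)" using D l by simp
  then obtain a b \<alpha> \<beta> C where ab: "hinge a b \<alpha> \<beta> C" "a \<le> b" "a + b < Inf B + D / (36 * l)"
  proof -
    obtain \<sigma> where "\<sigma> \<in> B" "\<sigma> < Inf B + D / (36 * l)"
      using \<open>Inf B < Inf B + D / (36 * l)\<close> cInf_less_iff[OF ne bdd] by blast
    then obtain a b \<alpha> \<beta> C where *: "hinge a b \<alpha> \<beta> C" "a + b < Inf B + D / (36 * l)"
      by (auto simp: B_def)
    then have "hinge b a \<beta> \<alpha> C" by (auto simp: hinge_def has_cos_commute[of \<beta>] mult_ac add_ac insert_commute)
    then show ?thesis using that[of a b \<alpha> \<beta> C] that[of b a \<beta> \<alpha> C] * by (cases "a \<le> b") (auto simp: add.commute)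
  qed
  have \<alpha>: "unit_speed a \<alpha>" and \<beta>: "unit_speed b \<beta>" and vert: "\<alpha> 0 = \<beta> 0" and pos: "0 < a" "0 < b"
    and ends: "{\<alpha> a, \<beta> b} = {p, q}" and C: "has_cos \<alpha> \<beta> C" and V: "a\<^sup>2 + b\<^sup>2 - 2 * a * b * C \<le> V0"
    and len: "a + b < l"
    using ab(1) by (auto simp: hinge_def)
  have dpq: "d (\<alpha> a) (\<beta> b) = d p q" using ends commute[of p q] by (auto simp: doubleton_eq_iff)
  \<comment> \<open>The margin \<open>2 * l\<close> around \<open>V'\<close> is spent in two steps:
    from \<open>x\<close> to the fixed endpoint, and from there to the new vertex.\<close>
  have near: "y \<in> V" if y: "y \<in> M" "d y (\<beta> b) < l" for y
  proof -
    have "\<beta> b \<in> M" "d x (\<beta> b) < l" using ends M0 dx by auto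
    then have "d x y < 2 * l" using triangle[of x "\<beta> b" y] M0 y commute[of y "\<beta> b"] by simp
    moreover have "mball x (2 * l) \<subseteq> V" using V'[OF h0(4)] by (simp add: x_def)
    ultimately show ?thesis using M0 y by auto
  qed
  have \<beta>M: "\<beta> t \<in> V" if "0 \<le> t" "t \<le> b" for t
    using unit_speed_in[OF \<beta> that] unit_speed_dist[OF \<beta>, of t b] that pos len by (intro near) auto
  have ge: "2 / 3 * l \<le> a + b"
  proof (rule ccontr)
    assume "\<not> ?thesis"
    then have "C \<le> comp_cos \<alpha> \<beta> a b"
      using \<beta>M[of 0] vert pos C by (intro hinge_comparisonD[OF hc \<alpha> \<beta>]) auto
    then have "(d p q)\<^sup>2 \<le> a\<^sup>2 + b\<^sup>2 - 2 * a * b * C"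
      using pos by (simp add: comp_cos_def dpq pos_le_divide_eq mult_ac)
    then show False using V D by (simp add: D_def)
  qed
  \<comment> \<open>Two thirds of \<open>l / 3 - a / 2\<close>, the limit set by
    \<open>a + 2 * s < 2 / 3 * l\<close>; since \<open>a < l / 2\<close>, this stays above
    \<open>l / 18\<close>.\<close>
  define s where "s = 2 / 9 * l - a / 3"
  have s: "l / 18 < s" "0 < s" "s < b" "a + 2 * s < 2 / 3 * l"
    using ge len ab(2) pos l unfolding s_def by argo+
  define e where "e = d (\<beta> s) (\<alpha> a)"
  define W where "W = a\<^sup>2 + b\<^sup>2 - b * (a\<^sup>2 + s\<^sup>2 - e\<^sup>2) / s"
  have \<alpha>0: "\<alpha> 0 \<in> V" "\<beta> s \<in> V" using \<beta>M[of 0] \<beta>M[of s] vert s pos by auto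
  note step = hinge_step[OF hc \<alpha> \<beta> vert \<alpha>0 pos s(2-4) C, folded e_def, folded W_def]
  have W: "W \<le> V0" using step(1) V by linarith
  have M: "\<alpha> 0 \<in> M" "\<alpha> a \<in> M" "\<beta> s \<in> M" using unit_speed_in[OF \<alpha>] unit_speed_in[OF \<beta>] pos s by auto
  have dist: "d (\<alpha> 0) (\<alpha> a) = a" "d (\<alpha> 0) (\<beta> s) = s" "d (\<alpha> 0) (\<beta> b) = b"
    using unit_speed_dist[OF \<alpha>, of 0 a] unit_speed_dist[OF \<beta>, of 0 s] unit_speed_dist[OF \<beta>, of 0 b] pos s vert
    by auto
  have e_le: "e \<le> a + s" using triangle[of "\<beta> s" "\<alpha> 0" "\<alpha> a"] M dist by (simp add: e_def commute)
  have "e \<noteq> 0" using step(2) W D dpq by (auto simp: D_def)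
  then have e: "0 < e" using nonneg[of "\<beta> s" "\<alpha> a"] unfolding e_def by linarith
  obtain \<alpha>' \<beta>' C' where new: "unit_speed e \<alpha>'" "unit_speed (b - s) \<beta>'" "\<alpha>' 0 = \<beta>' 0"
       "\<alpha>' e = \<alpha> a" "\<beta>' (b - s) = \<beta> b" "has_cos \<alpha>' \<beta>' C'" "e\<^sup>2 + (b - s)\<^sup>2 - 2 * e * (b - s) * C' \<le> W"
    using step(3)[OF e] by blast
  have "hinge e (b - s) \<alpha>' \<beta>' C'"
    unfolding hinge_def using new W e s e_le len ends by auto
  then have "e + (b - s) \<in> B" unfolding B_def by blast
  then have "Inf B \<le> e + (b - s)" using bdd by (rule cInf_lower)
  then have \<delta>: "a + s - e < D / (36 * l)" using ab(3) by linarith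
  have "d p q \<le> a + b"
    using triangle[of "\<alpha> a" "\<alpha> 0" "\<beta> b"] M dist dpq unit_speed_in[OF \<beta>, of b] pos commute[of "\<alpha> a" "\<alpha> 0"] by simp
  then have "(d p q)\<^sup>2 \<le> (a + b)\<^sup>2" by (intro power_mono) auto
  define \<delta>\<^sub>0 where "\<delta>\<^sub>0 = a + s - e"
  \<comment> \<open>\<open>\<delta>\<^sub>0\<close> is the length saved by moving the vertex; if it
    were 0, then \<open>W\<close> would be \<open>(a + b)\<^sup>2\<close>, the value of a straight
    hinge.\<close>
  have "W = (a + b)\<^sup>2 - b * (2 * \<delta>\<^sub>0 * (a + s) - \<delta>\<^sub>0\<^sup>2) / s"
    using s by (simp add: W_def \<delta>\<^sub>0_def field_simps power2_eq_square)
  moreover have "b * (2 * \<delta>\<^sub>0 * (a + s) - \<delta>\<^sub>0\<^sup>2) / s < D"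
  proof -
    have "\<delta>\<^sub>0 * (a + s) * b \<le> \<delta>\<^sub>0 * l * l"
      using e_le s pos len l by (intro mult_mono) (auto simp: \<delta>\<^sub>0_def)
    have "b * (2 * \<delta>\<^sub>0 * (a + s) - \<delta>\<^sub>0\<^sup>2) \<le> b * (2 * \<delta>\<^sub>0 * (a + s))" using pos by (intro mult_left_mono) auto
    also have "\<dots> = 2 * (\<delta>\<^sub>0 * (a + s) * b)" by (simp only: mult_ac)
    also have "\<dots> \<le> 2 * (\<delta>\<^sub>0 * l * l)" using \<open>\<delta>\<^sub>0 * (a + s) * b \<le> \<delta>\<^sub>0 * l * l\<close> by simp
    also have "\<dots> = 2 * l * l * \<delta>\<^sub>0" by simp
    also have "\<dots> < 2 * l * l * (D / (36 * l))" using \<delta> l unfolding \<delta>\<^sub>0_def by (intro mult_strict_left_mono) auto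
    also have "\<dots> = l / 18 * D" using l by simp
    also have "\<dots> < s * D" using s D by (intro mult_strict_right_mono) auto
    finally show ?thesis using s by (simp add: pos_divide_less_eq mult_ac)
  qed
  ultimately have "V0 < W" using \<open>(d p q)\<^sup>2 \<le> (a + b)\<^sup>2\<close> by (simp add: D_def)
  then show False using W by simp
qed

text \<open>Each enlargement of the scale from \<open>2 / 3 * l\<close> to \<open>l\<close> costs a
  margin \<open>2 * l\<close>, and the geometric series of these margins sums to
  \<open>6 * l\<close>.\<close>

lemma hinge_comparison_iterate:
  assumes "z \<in> M"
  shows "0 < l \<Longrightarrow> hinge_comparison (mball z (R + 6 * l)) ((2 / 3) ^ n * l) \<Longrightarrow> hinge_comparison (mball z R) l"
proof (induction n arbitrary: R l)
  case 0
  then have hc: "hinge_comparison (mball z (R + 6 * l)) l" by simp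
  have "mball z R \<subseteq> mball z (R + 6 * l)" using 0(1) by (intro mball_subset_concentric) auto
  then show ?case by (rule hinge_comparison_mono[OF hc _ order_refl])
next
  case (Suc n)
  have "hinge_comparison (mball z (R + 2 * l)) (2 / 3 * l)"
  proof (rule Suc.IH)
    have "R + 2 * l + 6 * (2 / 3 * l) = R + 6 * l" "(2 / 3) ^ n * (2 / 3 * l) = (2 / 3) ^ Suc n * l" by simp_all
    then show "hinge_comparison (mball z (R + 2 * l + 6 * (2 / 3 * l))) ((2 / 3) ^ n * (2 / 3 * l))"
      using Suc.prems by (simp only:)
  qed (use Suc.prems in simp)
  then show ?case
  proof (rule hinge_comparison_extend)
    fix x assume x: "x \<in> mball z R"
    show "mball x (2 * l) \<subseteq> mball z (R + 2 * l)"
    proof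
      fix y assume "y \<in> mball x (2 * l)"
      then show "y \<in> mball z (R + 2 * l)" using x triangle[of z x y] by auto
    qed
  qed
qed

text \<open>Properness enters the globalization here: closed balls are compact, and a Lebesgue
  number of a cover by semiconcave balls serves as the common radius.\<close>

lemma uniformly_semiconcave:
  assumes "proper_space M d" "z \<in> M"
  obtains \<epsilon> where "0 < \<epsilon>" "\<And>x. x \<in> mcball z R \<Longrightarrow> semiconcave_in (mball x \<epsilon>)"
proof -
  let ?\<C> = "{mball x \<delta> |x \<delta>. semiconcave_in (mball x \<delta>)}"
  have "compactin mtopology (mcball z R)"
    using assms(1) unfolding proper_space_def using mbounded_mcball by blast
  moreover have "mcball z R \<subseteq> \<Union>?\<C>"
  proof
    fix x assume "x \<in> mcball z R"
    then have x: "x \<in> M" by auto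
    then obtain \<delta> where "0 < \<delta>" "semiconcave_in (mball x \<delta>)" using locally_semiconcave by blast
    then show "x \<in> \<Union>?\<C>" using x by (intro UnionI[of "mball x \<delta>"]) auto
  qed
  ultimately obtain \<epsilon> where "0 < \<epsilon>" "\<forall>x\<in>mcball z R. \<exists>U\<in>?\<C>. mball x \<epsilon> \<subseteq> U"
    using lebesgue_number[of "mcball z R" ?\<C>] by auto
  note \<epsilon> = this
  show ?thesis
  proof (rule that[OF \<epsilon>(1)])
    fix x assume "x \<in> mcball z R"
    then have "\<exists>U\<in>?\<C>. mball x \<epsilon> \<subseteq> U" using \<epsilon>(2) by (rule bspec[rotated])
    then obtain y \<delta> where "semiconcave_in (mball y \<delta>)" "mball x \<epsilon> \<subseteq> mball y \<delta>" by blast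
    then show "semiconcave_in (mball x \<epsilon>)" by (rule semiconcave_in_subset)
  qed
qed

lemma global_hinge_comparison:
  assumes proper: "proper_space M d" and \<alpha>: "unit_speed a \<alpha>" and \<beta>: "unit_speed b \<beta>"
    and vert: "\<alpha> 0 = \<beta> 0" and pos: "0 < a" "0 < b" and C: "has_cos \<alpha> \<beta> C"
  shows "C \<le> comp_cos \<alpha> \<beta> a b"
proof -
  \<comment> \<open>The summand 1 makes \<open>a + b < ?l\<close> strict.\<close>
  let ?z = "\<alpha> 0" and ?l = "a + b + 1"
  have z: "?z \<in> M" using unit_speed_in[OF \<alpha>, of 0] pos by simp
  obtain \<epsilon> where \<epsilon>: "0 < \<epsilon>" "\<And>x. x \<in> mcball ?z (1 + 6 * ?l) \<Longrightarrow> semiconcave_in (mball x \<epsilon>)"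
    using uniformly_semiconcave[OF proper z] by blast
  have "(\<lambda>n. (2 / 3) ^ n * ?l) \<longlonglongrightarrow> 0 * ?l" by (intro tendsto_mult LIMSEQ_power_zero tendsto_const) auto
  then have "eventually (\<lambda>n. (2 / 3) ^ n * ?l < \<epsilon>) sequentially" using \<epsilon>(1) by (intro order_tendstoD) auto
  then obtain n where n: "(2 / 3) ^ n * ?l < \<epsilon>" by (auto simp: eventually_sequentially)
  have "hinge_comparison (mball ?z (1 + 6 * ?l)) \<epsilon>"
    using \<epsilon>(2) mball_subset_mcball[of ?z] by (intro hinge_comparison_local[OF _ \<epsilon>(1)]) blast
  then have "hinge_comparison (mball ?z (1 + 6 * ?l)) ((2 / 3) ^ n * ?l)"
    using n by (rule hinge_comparison_mono[OF _ order_refl less_imp_le])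
  then have "hinge_comparison (mball ?z 1) ?l"
    using pos by (intro hinge_comparison_iterate[OF z, of ?l 1 n]) auto
  from hinge_comparisonD[OF this \<alpha> \<beta> vert _ pos _ C] show ?thesis using z by simp
qed

end

section \<open>The four point inequality\<close>

text \<open>With cosines \<open>c\<close>, \<open>c'\<close> and sines \<open>s\<close>,
  \<open>s'\<close> this is the positivity of sin (\<theta> + \<theta>') for \<theta> + \<theta>' <
  \<pi>. The order of the cosines yields \<open>\<bar>c\<bar> \<le> c'\<close> and
  \<open>s' \<le> s\<close>, which makes the proof algebraic.\<close>

lemma sin_add_pos:
  fixes c c' s s' :: real
  assumes c: "c \<le> c'" "0 < c + c'" and s: "s\<^sup>2 = 1 - c\<^sup>2" "s'\<^sup>2 = 1 - c'\<^sup>2" "0 \<le> s" "0 \<le> s'" "0 < s + s'"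
  shows "0 < s * c' + s' * c"
proof -
  have "\<bar>c\<bar> \<le> c'" using c by linarith
  then have "c\<^sup>2 \<le> c'\<^sup>2" using power_mono[of "\<bar>c\<bar>" c' 2] by simp
  then have "s'\<^sup>2 \<le> s\<^sup>2" unfolding s(1,2) by simp
  then have ss: "s' \<le> s" using s(3) by (rule power2_le_imp_le)
  then have "s' * c' \<le> s * c'" using \<open>\<bar>c\<bar> \<le> c'\<close> by (intro mult_right_mono) auto
  then have le: "s' * (c + c') \<le> s * c' + s' * c" by (simp add: algebra_simps)
  show ?thesis
  proof (cases "s' = 0")
    case True
    then have "0 < s" using s(5) by simp
    moreover have "0 < c'" using c by linarith
    ultimately show ?thesis using True by simp
  next
    case False
    then have "0 < s' * (c + c')" using s(4) c(2) by simp
    then show ?thesis using le by linarith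
  qed
qed

text \<open>The value of \<open>\<tau>\<close> is chosen such that, for unit vectors at angles \<open>\<theta>\<^sub>1\<close> and \<open>- \<theta>\<^sub>2\<close>
  to the first axis, the point \<open>(\<tau>, 0)\<close> lies on the segment between them.\<close>

lemma ex_chord_point:
  fixes c\<^sub>1 c\<^sub>2 :: real
  assumes c: "\<bar>c\<^sub>1\<bar> \<le> 1" "\<bar>c\<^sub>2\<bar> \<le> 1" "0 < c\<^sub>1 + c\<^sub>2"
  obtains \<tau> where "0 < \<tau>"
    "(sqrt (1 + \<tau>\<^sup>2 - 2 * \<tau> * c\<^sub>1) + sqrt (1 + \<tau>\<^sup>2 - 2 * \<tau> * c\<^sub>2))\<^sup>2
       = 2 - 2 * (c\<^sub>1 * c\<^sub>2 - sqrt (1 - c\<^sub>1\<^sup>2) * sqrt (1 - c\<^sub>2\<^sup>2))"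
proof -
  define s\<^sub>1 s\<^sub>2 where "s\<^sub>1 = sqrt (1 - c\<^sub>1\<^sup>2)" and "s\<^sub>2 = sqrt (1 - c\<^sub>2\<^sup>2)"
  have sq: "c\<^sub>1\<^sup>2 \<le> 1" "c\<^sub>2\<^sup>2 \<le> 1" using c by (auto simp: abs_square_le_1)
  have s: "0 \<le> s\<^sub>1" "0 \<le> s\<^sub>2" "s\<^sub>1\<^sup>2 = 1 - c\<^sub>1\<^sup>2" "s\<^sub>2\<^sup>2 = 1 - c\<^sub>2\<^sup>2" using sq by (auto simp: s\<^sub>1_def s\<^sub>2_def)
  show ?thesis
  proof (cases "s\<^sub>1 + s\<^sub>2 = 0")
    \<comment> \<open>Both unit vectors are \<open>(1, 0)\<close>, and the segment degenerates to
      that point.\<close>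
    case True
    then have "s\<^sub>1 = 0" "s\<^sub>2 = 0" using s by auto
    then have "c\<^sub>1\<^sup>2 = 1" "c\<^sub>2\<^sup>2 = 1" using s by auto
    then have "c\<^sub>1 = 1" "c\<^sub>2 = 1" using c by (auto simp: power2_eq_1_iff)
    then show ?thesis using that[of 1] by simp
  next
    case False
    then have S: "0 < s\<^sub>1 + s\<^sub>2" using s by simp
    define \<tau> where "\<tau> = (s\<^sub>1 * c\<^sub>2 + s\<^sub>2 * c\<^sub>1) / (s\<^sub>1 + s\<^sub>2)"
    have "0 < s\<^sub>1 * c\<^sub>2 + s\<^sub>2 * c\<^sub>1"
      using sin_add_pos[of c\<^sub>1 c\<^sub>2 s\<^sub>1 s\<^sub>2] sin_add_pos[of c\<^sub>2 c\<^sub>1 s\<^sub>2 s\<^sub>1] s S c(3)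
      by (cases "c\<^sub>1 \<le> c\<^sub>2") (auto simp: add.commute)
    then have \<tau>: "0 < \<tau>" using S by (simp add: \<tau>_def)
    \<comment> \<open>The point \<open>(\<tau>, 0)\<close> divides the chord in the ratio
      \<open>s\<^sub>1 : s\<^sub>2\<close>; \<open>K\<close> is the chord length per unit of
      \<open>s\<^sub>1 + s\<^sub>2\<close>.\<close>
    define K where "K = sqrt ((c\<^sub>1 - c\<^sub>2)\<^sup>2 + (s\<^sub>1 + s\<^sub>2)\<^sup>2) / (s\<^sub>1 + s\<^sub>2)"
    have K2: "K\<^sup>2 = ((c\<^sub>1 - c\<^sub>2)\<^sup>2 + (s\<^sub>1 + s\<^sub>2)\<^sup>2) / (s\<^sub>1 + s\<^sub>2)\<^sup>2" by (simp add: K_def power_divide)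
    have dist: "sqrt (1 + \<tau>\<^sup>2 - 2 * \<tau> * c) = s * K"
      if "c - \<tau> = s * (c - c') / (s\<^sub>1 + s\<^sub>2)" "(c - c')\<^sup>2 = (c\<^sub>1 - c\<^sub>2)\<^sup>2" "s\<^sup>2 = 1 - c\<^sup>2" "0 \<le> s" for c c' s
    proof -
      have "1 + \<tau>\<^sup>2 - 2 * \<tau> * c = (c - \<tau>)\<^sup>2 + s\<^sup>2" using that(3) by (simp add: power2_diff)
      also have "\<dots> = (s * K)\<^sup>2"
        using S that(2) by (simp add: that(1) K2 power_mult_distrib power_divide add_divide_distrib distrib_left)
      finally show ?thesis using S that(4) by (simp add: K_def)
    qed
    have "c\<^sub>1 - \<tau> = s\<^sub>1 * (c\<^sub>1 - c\<^sub>2) / (s\<^sub>1 + s\<^sub>2)" "c\<^sub>2 - \<tau> = s\<^sub>2 * (c\<^sub>2 - c\<^sub>1) / (s\<^sub>1 + s\<^sub>2)"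
      using S by (auto simp: \<tau>_def field_simps)
    then have "sqrt (1 + \<tau>\<^sup>2 - 2 * \<tau> * c\<^sub>1) + sqrt (1 + \<tau>\<^sup>2 - 2 * \<tau> * c\<^sub>2) = (s\<^sub>1 + s\<^sub>2) * K"
      using dist[of c\<^sub>1 s\<^sub>1 c\<^sub>2] dist[of c\<^sub>2 s\<^sub>2 c\<^sub>1] s by (simp add: power2_commute distrib_right)
    then have "(sqrt (1 + \<tau>\<^sup>2 - 2 * \<tau> * c\<^sub>1) + sqrt (1 + \<tau>\<^sup>2 - 2 * \<tau> * c\<^sub>2))\<^sup>2 = (c\<^sub>1 - c\<^sub>2)\<^sup>2 + (s\<^sub>1 + s\<^sub>2)\<^sup>2"
      using S by (simp add: power_mult_distrib K2)
    also have "\<dots> = 2 - 2 * (c\<^sub>1 * c\<^sub>2 - s\<^sub>1 * s\<^sub>2)"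
      using s(3,4) by (simp add: power2_diff power2_sum algebra_simps)
    finally show ?thesis using that[OF \<tau>] by (simp add: s\<^sub>1_def s\<^sub>2_def)
  qed
qed

text \<open>The cosines \<open>c\<^sub>1\<close>, \<open>c\<^sub>2\<close> are meant with respect to
  the direction opposite to the third one. If \<open>0 < c\<^sub>1 + c\<^sub>2\<close>, the form
  dominates the squared norm of a sum of plane vectors of lengths \<open>m\<^sub>1\<close>,
  \<open>m\<^sub>2\<close>, \<open>m\<^sub>3\<close> at angles \<open>\<theta>\<^sub>1\<close>,
  \<open>- \<theta>\<^sub>2\<close> and \<pi>. Otherwise \<open>- 1 \<le> k\<^sub>1\<^sub>2\<close>
  is enough, and the form dominates the square of
  \<open>\<bar>m\<^sub>1 - m\<^sub>2\<bar> - m\<^sub>3\<close>.\<close>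

lemma cos_form_nonneg:
  fixes c\<^sub>1 c\<^sub>2 k\<^sub>1\<^sub>2 k\<^sub>1\<^sub>3 k\<^sub>2\<^sub>3 :: real
  assumes c: "\<bar>c\<^sub>1\<bar> \<le> 1" "\<bar>c\<^sub>2\<bar> \<le> 1" and k: "- c\<^sub>1 \<le> k\<^sub>1\<^sub>3" "- c\<^sub>2 \<le> k\<^sub>2\<^sub>3" "- 1 \<le> k\<^sub>1\<^sub>2"
    and k12: "0 < c\<^sub>1 + c\<^sub>2 \<Longrightarrow> c\<^sub>1 * c\<^sub>2 - sqrt (1 - c\<^sub>1\<^sup>2) * sqrt (1 - c\<^sub>2\<^sup>2) \<le> k\<^sub>1\<^sub>2"
    and m: "0 \<le> m\<^sub>1" "0 \<le> m\<^sub>2" "0 \<le> m\<^sub>3"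
  shows "0 \<le> m\<^sub>1\<^sup>2 + m\<^sub>2\<^sup>2 + m\<^sub>3\<^sup>2 + 2 * (m\<^sub>1 * m\<^sub>2) * k\<^sub>1\<^sub>2 + 2 * (m\<^sub>1 * m\<^sub>3) * k\<^sub>1\<^sub>3 + 2 * (m\<^sub>2 * m\<^sub>3) * k\<^sub>2\<^sub>3"
proof -
  have 13: "2 * (m\<^sub>1 * m\<^sub>3) * (- c\<^sub>1) \<le> 2 * (m\<^sub>1 * m\<^sub>3) * k\<^sub>1\<^sub>3" "2 * (m\<^sub>2 * m\<^sub>3) * (- c\<^sub>2) \<le> 2 * (m\<^sub>2 * m\<^sub>3) * k\<^sub>2\<^sub>3"
    using k m by (intro mult_left_mono; simp)+
  show ?thesis
  proof (cases "0 < c\<^sub>1 + c\<^sub>2")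
    case True
    define s\<^sub>1 s\<^sub>2 where "s\<^sub>1 = sqrt (1 - c\<^sub>1\<^sup>2)" and "s\<^sub>2 = sqrt (1 - c\<^sub>2\<^sup>2)"
    have "c\<^sub>1\<^sup>2 \<le> 1" "c\<^sub>2\<^sup>2 \<le> 1" using c by (auto simp: abs_square_le_1)
    then have s: "s\<^sub>1\<^sup>2 = 1 - c\<^sub>1\<^sup>2" "s\<^sub>2\<^sup>2 = 1 - c\<^sub>2\<^sup>2" by (auto simp: s\<^sub>1_def s\<^sub>2_def)
    have "2 * (m\<^sub>1 * m\<^sub>2) * (c\<^sub>1 * c\<^sub>2 - s\<^sub>1 * s\<^sub>2) \<le> 2 * (m\<^sub>1 * m\<^sub>2) * k\<^sub>1\<^sub>2"
      using k12[OF True] m by (intro mult_left_mono) (auto simp: s\<^sub>1_def s\<^sub>2_def)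
    moreover have "m\<^sub>1\<^sup>2 + m\<^sub>2\<^sup>2 + m\<^sub>3\<^sup>2 + 2 * (m\<^sub>1 * m\<^sub>2) * (c\<^sub>1 * c\<^sub>2 - s\<^sub>1 * s\<^sub>2) + 2 * (m\<^sub>1 * m\<^sub>3) * (- c\<^sub>1) + 2 * (m\<^sub>2 * m\<^sub>3) * (- c\<^sub>2)
        = (m\<^sub>3 - m\<^sub>1 * c\<^sub>1 - m\<^sub>2 * c\<^sub>2)\<^sup>2 + (m\<^sub>1 * s\<^sub>1 - m\<^sub>2 * s\<^sub>2)\<^sup>2 + m\<^sub>1\<^sup>2 * (1 - c\<^sub>1\<^sup>2 - s\<^sub>1\<^sup>2) + m\<^sub>2\<^sup>2 * (1 - c\<^sub>2\<^sup>2 - s\<^sub>2\<^sup>2)"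
      by (simp add: power2_eq_square algebra_simps)
    moreover have "\<dots> \<ge> 0" using s by simp
    ultimately show ?thesis using 13 by linarith
  next
    case False
    have "m\<^sub>1 * c\<^sub>1 + m\<^sub>2 * c\<^sub>2 \<le> \<bar>m\<^sub>1 - m\<^sub>2\<bar>"
    proof -
      have "m\<^sub>2 * c\<^sub>2 \<le> m\<^sub>2 * (- c\<^sub>1)" using False m by (intro mult_left_mono) auto
      then have "m\<^sub>1 * c\<^sub>1 + m\<^sub>2 * c\<^sub>2 \<le> (m\<^sub>1 - m\<^sub>2) * c\<^sub>1" by (simp add: algebra_simps)
      also have "\<dots> \<le> \<bar>m\<^sub>1 - m\<^sub>2\<bar> * \<bar>c\<^sub>1\<bar>" by (metis abs_ge_self abs_mult)
      also have "\<dots> \<le> \<bar>m\<^sub>1 - m\<^sub>2\<bar>" using c(1) by (simp add: mult_left_le)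
      finally show ?thesis .
    qed
    then have "m\<^sub>3 * (m\<^sub>1 * c\<^sub>1 + m\<^sub>2 * c\<^sub>2) \<le> m\<^sub>3 * \<bar>m\<^sub>1 - m\<^sub>2\<bar>" using m by (intro mult_left_mono)
    moreover have "2 * (m\<^sub>1 * m\<^sub>2) * (- 1) \<le> 2 * (m\<^sub>1 * m\<^sub>2) * k\<^sub>1\<^sub>2" using k m by (intro mult_left_mono) auto
    moreover have "0 \<le> (\<bar>m\<^sub>1 - m\<^sub>2\<bar> - m\<^sub>3)\<^sup>2" by simp
    then have "0 \<le> (m\<^sub>1 - m\<^sub>2)\<^sup>2 - 2 * (m\<^sub>3 * \<bar>m\<^sub>1 - m\<^sub>2\<bar>) + m\<^sub>3\<^sup>2" by (simp add: power2_diff mult_ac)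
    then have "0 \<le> m\<^sub>1\<^sup>2 + m\<^sub>2\<^sup>2 - 2 * (m\<^sub>1 * m\<^sub>2) - 2 * (m\<^sub>3 * \<bar>m\<^sub>1 - m\<^sub>2\<bar>) + m\<^sub>3\<^sup>2" by (simp add: power2_diff)
    ultimately show ?thesis using 13 by (simp add: algebra_simps)
  qed
qed

context Metric_space
begin

text \<open>This condition, due to Lang, Schroeder and Sturm, characterizes non-negative curvature by
  distances alone; being quadratic in them, it passes to \<open>\<ell>\<^sup>2\<close>-type spaces over \<open>M\<close>.\<close>

definition four_point_inequality :: bool where
  "four_point_inequality \<longleftrightarrow>
     (\<forall>x\<in>M. \<forall>y\<^sub>1\<in>M. \<forall>y\<^sub>2\<in>M. \<forall>y\<^sub>3\<in>M. \<forall>l\<^sub>1\<ge>0. \<forall>l\<^sub>2\<ge>0. \<forall>l\<^sub>3\<ge>0.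
        l\<^sub>1 * l\<^sub>2 * (d y\<^sub>1 y\<^sub>2)\<^sup>2 + l\<^sub>1 * l\<^sub>3 * (d y\<^sub>1 y\<^sub>3)\<^sup>2 + l\<^sub>2 * l\<^sub>3 * (d y\<^sub>2 y\<^sub>3)\<^sup>2
          \<le> (l\<^sub>1 + l\<^sub>2 + l\<^sub>3) * (l\<^sub>1 * (d x y\<^sub>1)\<^sup>2 + l\<^sub>2 * (d x y\<^sub>2)\<^sup>2 + l\<^sub>3 * (d x y\<^sub>3)\<^sup>2))"

lemma has_cos_tendsto:
  assumes "has_cos \<alpha> \<beta> C" "0 < u" "0 < v"
  shows "((\<lambda>t. comp_cos \<alpha> \<beta> (u * t) (v * t)) \<longlongrightarrow> C) (at_right 0)"
  unfolding tendsto_iff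
proof (intro allI impI)
  fix e :: real assume "0 < e"
  then obtain \<eta> where \<eta>: "0 < \<eta>" "\<And>s t. 0 < s \<Longrightarrow> s < \<eta> \<Longrightarrow> 0 < t \<Longrightarrow> t < \<eta> \<Longrightarrow> \<bar>comp_cos \<alpha> \<beta> s t - C\<bar> < e"
    using has_cosE[OF assms(1)] by metis
  have "eventually (\<lambda>t. t \<in> {0<..<min (\<eta> / u) (\<eta> / v)}) (at_right 0)"
    using \<eta>(1) assms by (intro eventually_at_right_real) auto
  then show "eventually (\<lambda>t. dist (comp_cos \<alpha> \<beta> (u * t) (v * t)) C < e) (at_right 0)"
  proof (rule eventually_mono)
    fix t assume t: "t \<in> {0<..<min (\<eta> / u) (\<eta> / v)}"
    then have "u * t < \<eta>" "v * t < \<eta>" using assms by (auto simp: pos_less_divide_eq mult.commute)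
    then show "dist (comp_cos \<alpha> \<beta> (u * t) (v * t)) C < e"
      using \<eta>(2)[of "u * t" "v * t"] t assms by (auto simp: dist_real_def)
  qed
qed

text \<open>Divide by \<open>t\<close> the triangle inequality for
  \<open>\<alpha>\<^sub>1 t\<close>, \<open>\<alpha>\<^sub>0 (\<tau> * t)\<close>,
  \<open>\<alpha>\<^sub>2 t\<close>. The value \<tau> places the middle point on the segment between
  the outer ones in the planar picture with the angles added, so nothing is lost; the result is the
  triangle inequality for angles.\<close>

lemma has_cos_triangle:
  assumes \<alpha>: "unit_speed a\<^sub>0 \<alpha>\<^sub>0" "unit_speed a\<^sub>1 \<alpha>\<^sub>1" "unit_speed a\<^sub>2 \<alpha>\<^sub>2" and z: "\<alpha>\<^sub>1 0 = \<alpha>\<^sub>0 0" "\<alpha>\<^sub>2 0 = \<alpha>\<^sub>0 0"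
    and pos: "0 < a\<^sub>0" "0 < a\<^sub>1" "0 < a\<^sub>2"
    and C: "has_cos \<alpha>\<^sub>1 \<alpha>\<^sub>0 c\<^sub>1" "has_cos \<alpha>\<^sub>2 \<alpha>\<^sub>0 c\<^sub>2" "has_cos \<alpha>\<^sub>1 \<alpha>\<^sub>2 c"
    and c: "0 < c\<^sub>1 + c\<^sub>2"
  shows "c\<^sub>1 * c\<^sub>2 - sqrt (1 - c\<^sub>1\<^sup>2) * sqrt (1 - c\<^sub>2\<^sup>2) \<le> c"
proof -
  have b: "\<bar>c\<^sub>1\<bar> \<le> 1" "\<bar>c\<^sub>2\<bar> \<le> 1"
    using has_cos_bounds[OF C(1) \<alpha>(2,1) z(1) pos(2,1)] has_cos_bounds[OF C(2) \<alpha>(3,1) z(2) pos(3,1)] by auto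
  obtain \<tau> where \<tau>: "0 < \<tau>"
    "(sqrt (1 + \<tau>\<^sup>2 - 2 * \<tau> * c\<^sub>1) + sqrt (1 + \<tau>\<^sup>2 - 2 * \<tau> * c\<^sub>2))\<^sup>2
       = 2 - 2 * (c\<^sub>1 * c\<^sub>2 - sqrt (1 - c\<^sub>1\<^sup>2) * sqrt (1 - c\<^sub>2\<^sup>2))"
    using ex_chord_point[OF b c] .
  \<comment> \<open>Distances divided by \<open>t\<close>, as \<open>sq\<close> shows below, written
    through comparison cosines whose limits are known.\<close>
  let ?f = "\<lambda>t. sqrt (2 - 2 * comp_cos \<alpha>\<^sub>1 \<alpha>\<^sub>2 (1 * t) (1 * t))"
  let ?g = "\<lambda>t. sqrt (1 + \<tau>\<^sup>2 - 2 * \<tau> * comp_cos \<alpha>\<^sub>1 \<alpha>\<^sub>0 (1 * t) (\<tau> * t)) + sqrt (1 + \<tau>\<^sup>2 - 2 * \<tau> * comp_cos \<alpha>\<^sub>2 \<alpha>\<^sub>0 (1 * t) (\<tau> * t))"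
  have "sqrt (2 - 2 * c) \<le> sqrt (1 + \<tau>\<^sup>2 - 2 * \<tau> * c\<^sub>1) + sqrt (1 + \<tau>\<^sup>2 - 2 * \<tau> * c\<^sub>2)"
  proof (rule tendsto_le[of "at_right 0"])
    show "(?f \<longlongrightarrow> sqrt (2 - 2 * c)) (at_right 0)"
      by (intro tendsto_intros has_cos_tendsto C) auto
    show "(?g \<longlongrightarrow> sqrt (1 + \<tau>\<^sup>2 - 2 * \<tau> * c\<^sub>1) + sqrt (1 + \<tau>\<^sup>2 - 2 * \<tau> * c\<^sub>2)) (at_right 0)"
      using \<tau>(1) by (intro tendsto_intros has_cos_tendsto C) auto
    have "eventually (\<lambda>t. t \<in> {0<..<Min {a\<^sub>1, a\<^sub>2, a\<^sub>0 / \<tau>}}) (at_right 0)"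
      using pos \<tau>(1) by (intro eventually_at_right_real) auto
    then show "eventually (\<lambda>t. ?f t \<le> ?g t) (at_right 0)"
    proof (rule eventually_mono)
      fix t assume "t \<in> {0<..<Min {a\<^sub>1, a\<^sub>2, a\<^sub>0 / \<tau>}}"
      then have t: "0 < t" "t < a\<^sub>1" "t < a\<^sub>2" "\<tau> * t < a\<^sub>0"
        using \<tau>(1) by (auto simp: pos_less_divide_eq mult.commute)
      have M: "\<alpha>\<^sub>1 t \<in> M" "\<alpha>\<^sub>2 t \<in> M" "\<alpha>\<^sub>0 (\<tau> * t) \<in> M"
        using unit_speed_in[OF \<alpha>(1)] unit_speed_in[OF \<alpha>(2)] unit_speed_in[OF \<alpha>(3)] t \<tau>(1) by auto
      have sq: "sqrt (u\<^sup>2 + v\<^sup>2 - 2 * u * v * comp_cos \<beta> \<gamma> (u * t) (v * t)) = d (\<beta> (u * t)) (\<gamma> (v * t)) / t"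
        if "0 < u" "0 < v" for u v \<beta> \<gamma>
      proof -
        have "u\<^sup>2 + v\<^sup>2 - 2 * u * v * comp_cos \<beta> \<gamma> (u * t) (v * t) = (d (\<beta> (u * t)) (\<gamma> (v * t)) / t)\<^sup>2"
          using that t(1) by (simp add: comp_cos_def field_simps power2_eq_square)
        then show ?thesis using t(1) by simp
      qed
      have "d (\<alpha>\<^sub>1 t) (\<alpha>\<^sub>2 t) / t \<le> d (\<alpha>\<^sub>1 t) (\<alpha>\<^sub>0 (\<tau> * t)) / t + d (\<alpha>\<^sub>2 t) (\<alpha>\<^sub>0 (\<tau> * t)) / t"
        using triangle[OF M(1,3,2)] t(1) commute[of "\<alpha>\<^sub>2 t"] by (simp add: add_divide_distrib[symmetric] divide_right_mono)
      then show "?f t \<le> ?g t"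
        using sq[of 1 1 \<alpha>\<^sub>1 \<alpha>\<^sub>2] sq[of 1 \<tau> \<alpha>\<^sub>1 \<alpha>\<^sub>0] sq[of 1 \<tau> \<alpha>\<^sub>2 \<alpha>\<^sub>0] \<tau>(1) by simp
    qed
  qed simp
  moreover have "0 \<le> sqrt (2 - 2 * c)"
    using has_cos_bounds(2)[OF C(3) \<alpha>(2,3) _ pos(2,3)] z by simp
  ultimately have "(sqrt (2 - 2 * c))\<^sup>2 \<le> (sqrt (1 + \<tau>\<^sup>2 - 2 * \<tau> * c\<^sub>1) + sqrt (1 + \<tau>\<^sup>2 - 2 * \<tau> * c\<^sub>2))\<^sup>2"
    by (intro power_mono)
  then show ?thesis using \<tau>(2) has_cos_bounds(2)[OF C(3) \<alpha>(2,3) _ pos(2,3)] z by simp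
qed

end

context locally_nonneg_curved
begin

text \<open>At an interior point of \<gamma> the direction to \<open>\<gamma> L\<close> has an
  opposite, \<open>?\<sigma>\<^sub>0\<close>. With angles measured against it, adjacency bounds
  \<open>c\<^sub>1\<^sub>3\<close> and \<open>c\<^sub>2\<^sub>3\<close>, and the triangle inequality
  for angles bounds \<open>c\<^sub>1\<^sub>2\<close>; global hinge comparison passes from angles to
  distances. What remains is \<open>cos_form_nonneg\<close> with
  \<open>l\<^sub>i * r\<^sub>i\<close> in place of \<open>m\<^sub>i\<close>.\<close>

lemma four_point_interior:
  assumes proper: "proper_space M d" and \<gamma>: "unit_speed L \<gamma>" and \<tau>: "0 < \<tau>" "\<tau> < L"
    and y: "y\<^sub>1 \<in> M" "y\<^sub>2 \<in> M" and ne: "y\<^sub>1 \<noteq> \<gamma> \<tau>" "y\<^sub>2 \<noteq> \<gamma> \<tau>" and l: "0 \<le> l\<^sub>1" "0 \<le> l\<^sub>2" "0 \<le> l\<^sub>3"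
  shows "l\<^sub>1 * l\<^sub>2 * (d y\<^sub>1 y\<^sub>2)\<^sup>2 + l\<^sub>1 * l\<^sub>3 * (d y\<^sub>1 (\<gamma> L))\<^sup>2 + l\<^sub>2 * l\<^sub>3 * (d y\<^sub>2 (\<gamma> L))\<^sup>2
      \<le> (l\<^sub>1 + l\<^sub>2 + l\<^sub>3) * (l\<^sub>1 * (d (\<gamma> \<tau>) y\<^sub>1)\<^sup>2 + l\<^sub>2 * (d (\<gamma> \<tau>) y\<^sub>2)\<^sup>2 + l\<^sub>3 * (d (\<gamma> \<tau>) (\<gamma> L))\<^sup>2)"
proof -
  let ?z = "\<gamma> \<tau>"
  have z: "?z \<in> M" using unit_speed_in[OF \<gamma>] \<tau> by simp
  define r\<^sub>1 r\<^sub>2 r\<^sub>3 where "r\<^sub>1 = d ?z y\<^sub>1" and "r\<^sub>2 = d ?z y\<^sub>2" and "r\<^sub>3 = L - \<tau>"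
  have r: "0 < r\<^sub>1" "0 < r\<^sub>2" "0 < r\<^sub>3"
    using mdist_pos_less[of ?z y\<^sub>1] mdist_pos_less[of ?z y\<^sub>2] ne z y \<tau>
    by (auto simp: r\<^sub>1_def r\<^sub>2_def r\<^sub>3_def)
  obtain \<sigma>\<^sub>1 where \<sigma>\<^sub>1: "unit_speed r\<^sub>1 \<sigma>\<^sub>1" "\<sigma>\<^sub>1 0 = ?z" "\<sigma>\<^sub>1 r\<^sub>1 = y\<^sub>1" using geodesic[OF z y(1)] unfolding r\<^sub>1_def by blast
  obtain \<sigma>\<^sub>2 where \<sigma>\<^sub>2: "unit_speed r\<^sub>2 \<sigma>\<^sub>2" "\<sigma>\<^sub>2 0 = ?z" "\<sigma>\<^sub>2 r\<^sub>2 = y\<^sub>2" using geodesic[OF z y(2)] unfolding r\<^sub>2_def by blast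
  let ?\<sigma>\<^sub>3 = "\<lambda>t. \<gamma> (\<tau> + t)" and ?\<sigma>\<^sub>0 = "\<lambda>t. \<gamma> (\<tau> - t)"
  have \<sigma>\<^sub>3: "unit_speed r\<^sub>3 ?\<sigma>\<^sub>3" unfolding r\<^sub>3_def using \<tau> by (intro unit_speed_shift[OF \<gamma>]) auto
  have \<sigma>\<^sub>0: "unit_speed \<tau> ?\<sigma>\<^sub>0" using \<tau> by (intro unit_speed_reverse[OF \<gamma>]) auto
  obtain c\<^sub>1 where c\<^sub>1: "has_cos \<sigma>\<^sub>1 ?\<sigma>\<^sub>0 c\<^sub>1" using ex_has_cos[OF \<sigma>\<^sub>1(1) \<sigma>\<^sub>0] \<sigma>\<^sub>1 r \<tau> by auto
  obtain c\<^sub>2 where c\<^sub>2: "has_cos \<sigma>\<^sub>2 ?\<sigma>\<^sub>0 c\<^sub>2" using ex_has_cos[OF \<sigma>\<^sub>2(1) \<sigma>\<^sub>0] \<sigma>\<^sub>2 r \<tau> by auto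
  obtain c\<^sub>1\<^sub>2 where c\<^sub>1\<^sub>2: "has_cos \<sigma>\<^sub>1 \<sigma>\<^sub>2 c\<^sub>1\<^sub>2" using ex_has_cos[OF \<sigma>\<^sub>1(1) \<sigma>\<^sub>2(1)] \<sigma>\<^sub>1 \<sigma>\<^sub>2 r by auto
  obtain c\<^sub>1\<^sub>3 where c\<^sub>1\<^sub>3: "has_cos \<sigma>\<^sub>1 ?\<sigma>\<^sub>3 c\<^sub>1\<^sub>3" using ex_has_cos[OF \<sigma>\<^sub>1(1) \<sigma>\<^sub>3] \<sigma>\<^sub>1 r by auto
  obtain c\<^sub>2\<^sub>3 where c\<^sub>2\<^sub>3: "has_cos \<sigma>\<^sub>2 ?\<sigma>\<^sub>3 c\<^sub>2\<^sub>3" using ex_has_cos[OF \<sigma>\<^sub>2(1) \<sigma>\<^sub>3] \<sigma>\<^sub>2 r by auto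
  have adj: "0 \<le> c\<^sub>1\<^sub>3 + c\<^sub>1" "0 \<le> c\<^sub>2\<^sub>3 + c\<^sub>2"
    using has_cos_adjacent'[OF \<gamma> \<tau> \<sigma>\<^sub>1(1,2) r(1) has_cos_commute[THEN iffD1, OF c\<^sub>1\<^sub>3] has_cos_commute[THEN iffD1, OF c\<^sub>1]]
      has_cos_adjacent'[OF \<gamma> \<tau> \<sigma>\<^sub>2(1,2) r(2) has_cos_commute[THEN iffD1, OF c\<^sub>2\<^sub>3] has_cos_commute[THEN iffD1, OF c\<^sub>2]]
    by auto
  have k: "c\<^sub>1\<^sub>2 \<le> comp_cos \<sigma>\<^sub>1 \<sigma>\<^sub>2 r\<^sub>1 r\<^sub>2" "c\<^sub>1\<^sub>3 \<le> comp_cos \<sigma>\<^sub>1 ?\<sigma>\<^sub>3 r\<^sub>1 r\<^sub>3" "c\<^sub>2\<^sub>3 \<le> comp_cos \<sigma>\<^sub>2 ?\<sigma>\<^sub>3 r\<^sub>2 r\<^sub>3"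
    using global_hinge_comparison[OF proper \<sigma>\<^sub>1(1) \<sigma>\<^sub>2(1) _ r(1,2) c\<^sub>1\<^sub>2] global_hinge_comparison[OF proper \<sigma>\<^sub>1(1) \<sigma>\<^sub>3 _ r(1,3) c\<^sub>1\<^sub>3]
      global_hinge_comparison[OF proper \<sigma>\<^sub>2(1) \<sigma>\<^sub>3 _ r(2,3) c\<^sub>2\<^sub>3] \<sigma>\<^sub>1(2) \<sigma>\<^sub>2(2) by auto
  have "c\<^sub>1 * c\<^sub>2 - sqrt (1 - c\<^sub>1\<^sup>2) * sqrt (1 - c\<^sub>2\<^sup>2) \<le> c\<^sub>1\<^sub>2" if "0 < c\<^sub>1 + c\<^sub>2"
    using has_cos_triangle[OF \<sigma>\<^sub>0 \<sigma>\<^sub>1(1) \<sigma>\<^sub>2(1) _ _ \<tau>(1) r(1,2) c\<^sub>1 c\<^sub>2 c\<^sub>1\<^sub>2 that] \<sigma>\<^sub>1(2) \<sigma>\<^sub>2(2) by simp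
  moreover have "\<bar>c\<^sub>1\<bar> \<le> 1" "\<bar>c\<^sub>2\<bar> \<le> 1" "- 1 \<le> c\<^sub>1\<^sub>2"
    using has_cos_bounds[OF c\<^sub>1 \<sigma>\<^sub>1(1) \<sigma>\<^sub>0 _ r(1) \<tau>(1)] has_cos_bounds[OF c\<^sub>2 \<sigma>\<^sub>2(1) \<sigma>\<^sub>0 _ r(2) \<tau>(1)]
      has_cos_bounds[OF c\<^sub>1\<^sub>2 \<sigma>\<^sub>1(1) \<sigma>\<^sub>2(1) _ r(1,2)] \<sigma>\<^sub>1(2) \<sigma>\<^sub>2(2) by auto
  ultimately have form: "0 \<le> (l\<^sub>1 * r\<^sub>1)\<^sup>2 + (l\<^sub>2 * r\<^sub>2)\<^sup>2 + (l\<^sub>3 * r\<^sub>3)\<^sup>2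
      + 2 * ((l\<^sub>1 * r\<^sub>1) * (l\<^sub>2 * r\<^sub>2)) * comp_cos \<sigma>\<^sub>1 \<sigma>\<^sub>2 r\<^sub>1 r\<^sub>2
      + 2 * ((l\<^sub>1 * r\<^sub>1) * (l\<^sub>3 * r\<^sub>3)) * comp_cos \<sigma>\<^sub>1 ?\<sigma>\<^sub>3 r\<^sub>1 r\<^sub>3
      + 2 * ((l\<^sub>2 * r\<^sub>2) * (l\<^sub>3 * r\<^sub>3)) * comp_cos \<sigma>\<^sub>2 ?\<sigma>\<^sub>3 r\<^sub>2 r\<^sub>3"
    using k adj l r by (intro cos_form_nonneg[of c\<^sub>1 c\<^sub>2]) auto
  have expand: "2 * ((l * r) * (l' * r')) * comp_cos \<alpha> \<beta> r r' = l * l' * (r\<^sup>2 + r'\<^sup>2 - (d (\<alpha> r) (\<beta> r'))\<^sup>2)"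
    if "0 < r" "0 < r'" for l l' r r' \<alpha> \<beta>
    using that by (simp add: comp_cos_def)
  have "\<gamma> (\<tau> + r\<^sub>3) = \<gamma> L" by (simp add: r\<^sub>3_def)
  then have "0 \<le> (l\<^sub>1 * r\<^sub>1)\<^sup>2 + (l\<^sub>2 * r\<^sub>2)\<^sup>2 + (l\<^sub>3 * r\<^sub>3)\<^sup>2
      + l\<^sub>1 * l\<^sub>2 * (r\<^sub>1\<^sup>2 + r\<^sub>2\<^sup>2 - (d y\<^sub>1 y\<^sub>2)\<^sup>2) + l\<^sub>1 * l\<^sub>3 * (r\<^sub>1\<^sup>2 + r\<^sub>3\<^sup>2 - (d y\<^sub>1 (\<gamma> L))\<^sup>2)
      + l\<^sub>2 * l\<^sub>3 * (r\<^sub>2\<^sup>2 + r\<^sub>3\<^sup>2 - (d y\<^sub>2 (\<gamma> L))\<^sup>2)"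
    using form unfolding expand[OF r(1,2)] expand[OF r(1,3)] expand[OF r(2,3)] \<sigma>\<^sub>1(3) \<sigma>\<^sub>2(3) by (simp only:)
  moreover have "d ?z (\<gamma> L) = r\<^sub>3" using unit_speed_dist[OF \<gamma>, of \<tau> L] \<tau> by (simp add: r\<^sub>3_def)
  ultimately show ?thesis
    by (simp add: r\<^sub>1_def[symmetric] r\<^sub>2_def[symmetric] power2_eq_square algebra_simps)
qed

text \<open>Since \<open>x\<close> need not be interior to a geodesic, it is replaced by
  \<open>\<gamma> t\<close> on a geodesic from \<open>x\<close> to \<open>y\<^sub>3\<close>, with
  \<open>t\<close> tending to 0. If \<open>x = y\<^sub>3\<close>, the triangle inequality for
  \<open>y\<^sub>1\<close>, \<open>x\<close>, \<open>y\<^sub>2\<close> suffices.\<close>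

lemma four_point:
  assumes proper: "proper_space M d"
  shows four_point_inequality
  unfolding four_point_inequality_def
proof (intro ballI allI impI)
  fix x y\<^sub>1 y\<^sub>2 y\<^sub>3 and l\<^sub>1 l\<^sub>2 l\<^sub>3 :: real
  assume M: "x \<in> M" "y\<^sub>1 \<in> M" "y\<^sub>2 \<in> M" "y\<^sub>3 \<in> M" and l: "0 \<le> l\<^sub>1" "0 \<le> l\<^sub>2" "0 \<le> l\<^sub>3"
  show "l\<^sub>1 * l\<^sub>2 * (d y\<^sub>1 y\<^sub>2)\<^sup>2 + l\<^sub>1 * l\<^sub>3 * (d y\<^sub>1 y\<^sub>3)\<^sup>2 + l\<^sub>2 * l\<^sub>3 * (d y\<^sub>2 y\<^sub>3)\<^sup>2
          \<le> (l\<^sub>1 + l\<^sub>2 + l\<^sub>3) * (l\<^sub>1 * (d x y\<^sub>1)\<^sup>2 + l\<^sub>2 * (d x y\<^sub>2)\<^sup>2 + l\<^sub>3 * (d x y\<^sub>3)\<^sup>2)"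
  proof (cases "x = y\<^sub>3")
    case True
    have "d y\<^sub>1 y\<^sub>2 \<le> d x y\<^sub>1 + d x y\<^sub>2" using triangle[of y\<^sub>1 x y\<^sub>2] M commute[of x y\<^sub>1] by simp
    then have "(d y\<^sub>1 y\<^sub>2)\<^sup>2 \<le> (d x y\<^sub>1 + d x y\<^sub>2)\<^sup>2" by (intro power_mono) auto
    then have "l\<^sub>1 * l\<^sub>2 * (d y\<^sub>1 y\<^sub>2)\<^sup>2 \<le> l\<^sub>1 * l\<^sub>2 * (d x y\<^sub>1 + d x y\<^sub>2)\<^sup>2" using l by (intro mult_left_mono) auto
    moreover have "0 \<le> (l\<^sub>1 * d x y\<^sub>1 - l\<^sub>2 * d x y\<^sub>2)\<^sup>2" by simp
    ultimately show ?thesis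
      using True M commute[of y\<^sub>1 y\<^sub>3] commute[of y\<^sub>2 y\<^sub>3] by (simp add: power2_eq_square algebra_simps)
  next
    case False
    define L where "L = d x y\<^sub>3"
    have L: "0 < L" using False M mdist_pos_less[of x y\<^sub>3] by (simp add: L_def)
    obtain \<gamma> where \<gamma>: "unit_speed L \<gamma>" "\<gamma> 0 = x" "\<gamma> L = y\<^sub>3" using geodesic[OF M(1,4)] unfolding L_def by blast
    have ev: "eventually (\<lambda>t. t \<in> {0<..<L}) (at_right 0)" using L by (intro eventually_at_right_real) auto
    have near: "\<bar>d (\<gamma> t) y - d x y\<bar> \<le> t" if "t \<in> {0<..<L}" "y \<in> M" for t y
    proof -
      have "\<gamma> t \<in> M" "d x (\<gamma> t) = t" using unit_speed_in[OF \<gamma>(1)] unit_speed_dist[OF \<gamma>(1), of 0 t] \<gamma>(2) that by auto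
      then show ?thesis using triangle[of x "\<gamma> t" y] triangle[of "\<gamma> t" x y] that M commute[of x "\<gamma> t"] by auto
    qed
    have lim: "((\<lambda>t. d (\<gamma> t) y) \<longlongrightarrow> d x y) (at_right 0)" if "y \<in> M" for y
    proof -
      have "((\<lambda>t. d (\<gamma> t) y - d x y) \<longlongrightarrow> 0) (at_right 0)"
      proof (rule Lim_null_comparison)
        show "eventually (\<lambda>t. norm (d (\<gamma> t) y - d x y) \<le> t) (at_right 0)"
          using ev by (rule eventually_mono) (use near that in auto)
        show "((\<lambda>t::real. t) \<longlongrightarrow> 0) (at_right 0)" by (rule tendsto_ident_at)
      qed
      then show ?thesis by (simp add: LIM_zero_iff)
    qed
    \<comment> \<open>\<open>four_point_interior\<close> wants \<open>y\<^sub>1\<close> and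
      \<open>y\<^sub>2\<close> off the centre; for small \<open>t\<close> this holds even when
      \<open>y = x\<close>.\<close>
    have away: "eventually (\<lambda>t. y \<noteq> \<gamma> t) (at_right 0)" if "y \<in> M" for y
    proof (cases "y = x")
      case True
      have "y \<noteq> \<gamma> t" if "t \<in> {0<..<L}" for t
        using unit_speed_dist[OF \<gamma>(1), of 0 t] \<gamma>(2) that True M by auto
      then show ?thesis using ev by (rule eventually_mono[rotated])
    next
      case False
      then have "0 < d x y" using M that mdist_pos_less[of x y] by auto
      then have "eventually (\<lambda>t. 0 < d (\<gamma> t) y) (at_right 0)" using lim[OF that] by (intro order_tendstoD)
      then show ?thesis by (rule eventually_mono) (use that in auto)
    qed
    show ?thesis
    proof (rule tendsto_le[OF _ _ tendsto_const])
      show "((\<lambda>t. (l\<^sub>1 + l\<^sub>2 + l\<^sub>3) * (l\<^sub>1 * (d (\<gamma> t) y\<^sub>1)\<^sup>2 + l\<^sub>2 * (d (\<gamma> t) y\<^sub>2)\<^sup>2 + l\<^sub>3 * (d (\<gamma> t) y\<^sub>3)\<^sup>2))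
          \<longlongrightarrow> (l\<^sub>1 + l\<^sub>2 + l\<^sub>3) * (l\<^sub>1 * (d x y\<^sub>1)\<^sup>2 + l\<^sub>2 * (d x y\<^sub>2)\<^sup>2 + l\<^sub>3 * (d x y\<^sub>3)\<^sup>2)) (at_right 0)"
        using M by (intro tendsto_intros lim)
      show "eventually (\<lambda>t. l\<^sub>1 * l\<^sub>2 * (d y\<^sub>1 y\<^sub>2)\<^sup>2 + l\<^sub>1 * l\<^sub>3 * (d y\<^sub>1 y\<^sub>3)\<^sup>2 + l\<^sub>2 * l\<^sub>3 * (d y\<^sub>2 y\<^sub>3)\<^sup>2
          \<le> (l\<^sub>1 + l\<^sub>2 + l\<^sub>3) * (l\<^sub>1 * (d (\<gamma> t) y\<^sub>1)\<^sup>2 + l\<^sub>2 * (d (\<gamma> t) y\<^sub>2)\<^sup>2 + l\<^sub>3 * (d (\<gamma> t) y\<^sub>3)\<^sup>2)) (at_right 0)"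
        using ev away[OF M(2)] away[OF M(3)]
      proof eventually_elim
        case (elim t)
        then show ?case
          using four_point_interior[OF proper \<gamma>(1), of t y\<^sub>1 y\<^sub>2 l\<^sub>1 l\<^sub>2 l\<^sub>3] M l \<gamma>(3) by auto
      qed
    qed simp
  qed
qed

end

section \<open>The Alexandrov condition, local concavity and the four point inequality\<close>

context Metric_space
begin

lemma alexandrov_locally_nonneg_curved:
  assumes "alexandrov_nonneg M d"
  shows "locally_nonneg_curved M d"
proof
  obtain \<U> where geo: "geodesic_space M d"
    and \<U>: "\<And>U. U \<in> \<U> \<Longrightarrow> openin mtopology U" "\<Union>\<U> = M" "\<And>U. U \<in> \<U> \<Longrightarrow> triangle_comparison_in M d U"
    using assms unfolding alexandrov_nonneg_def by metis
  show "\<exists>\<gamma>. unit_speed (d x y) \<gamma> \<and> \<gamma> 0 = x \<and> \<gamma> (d x y) = y" if "x \<in> M" "y \<in> M" for x y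
    using geo that minimizing_geodesic_unit_speed unfolding geodesic_space_def by metis
  show "\<exists>\<delta>>0. semiconcave_in (mball z \<delta>)" if z: "z \<in> M" for z
  proof -
    obtain U where U: "U \<in> \<U>" "z \<in> U" using z \<U>(2) by auto
    then obtain r where r: "0 < r" "mball z r \<subseteq> U" using \<U>(1)[OF U(1)] unfolding openin_mtopology by blast
    have "mball z (2 * (r / 2)) \<subseteq> U" using r by simp
    then have "semiconcave_in (mball z (r / 2))"
      by (rule triangle_comparison_semiconcave[OF geo \<U>(3)[OF U(1)]])
    then show ?thesis using r(1) half_gt_zero by blast
  qed
qed

lemma four_point_inequalityD:
  assumes four_point_inequality "x \<in> M" "y\<^sub>1 \<in> M" "y\<^sub>2 \<in> M" "y\<^sub>3 \<in> M" "0 \<le> l\<^sub>1" "0 \<le> l\<^sub>2" "0 \<le> l\<^sub>3"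
  shows "l\<^sub>1 * l\<^sub>2 * (d y\<^sub>1 y\<^sub>2)\<^sup>2 + l\<^sub>1 * l\<^sub>3 * (d y\<^sub>1 y\<^sub>3)\<^sup>2 + l\<^sub>2 * l\<^sub>3 * (d y\<^sub>2 y\<^sub>3)\<^sup>2
      \<le> (l\<^sub>1 + l\<^sub>2 + l\<^sub>3) * (l\<^sub>1 * (d x y\<^sub>1)\<^sup>2 + l\<^sub>2 * (d x y\<^sub>2)\<^sup>2 + l\<^sub>3 * (d x y\<^sub>3)\<^sup>2)"
  using assms unfolding four_point_inequality_def by blast

text \<open>Letting the weight \<open>\<epsilon>\<close> of \<open>p\<close> tend to \<open>0\<close> in the four point inequality around a point
  between \<open>q\<close> and \<open>r\<close> yields the comparison.\<close>

lemma four_point_triangle_comparison: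
  assumes four: four_point_inequality
  shows "triangle_comparison_in M d U"
  unfolding triangle_comparison_in_def
proof (intro allI impI ballI, elim conjE)
  fix p q r g\<^sub>p\<^sub>q g\<^sub>q\<^sub>r g\<^sub>r\<^sub>p and p' q' r' :: "real^2" and x x'
  assume g: "minimizing_geodesic M d p q g\<^sub>p\<^sub>q" "minimizing_geodesic M d q r g\<^sub>q\<^sub>r"
    and D: "dist p' q' = d p q" "dist q' r' = d q r" "dist r' p' = d r p"
    and x: "x \<in> g\<^sub>q\<^sub>r ` {0..1}" and x': "x' \<in> closed_segment q' r'" "dist q' x' = d q x"
  let ?L = "d q r"
  have M: "p \<in> M" "q \<in> M" "r \<in> M"
    using minimizing_geodesic_in[OF g(1), of 0] minimizing_geodesic_in[OF g(2), of 0]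
      minimizing_geodesic_in[OF g(2), of 1] g by (auto simp: minimizing_geodesic_def)
  note xM = minimizing_geodesic_between[OF g(2) x]
  obtain u where u: "0 \<le> u" "u \<le> 1" "x' = (1 - u) *\<^sub>R q' + u *\<^sub>R r'"
    using x'(1) by (auto simp: closed_segment_def)
  have "q' - x' = u *\<^sub>R (q' - r')" by (simp add: u(3) algebra_simps)
  then have qx: "d q x = u * ?L" using x'(2) D(2) u(1) by (simp add: dist_norm)
  then have xr: "d x r = (1 - u) * ?L" using xM(2) by (simp add: algebra_simps)
  define X where "X = (dist p' x')\<^sup>2"
  have X: "X = (1 - u) * (d p q)\<^sup>2 + u * (d p r)\<^sup>2 - u * (1 - u) * ?L\<^sup>2"
    using dist_segment_point[OF u(3), of p'] D by (simp add: X_def dist_commute commute)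
  have le: "X \<le> (1 + \<epsilon>) * (d p x)\<^sup>2" if \<epsilon>: "0 < \<epsilon>" for \<epsilon>
  proof -
    \<comment> \<open>The terms without \<epsilon> cancel, because
      \<open>(1 - u) * u\<^sup>2 + u * (1 - u)\<^sup>2 = u * (1 - u)\<close>; this leaves a multiple
      of \<epsilon> on both sides.\<close>
    have "\<epsilon> * (1 - u) * (d p q)\<^sup>2 + \<epsilon> * u * (d p r)\<^sup>2 + (1 - u) * u * ?L\<^sup>2
        \<le> (\<epsilon> + (1 - u) + u) * (\<epsilon> * (d x p)\<^sup>2 + (1 - u) * (d x q)\<^sup>2 + u * (d x r)\<^sup>2)"
      using u \<epsilon> by (intro four_point_inequalityD[OF four xM(1) M]) auto
    also have "(1 - u) * (d x q)\<^sup>2 = (1 - u) * u\<^sup>2 * ?L\<^sup>2"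
      using qx commute[of x q] by (simp add: power_mult_distrib)
    also have "u * (d x r)\<^sup>2 = u * (1 - u)\<^sup>2 * ?L\<^sup>2"
      using xr by (simp add: power_mult_distrib)
    finally have "\<epsilon> * X \<le> \<epsilon> * ((1 + \<epsilon>) * (d p x)\<^sup>2)"
      unfolding X commute[of x p] by (simp add: algebra_simps power2_eq_square)
    then show ?thesis using \<epsilon> by simp
  qed
  have "X \<le> (d p x)\<^sup>2"
  proof (rule field_le_epsilon)
    fix e :: real assume e: "0 < e"
    define \<epsilon> where "\<epsilon> = e / ((d p x)\<^sup>2 + 1)"
    have pos: "0 < (d p x)\<^sup>2 + 1" using zero_le_power2[of "d p x"] by linarith
    then have "0 < \<epsilon>" using e by (simp add: \<epsilon>_def)
    then have "\<epsilon> * (d p x)\<^sup>2 \<le> \<epsilon> * ((d p x)\<^sup>2 + 1)" by simp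
    also have "\<dots> = e" using pos by (simp add: \<epsilon>_def)
    finally show "X \<le> (d p x)\<^sup>2 + e" using le[OF \<open>0 < \<epsilon>\<close>] by (simp add: distrib_right)
  qed
  then show "dist p' x' \<le> d p x" unfolding X_def by (rule power2_le_imp_le) simp
qed

lemma four_point_alexandrov:
  assumes "mcomplete" "geodesic_space M d" four_point_inequality
  shows "alexandrov_nonneg M d"
  unfolding alexandrov_nonneg_def
  using assms four_point_triangle_comparison[OF assms(3)]
  by (intro conjI exI[of _ "{M}"]) (auto simp: openin_mtopology mball_subset_mspace intro: exI[of _ "1::real"])

end

section \<open>Diagrams as families of points\<close>

text \<open>All infinite sets are identified, which is harmless for the fibres of families over a
  countable index type.\<close>

definition ecard :: "'i set \<Rightarrow> enat" where
  "ecard K = (if finite K then enat (card K) else \<infinity>)"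

lemma ecard_eqpoll: "K \<approx> K' \<Longrightarrow> ecard K = ecard K'"
  using eqpoll_finite_iff eqpoll_iff_card by (fastforce simp: ecard_def)

lemma ecard_initial: "ecard {k::nat. enat k < n} = n"
  by (cases n) (auto simp: ecard_def lessThan_def[symmetric])

lemma eqpoll_ecard:
  assumes "countable K"
  shows "K \<approx> {k::nat. enat k < ecard K}"
proof (cases "finite K")
  case True
  then show ?thesis by (simp add: ecard_def lessThan_def[symmetric] eqpoll_iff_card)
next
  case False
  then obtain h :: "'a \<Rightarrow> nat" where "bij_betw h K UNIV"
    using assms countableE_infinite by blast
  then show ?thesis using False by (auto simp: ecard_def eqpoll_def)
qed

lemma ecard_eq_iff: "countable K \<Longrightarrow> countable K' \<Longrightarrow> ecard K = ecard K' \<longleftrightarrow> K \<approx> K'"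
  by (metis ecard_eqpoll eqpoll_ecard eqpoll_sym eqpoll_trans)

definition mset_of :: "('i \<Rightarrow> 'a) \<Rightarrow> 'a \<Rightarrow> enat" where
  "mset_of u x = ecard {i. u i = x}"

lemma enumerates_mset_of: "enumerates UNIV u (mset_of u)" for u :: "'i::countable \<Rightarrow> 'a"
  unfolding enumerates_def mset_of_def by (auto intro: eqpoll_ecard)

lemma enumerates_unique: "enumerates UNIV u s \<Longrightarrow> s = mset_of u"
proof (rule ext)
  fix x assume "enumerates UNIV u s"
  then have "{i. u i = x} \<approx> {k::nat. enat k < s x}" by (simp add: enumerates_def)
  from ecard_eqpoll[OF this] show "s x = mset_of u x" by (simp add: mset_of_def ecard_initial)
qed

lemma mset_of_cmsets: "range u \<subseteq> M \<Longrightarrow> mset_of u \<in> cmsets M" for u :: "'i::countable \<Rightarrow> 'a"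
proof -
  have "mset_of u x = 0" if "x \<notin> range u" for x
  proof -
    have "{i. u i = x} = {}" using that by auto
    then show ?thesis by (simp add: mset_of_def ecard_def zero_enat_def)
  qed
  then have "{x. mset_of u x \<noteq> 0} \<subseteq> range u" by blast
  then show "range u \<subseteq> M \<Longrightarrow> mset_of u \<in> cmsets M"
    unfolding cmsets_def using countable_subset by fastforce
qed

lemma countable_copies: "s \<in> cmsets M \<Longrightarrow> countable (copies s)"
proof -
  assume "s \<in> cmsets M"
  then have "countable ({x. s x \<noteq> 0} \<times> (UNIV :: nat set))" by (auto simp: cmsets_def)
  then show "countable (copies s)" by (rule countable_subset[rotated]) (auto simp: copies_def)
qed

context metric_pair
begin

definition base :: 'a where "base = (SOME a. a \<in> A)"

lemma base_in [simp]: "base \<in> A" "base \<in> M"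
proof -
  show "base \<in> A" using nonempty_A unfolding base_def by (simp add: some_in_eq)
  then show "base \<in> M" using A_subset by blast
qed

text \<open>Adding infinitely many copies of one point of \<open>A\<close> leaves the diagram
  unchanged and makes every multiset infinite, so that all can be enumerated by
  \<open>nat\<close>.\<close>

definition base_mset :: "'a \<Rightarrow> enat" where "base_mset x = (if x = base then \<infinity> else 0)"

lemma base_mset_cmsets: "base_mset \<in> cmsets A"
proof -
  have "{x. base_mset x \<noteq> 0} = {base}" by (auto simp: base_mset_def)
  then show ?thesis by (simp add: cmsets_def)
qed

text \<open>Multiplicities may be infinite, so nothing is subtracted: for the converse each multiset
  receives the other's part in \<open>A\<close>.\<close>

lemma diag_rel_iff:
  "(s, t) \<in> diag_rel M A \<longleftrightarrow> s \<in> cmsets M \<and> t \<in> cmsets M \<and> (\<forall>x. x \<notin> A \<longrightarrow> s x = t x)"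
proof
  assume "(s, t) \<in> diag_rel M A"
  then obtain a b where *: "s \<in> cmsets M" "t \<in> cmsets M" "a \<in> cmsets A" "b \<in> cmsets A" "s + a = t + b"
    by (auto simp: diag_rel_def)
  have "s x = t x" if "x \<notin> A" for x
  proof -
    have "a x = 0" "b x = 0" using * that by (auto simp: cmsets_def)
    then show ?thesis using fun_cong[OF *(5), of x] by simp
  qed
  then show "s \<in> cmsets M \<and> t \<in> cmsets M \<and> (\<forall>x. x \<notin> A \<longrightarrow> s x = t x)" using * by blast
next
  assume *: "s \<in> cmsets M \<and> t \<in> cmsets M \<and> (\<forall>x. x \<notin> A \<longrightarrow> s x = t x)"
  let ?a = "\<lambda>x. if x \<in> A then t x else 0" and ?b = "\<lambda>x. if x \<in> A then s x else 0"
  have "?a \<in> cmsets A" "?b \<in> cmsets A"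
    using * unfolding cmsets_def by (auto elim: countable_subset[rotated] split: if_splits)
  moreover have "s + ?a = t + ?b" using * by (auto simp: fun_eq_iff add.commute)
  ultimately show "(s, t) \<in> diag_rel M A" using * unfolding diag_rel_def by blast
qed

text \<open>The index type stays free: gluing uses \<open>nat \<times> nat\<close>, optimal
  couplings use \<open>nat + nat\<close>.\<close>

definition dgm :: "('i::countable \<Rightarrow> 'a) \<Rightarrow> ('a \<Rightarrow> enat) set" where
  "dgm u = diag_rel M A `` {mset_of u}"

lemma dgm_diagrams: "range u \<subseteq> M \<Longrightarrow> dgm u \<in> diagrams M A"
  by (simp add: dgm_def diagrams_def mset_of_cmsets quotientI)

lemma mset_of_in_dgm: "range u \<subseteq> M \<Longrightarrow> mset_of u \<in> dgm u"
  by (simp add: dgm_def diag_rel_iff mset_of_cmsets)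

lemma dgm_eq_iff:
  fixes u :: "'i::countable \<Rightarrow> 'a" and v :: "'j::countable \<Rightarrow> 'a"
  assumes "range u \<subseteq> M" "range v \<subseteq> M"
  shows "dgm u = dgm v \<longleftrightarrow> (\<forall>x. x \<notin> A \<longrightarrow> {i. u i = x} \<approx> {j. v j = x})"
proof -
  have "dgm u = dgm v \<longleftrightarrow> (mset_of u, mset_of v) \<in> diag_rel M A"
    unfolding dgm_def using mset_of_cmsets[OF assms(1)] mset_of_cmsets[OF assms(2)] equiv_diag_rel
    by (intro eq_equiv_class_iff)
  then show ?thesis
    using assms by (simp add: diag_rel_iff mset_of_cmsets mset_of_def ecard_eq_iff)
qed

text \<open>Only fibres over points off \<open>A\<close> are compared, so \<open>K\<close> and
  \<open>L\<close> may contain indices of points in \<open>A\<close> as long as they contain all the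
  others.\<close>

lemma dgm_eqI:
  fixes u :: "'i::countable \<Rightarrow> 'a" and v :: "'j::countable \<Rightarrow> 'a"
  assumes M: "range u \<subseteq> M" "range v \<subseteq> M" and h: "bij_betw h K L"
    and eq: "\<And>i. i \<in> K \<Longrightarrow> v (h i) = u i"
    and out: "\<And>i. i \<notin> K \<Longrightarrow> u i \<in> A" "\<And>j. j \<notin> L \<Longrightarrow> v j \<in> A"
  shows "dgm u = dgm v"
  unfolding dgm_eq_iff[OF M]
proof (intro allI impI)
  fix x assume x: "x \<notin> A"
  have "{i. u i = x} \<subseteq> K" using x out(1) by blast
  then have "inj_on h {i. u i = x}" using h inj_on_subset by (auto simp: bij_betw_def)
  moreover have "h ` {i. u i = x} = {j. v j = x}"
  proof
    show "h ` {i. u i = x} \<subseteq> {j. v j = x}" using eq out(1) x by fastforce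
    show "{j. v j = x} \<subseteq> h ` {i. u i = x}"
    proof
      fix j assume j: "j \<in> {j. v j = x}"
      then have "j \<in> L" using out(2) x by auto
      then obtain i where "i \<in> K" "j = h i" using h by (auto simp: bij_betw_def)
      then show "j \<in> h ` {i. u i = x}" using eq[of i] j by auto
    qed
  qed
  ultimately show "{i. u i = x} \<approx> {j. v j = x}" unfolding eqpoll_def bij_betw_def by blast
qed

lemma dgm_eq_off:
  assumes "range u \<subseteq> M" "range v \<subseteq> M" "\<And>i. u i \<noteq> v i \<Longrightarrow> u i \<in> A \<and> v i \<in> A"
  shows "dgm u = dgm v"
  by (rule dgm_eqI[OF assms(1,2), of id "{i. u i = v i}"]) (use assms(3) in auto)

text \<open>Bijections between the fibres over points off \<open>A\<close> fit together because
  distinct fibres are disjoint.\<close>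

lemma dgm_eqE:
  fixes u :: "'i::countable \<Rightarrow> 'a" and v :: "'j::countable \<Rightarrow> 'a"
  assumes M: "range u \<subseteq> M" "range v \<subseteq> M" and eq: "dgm u = dgm v"
  obtains h where "bij_betw h {i. u i \<notin> A} {j. v j \<notin> A}" "\<And>i. u i \<notin> A \<Longrightarrow> v (h i) = u i"
proof -
  have "\<forall>x. \<exists>g. x \<notin> A \<longrightarrow> bij_betw g {i. u i = x} {j. v j = x}"
    using eq unfolding dgm_eq_iff[OF M] eqpoll_def by blast
  then obtain g where g: "\<And>x. x \<notin> A \<Longrightarrow> bij_betw (g x) {i. u i = x} {j. v j = x}" by metis
  let ?h = "\<lambda>i. g (u i) i"
  have vh: "v (?h i) = u i" if "u i \<notin> A" for i using bij_betwE[OF g[OF that]] by auto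
  have "inj_on ?h {i. u i \<notin> A}"
  proof (rule inj_onI)
    fix i j assume ij: "i \<in> {i. u i \<notin> A}" "j \<in> {i. u i \<notin> A}" "?h i = ?h j"
    then have "u i = u j" using vh[of i] vh[of j] by auto
    then show "i = j" using ij g[of "u i"] by (auto simp: bij_betw_def inj_on_def)
  qed
  moreover have "?h ` {i. u i \<notin> A} = {j. v j \<notin> A}"
  proof
    show "?h ` {i. u i \<notin> A} \<subseteq> {j. v j \<notin> A}" using vh by auto
    show "{j. v j \<notin> A} \<subseteq> ?h ` {i. u i \<notin> A}"
    proof
      fix j assume j: "j \<in> {j. v j \<notin> A}"
      then have "j \<in> g (v j) ` {i. u i = v j}" using g[of "v j"] by (auto simp: bij_betw_def)
      then obtain i where "u i = v j" "j = g (v j) i" by auto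
      then show "j \<in> ?h ` {i. u i \<notin> A}" using j by (intro image_eqI[of _ _ i]) auto
    qed
  qed
  ultimately show ?thesis using that[of ?h] vh by (auto simp: bij_betw_def)
qed

lemma enumerates_nat:
  assumes s: "s \<in> cmsets M" and inf: "s base = \<infinity>"
  obtains h :: "nat \<Rightarrow> 'a \<times> nat" where "bij_betw h UNIV (copies s)"
proof -
  have "(\<lambda>n. (base, n)) ` UNIV \<subseteq> copies s" using inf by (auto simp: copies_def)
  moreover have "infinite ((\<lambda>n::nat. (base, n)) ` UNIV)" by (simp add: finite_image_iff inj_on_def)
  ultimately have "infinite (copies s)" using finite_subset by blast
  then obtain e :: "'a \<times> nat \<Rightarrow> nat" where "bij_betw e (copies s) UNIV"
    using countableE_infinite countable_copies[OF s] by blast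
  then show ?thesis using that bij_betw_inv_into by blast
qed

lemma dgm_of_enumeration:
  fixes u :: "'i::countable \<Rightarrow> 'a"
  assumes S: "S \<in> diagrams M A" "s \<in> S" and a: "a \<in> cmsets A" and u: "enumerates UNIV u (s + a)"
  shows "range u \<subseteq> M" "dgm u = S"
proof -
  obtain s' where s': "s' \<in> cmsets M" "S = diag_rel M A `` {s'}"
    using S(1) by (auto simp: diagrams_def elim: quotientE)
  have sM: "s \<in> cmsets M" using S(2) s' by (auto simp: diag_rel_iff)
  have sa: "s + a = mset_of u" using u by (rule enumerates_unique)
  have inM: "s + a \<in> cmsets M" using sM a cmsets_mono[OF A_subset] cmsets_plus by blast
  show "range u \<subseteq> M"
  proof
    fix x assume "x \<in> range u"
    then obtain i where i: "x = u i" by auto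
    have "mset_of u x \<noteq> 0" by (auto simp: i mset_of_def ecard_def zero_enat_def card_gt_0_iff)
    then show "x \<in> M" using inM unfolding sa by (auto simp: cmsets_def)
  qed
  have a0: "a x = 0" if "x \<notin> A" for x using a that by (auto simp: cmsets_def)
  have "(s', s + a) \<in> diag_rel M A"
    using S(2) s' inM a0 by (auto simp: diag_rel_iff)
  then show "dgm u = S" unfolding dgm_def s' sa[symmetric]
    using equiv_class_eq[OF equiv_diag_rel] by metis
qed

lemma ex_dgm:
  assumes "S \<in> diagrams M A"
  obtains u :: "nat \<Rightarrow> 'a" where "range u \<subseteq> M" "dgm u = S"
proof -
  obtain s where s: "s \<in> cmsets M" "S = diag_rel M A `` {s}"
    using assms by (auto simp: diagrams_def elim: quotientE)
  then have sS: "s \<in> S" by (simp add: diag_rel_iff)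
  have "s + base_mset \<in> cmsets M" "(s + base_mset) base = \<infinity>"
    using s base_mset_cmsets cmsets_mono[OF A_subset] cmsets_plus by (blast, simp add: base_mset_def)
  then obtain h :: "nat \<Rightarrow> 'a \<times> nat" where "bij_betw h UNIV (copies (s + base_mset))" by (rule enumerates_nat)
  then have "enumerates UNIV (\<lambda>i. fst (h i)) (s + base_mset)" unfolding enumerates_iff by auto
  from dgm_of_enumeration[OF assms sS base_mset_cmsets this] show ?thesis by (rule that)
qed

text \<open>The bound \<open>e\<close> is for the p-th power of the distance. Finite partial sums
  cover infinite families and pass to pointwise limits.\<close>

definition coupled :: "real \<Rightarrow> ('i \<Rightarrow> 'a) \<Rightarrow> ('i \<Rightarrow> 'a) \<Rightarrow> real \<Rightarrow> bool" where
  "coupled p u v e \<longleftrightarrow> (\<forall>F. finite F \<longrightarrow> (\<Sum>i\<in>F. d (u i) (v i) powr p) \<le> e)"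

lemma coupled_mono: "coupled p u v e \<Longrightarrow> e \<le> e' \<Longrightarrow> coupled p u v e'"
  unfolding coupled_def by force

lemma coupled_reindex:
  fixes u v :: "'i \<Rightarrow> 'a" and u' v' :: "'k \<Rightarrow> 'a"
  assumes c: "coupled p u v e" and inj: "inj_on h K"
    and eq: "\<And>i. i \<in> K \<Longrightarrow> d (u' i) (v' i) = d (u (h i)) (v (h i))" "\<And>i. i \<notin> K \<Longrightarrow> d (u' i) (v' i) = 0"
  shows "coupled p u' v' e"
  unfolding coupled_def
proof (intro allI impI)
  fix F :: "'k set" assume F: "finite F"
  have "(\<Sum>i\<in>F. d (u' i) (v' i) powr p) = (\<Sum>i\<in>F \<inter> K. d (u' i) (v' i) powr p)"
    using F eq(2) by (intro sum.mono_neutral_right) auto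
  also have "\<dots> = (\<Sum>i\<in>F \<inter> K. d (u (h i)) (v (h i)) powr p)" using eq(1) by (intro sum.cong) auto
  also have "\<dots> = (\<Sum>i\<in>h ` (F \<inter> K). d (u i) (v i) powr p)"
    using inj by (subst sum.reindex) (auto simp: inj_on_def)
  also have "\<dots> \<le> e" using c F by (auto simp: coupled_def)
  finally show "(\<Sum>i\<in>F. d (u' i) (v' i) powr p) \<le> e" .
qed

lemma edist_dgm_le:
  fixes u v :: "'i::countable \<Rightarrow> 'a"
  assumes p: "1 \<le> p" and M: "range u \<subseteq> M" "range v \<subseteq> M" and c: "0 \<le> c" "coupled p u v (c powr p)"
  shows "diag_edist p d A (dgm u) (dgm v) \<le> ennreal c"
proof -
  have "mset_dist p d (mset_of u) (mset_of v) \<le> ennreal c"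
    using c by (intro mset_dist_leI[OF p c(1) enumerates_mset_of enumerates_mset_of]) (auto simp: coupled_def)
  then have "rep_dist p d A (mset_of u) (mset_of v) \<le> ennreal c"
    using cmsets_zero by (intro rep_dist_leI[of 0 0]) auto
  then show ?thesis
    using diag_edist_eq[OF p dgm_diagrams[OF M(1)] dgm_diagrams[OF M(2)] mset_of_in_dgm[OF M(1)] mset_of_in_dgm[OF M(2)]]
    by simp
qed

text \<open>Adding \<open>base_mset\<close> on both sides does not increase the distance, so both
  multisets may be taken infinite and enumerated by \<open>nat\<close> along one bijection.\<close>

lemma edist_lessE:
  assumes p: "1 \<le> p" and ST: "S \<in> diagrams M A" "T \<in> diagrams M A" and c: "0 \<le> c"
    and less: "diag_edist p d A S T < ennreal c"
  obtains u v :: "nat \<Rightarrow> 'a" where "range u \<subseteq> M" "range v \<subseteq> M" "dgm u = S" "dgm v = T" "coupled p u v (c powr p)"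
proof -
  obtain u\<^sub>0 v\<^sub>0 :: "nat \<Rightarrow> 'a" where "range u\<^sub>0 \<subseteq> M" "dgm u\<^sub>0 = S" "range v\<^sub>0 \<subseteq> M" "dgm v\<^sub>0 = T"
    using ex_dgm ST by metis
  then obtain s t where st: "s \<in> S" "t \<in> T" using mset_of_in_dgm by blast
  have "rep_dist p d A s t < ennreal c" using less diag_edist_eq[OF p ST st] by simp
  then obtain a b where ab: "a \<in> cmsets A" "b \<in> cmsets A" "mset_dist p d (s + a) (t + b) < ennreal c"
    by (rule rep_dist_lessE)
  let ?a = "a + base_mset" and ?b = "b + base_mset"
  have inM: "r \<in> cmsets M" if "r \<in> cmsets A" for r using cmsets_mono[OF A_subset that] .
  have A: "?a \<in> cmsets A" "?b \<in> cmsets A" using ab base_mset_cmsets cmsets_plus by blast+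
  have "mset_dist p d (s + a + base_mset) (t + b + base_mset) \<le> mset_dist p d (s + a) (t + b)"
    using base_mset_cmsets by (intro mset_dist_plus_le[OF p] inM)
  then have "mset_dist p d (s + ?a) (t + ?b) < ennreal c" using ab by (simp add: add.assoc)
  then obtain \<phi> where \<phi>: "bij_betw \<phi> (copies (s + ?a)) (copies (t + ?b))"
    "\<And>F. finite F \<Longrightarrow> F \<subseteq> copies (s + ?a) \<Longrightarrow> (\<Sum>e\<in>F. d (fst e) (fst (\<phi> e)) powr p) \<le> c powr p"
    using mset_dist_lessE[OF p c] by blast
  have "s \<in> cmsets M" using st(1) ST(1) by (auto simp: diagrams_def diag_rel_iff elim!: quotientE)
  then have "s + ?a \<in> cmsets M" "(s + ?a) base = \<infinity>"
    using inM[OF A(1)] cmsets_plus by (blast, simp add: base_mset_def)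
  then obtain h :: "nat \<Rightarrow> 'a \<times> nat" where h: "bij_betw h UNIV (copies (s + ?a))" by (rule enumerates_nat)
  have "enumerates UNIV (\<lambda>i. fst (h i)) (s + ?a)" using h unfolding enumerates_iff by auto
  note u = dgm_of_enumeration[OF ST(1) st(1) A(1) this]
  have "enumerates UNIV (\<lambda>i. fst (\<phi> (h i))) (t + ?b)"
    using bij_betw_trans[OF h \<phi>(1)] unfolding enumerates_iff by (intro exI[of _ "\<phi> \<circ> h"]) auto
  note v = dgm_of_enumeration[OF ST(2) st(2) A(2) this]
  have "coupled p (\<lambda>i. fst (h i)) (\<lambda>i. fst (\<phi> (h i))) (c powr p)"
    unfolding coupled_def
  proof (intro allI impI)
    fix F :: "nat set" assume F: "finite F"
    have "(\<Sum>i\<in>F. d (fst (h i)) (fst (\<phi> (h i))) powr p) = (\<Sum>e\<in>h ` F. d (fst e) (fst (\<phi> e)) powr p)"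
      using h by (subst sum.reindex) (auto simp: bij_betw_def inj_on_def)
    also have "\<dots> \<le> c powr p" using F h by (intro \<phi>(2)) (auto simp: bij_betw_def)
    finally show "(\<Sum>i\<in>F. d (fst (h i)) (fst (\<phi> (h i))) powr p) \<le> c powr p" .
  qed
  then show ?thesis using that u v by blast
qed

text \<open>A coupling of \<open>dgm v\<close> and \<open>dgm w\<close> can be transported to any other family \<open>v\<close> representing
  the first diagram, provided \<open>v\<close> has an infinite supply of indices, \<open>range f\<close>, whose points in
  \<open>A\<close> may be moved within \<open>A\<close>.\<close>

lemma glue:
  fixes v :: "'i::countable \<Rightarrow> 'a" and f :: "nat \<Rightarrow> 'i" and v' w :: "nat \<Rightarrow> 'a"
  assumes M: "range v \<subseteq> M" "range v' \<subseteq> M" "range w \<subseteq> M" and f: "inj f" "\<And>j. v (f j) \<in> A"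
    and eq: "dgm v = dgm v'" and c: "coupled p v' w e"
  obtains v\<^sub>2 w\<^sub>2 where "range v\<^sub>2 \<subseteq> M" "range w\<^sub>2 \<subseteq> M" "\<And>i. i \<notin> range f \<Longrightarrow> v\<^sub>2 i = v i" "\<And>j. v\<^sub>2 (f j) \<in> A"
    "dgm w\<^sub>2 = dgm w" "coupled p v\<^sub>2 w\<^sub>2 e" "\<And>i. i \<notin> range f \<Longrightarrow> v i \<in> A \<Longrightarrow> w\<^sub>2 i = v i"
proof -
  obtain h where h: "bij_betw h {i. v i \<notin> A} {j. v' j \<notin> A}" "\<And>i. v i \<notin> A \<Longrightarrow> v' (h i) = v i"
    using dgm_eqE[OF M(1,2) eq] by blast
  define m where "m i = (if v i \<notin> A then h i else inv f i)" for i
  define K where "K = {i. v i \<notin> A} \<union> f ` {j. v' j \<in> A}"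
  define v\<^sub>2 where "v\<^sub>2 i = (if i \<in> K then v' (m i) else if i \<in> range f then base else v i)" for i
  define w\<^sub>2 where "w\<^sub>2 i = (if i \<in> K then w (m i) else if i \<in> range f then base else v i)" for i
  have mf: "m (f j) = j" for j using f by (simp add: m_def inv_f_f)
  have "bij_betw m {i. v i \<notin> A} {j. v' j \<notin> A}"
    using h(1) by (rule bij_betw_cong[THEN iffD1, rotated]) (simp add: m_def)
  moreover have "bij_betw m (f ` {j. v' j \<in> A}) {j. v' j \<in> A}"
    unfolding bij_betw_def by (auto simp: inj_on_def mf image_image)
  ultimately have "bij_betw m K ({j. v' j \<notin> A} \<union> {j. v' j \<in> A})"
    unfolding K_def by (rule bij_betw_combine) auto
  then have m: "bij_betw m K UNIV" by (simp add: Un_commute Collect_disj_eq[symmetric])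
  have AM: "x \<in> M" if "x \<in> A" for x using A_subset that by auto
  show ?thesis
  proof
    show "range v\<^sub>2 \<subseteq> M" "range w\<^sub>2 \<subseteq> M" using M by (auto simp: v\<^sub>2_def w\<^sub>2_def)
    show "v\<^sub>2 i = v i" if "i \<notin> range f" for i
      using that h(2) by (auto simp: v\<^sub>2_def K_def m_def)
    show "v\<^sub>2 (f j) \<in> A" for j using f(2) by (auto simp: v\<^sub>2_def K_def mf inj_eq[OF f(1)])
    show "w\<^sub>2 i = v i" if "i \<notin> range f" "v i \<in> A" for i using that by (auto simp: w\<^sub>2_def K_def)
    show "dgm w\<^sub>2 = dgm w"
      by (rule dgm_eqI[OF \<open>range w\<^sub>2 \<subseteq> M\<close> M(3) m]) (auto simp: w\<^sub>2_def K_def)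
    show "coupled p v\<^sub>2 w\<^sub>2 e"
    proof (rule coupled_reindex[OF c, of m K])
      show "inj_on m K" using m by (simp add: bij_betw_def)
      show "d (v\<^sub>2 i) (w\<^sub>2 i) = d (v' (m i)) (w (m i))" if "i \<in> K" for i
        using that by (simp add: v\<^sub>2_def w\<^sub>2_def)
      show "d (v\<^sub>2 i) (w\<^sub>2 i) = 0" if "i \<notin> K" for i
        using that subsetD[OF M(1), of "v i"] by (auto simp: v\<^sub>2_def w\<^sub>2_def)
    qed
  qed
qed

end

context Metric_space
begin

lemma limitin_dist_tendsto:
  assumes "limitin mtopology f l sequentially" and "\<And>n. f n \<in> M" "z \<in> M"
  shows "(\<lambda>n. d z (f n)) \<longlonglongrightarrow> d z l"
proof (rule LIMSEQ_I)
  fix r :: real assume "0 < r"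
  then obtain N where N: "\<And>n. N \<le> n \<Longrightarrow> d (f n) l < r" and l: "l \<in> M"
    using assms(1) unfolding limit_metric_sequentially by blast
  have "norm (d z (f n) - d z l) < r" if "N \<le> n" for n
    using N[OF that] triangle[of z l "f n"] triangle[of z "f n" l] l assms(2)[of n] assms(3) commute[of "f n" l]
    by (simp add: abs_less_iff)
  then show "\<exists>N. \<forall>n\<ge>N. norm (d z (f n) - d z l) < r" by blast
qed

end

section \<open>Distances of diagrams expressed by couplings\<close>

context metric_pair
begin

lemma edist_commute: "1 \<le> p \<Longrightarrow> diag_edist p d A S T = diag_edist p d A T S"
  unfolding diag_edist_def by (subst INF_commute) (simp add: rep_dist_commute)

lemma edist_triangle:
  assumes p: "1 \<le> p" and STR: "S \<in> diagrams M A" "T \<in> diagrams M A" "R \<in> diagrams M A"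
  shows "diag_edist p d A S R \<le> diag_edist p d A S T + diag_edist p d A T R"
proof -
  obtain u v w :: "nat \<Rightarrow> 'a" where *: "range u \<subseteq> M" "dgm u = S" "range v \<subseteq> M" "dgm v = T" "range w \<subseteq> M" "dgm w = R"
    using ex_dgm STR by metis
  then have mem: "mset_of u \<in> S" "mset_of v \<in> T" "mset_of w \<in> R" using mset_of_in_dgm by blast+
  then show ?thesis
    using rep_dist_triangle[OF p mset_of_cmsets[OF *(1)] mset_of_cmsets[OF *(3)] mset_of_cmsets[OF *(5)]]
      diag_edist_eq[OF p STR(1,2) mem(1,2)] diag_edist_eq[OF p STR(2,3) mem(2,3)] diag_edist_eq[OF p STR(1,3) mem(1,3)]
    by simp
qed

lemma empty_diagram_diagrams: "empty_diagram M A \<in> diagrams M A"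
  by (simp add: empty_diagram_def diagrams_def quotientI cmsets_zero)

lemma empty_diagram_eq:
  assumes "range u \<subseteq> A"
  shows "empty_diagram M A = dgm (u :: 'i::countable \<Rightarrow> 'a)"
proof -
  have "mset_of u x = 0" if "x \<notin> A" for x
  proof -
    have "{i. u i = x} = {}" using that assms by auto
    then show ?thesis by (simp add: mset_of_def ecard_def zero_enat_def)
  qed
  then have "(0, mset_of u) \<in> diag_rel M A"
    using mset_of_cmsets[of u M] assms A_subset cmsets_zero by (auto simp: diag_rel_iff)
  then show ?thesis unfolding empty_diagram_def dgm_def by (rule equiv_class_eq[OF equiv_diag_rel])
qed

lemma dgm_empty_in:
  assumes "range u \<subseteq> M" "dgm (u :: 'i::countable \<Rightarrow> 'a) = empty_diagram M A"
  shows "u i \<in> A"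
proof (rule ccontr)
  assume i: "u i \<notin> A"
  have "dgm u = dgm (\<lambda>n::nat. base)" using assms(2) empty_diagram_eq[of "\<lambda>n::nat. base"] by auto
  then have "{j. u j = u i} \<approx> {n::nat. base = u i}"
    using dgm_eq_iff[OF assms(1), of "\<lambda>n::nat. base"] i by auto
  moreover have "{n::nat. base = u i} = {}" using i base_in(1) by (metis (mono_tags, lifting) Collect_empty_eq)
  ultimately show False by (auto simp: eqpoll_def bij_betw_def)
qed

lemma pdiagrams_diagrams: "S \<in> pdiagrams p M d A \<Longrightarrow> S \<in> diagrams M A"
  by (simp add: pdiagrams_def)

lemma pdiagramsI:
  assumes p: "1 \<le> p" and S: "S \<in> pdiagrams p M d A" and T: "T \<in> diagrams M A"
    and fin: "diag_edist p d A S T < \<infinity>"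
  shows "T \<in> pdiagrams p M d A"
proof -
  have "diag_edist p d A T (empty_diagram M A)
      \<le> diag_edist p d A T S + diag_edist p d A S (empty_diagram M A)"
    using S by (intro edist_triangle[OF p T _ empty_diagram_diagrams]) (rule pdiagrams_diagrams)
  also have "\<dots> < \<infinity>"
    using S fin edist_commute[OF p, of T S] by (simp add: pdiagrams_def ennreal_add_less_top)
  finally show ?thesis using T by (simp add: pdiagrams_def)
qed

lemma edist_pdist:
  assumes p: "1 \<le> p" and ST: "S \<in> pdiagrams p M d A" "T \<in> pdiagrams p M d A"
  shows "diag_edist p d A S T = ennreal (pdist p d A S T)"
proof -
  have "diag_edist p d A S T \<le> diag_edist p d A S (empty_diagram M A) + diag_edist p d A (empty_diagram M A) T"
    using ST by (intro edist_triangle[OF p _ empty_diagram_diagrams]) (auto simp: pdiagrams_def)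
  also have "\<dots> < \<infinity>"
    using ST edist_commute[OF p, of "empty_diagram M A" T] by (simp add: pdiagrams_def ennreal_add_less_top)
  finally show ?thesis by (simp add: pdist_def)
qed

lemma pdist_dgm_le:
  fixes u v :: "'i::countable \<Rightarrow> 'a"
  assumes p: "1 \<le> p" and M: "range u \<subseteq> M" "range v \<subseteq> M" and c: "0 \<le> c" "coupled p u v (c powr p)"
  shows "pdist p d A (dgm u) (dgm v) \<le> c"
  unfolding pdist_def using enn2real_mono[OF edist_dgm_le[OF p M c]] c(1) by simp

lemma pdiagrams_dgmI:
  fixes u v :: "'i::countable \<Rightarrow> 'a"
  assumes p: "1 \<le> p" and M: "range u \<subseteq> M" "range v \<subseteq> M" and c: "0 \<le> c" "coupled p u v (c powr p)"
    and u: "dgm u \<in> pdiagrams p M d A"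
  shows "dgm v \<in> pdiagrams p M d A"
  using edist_dgm_le[OF p M c] by (intro pdiagramsI[OF p u dgm_diagrams[OF M(2)]]) (auto intro: le_less_trans)

lemma pdist_lessE:
  assumes p: "1 \<le> p" and ST: "S \<in> pdiagrams p M d A" "T \<in> pdiagrams p M d A" and less: "pdist p d A S T < c"
  obtains u v :: "nat \<Rightarrow> 'a" where "range u \<subseteq> M" "range v \<subseteq> M" "dgm u = S" "dgm v = T" "coupled p u v (c powr p)"
proof -
  have c: "0 < c" using less by (simp add: pdist_def) (meson enn2real_nonneg le_less_trans)
  then have "diag_edist p d A S T < ennreal c"
    using less by (simp add: edist_pdist[OF p ST] ennreal_lessI)
  from edist_lessE[OF p pdiagrams_diagrams[OF ST(1)] pdiagrams_diagrams[OF ST(2)] less_imp_le[OF c] this]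
  show ?thesis using that by blast
qed

lemma coupled_triangle:
  assumes p: "1 \<le> p" and M: "range u \<subseteq> M" "range v \<subseteq> M" "range w \<subseteq> M" and ab: "0 < a" "0 < b"
    and c: "coupled p u v (a powr p)" "coupled p v w (b powr p)"
  shows "coupled p u w ((a + b) powr p)"
  unfolding coupled_def
proof (intro allI impI)
  fix F :: "'b set" assume F: "finite F"
  have "(\<Sum>i\<in>F. d (u i) (w i) powr p) \<le> (\<Sum>i\<in>F. (d (u i) (v i) + d (v i) (w i)) powr p)"
    using M p by (intro sum_mono powr_mono2 triangle) auto
  also have "\<dots> \<le> (a + b) powr p"
    using c F by (intro minkowski_powr[OF p F ab]) (auto simp: coupled_def)
  finally show "(\<Sum>i\<in>F. d (u i) (w i) powr p) \<le> (a + b) powr p" .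
qed

lemma coupled_refl: "range u \<subseteq> M \<Longrightarrow> 0 \<le> e \<Longrightarrow> coupled p u u e"
  unfolding coupled_def by (auto simp: subset_eq intro!: sum_nonpos order_trans[of _ "0::real" e])

lemma coupled_dist_le:
  assumes "coupled p u v (c powr p)" "1 \<le> p" "0 \<le> c"
  shows "d (u i) (v i) \<le> c"
proof -
  have "d (u i) (v i) powr p \<le> c powr p"
    using assms(1)[unfolded coupled_def, rule_format, of "{i}"] by simp
  then show ?thesis
    using powr_less_mono2[of p c "d (u i) (v i)"] assms(2,3) by (auto simp: not_le[symmetric])
qed

section \<open>Completeness\<close>

text \<open>Stage \<open>n\<close> uses the indices in the blocks \<open>{0..n} \<times> UNIV\<close>; the points with index in a later
  block \<open>k\<close> stay in \<open>A\<close> and do not move before stage \<open>k\<close>.\<close>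

lemma chain_lift:
  assumes p: "1 \<le> p" and S: "\<And>n. S n \<in> diagrams M A" and c: "\<And>n. 0 \<le> c n"
    and less: "\<And>n. diag_edist p d A (S n) (S (Suc n)) < ennreal (c n)"
  obtains x :: "nat \<Rightarrow> nat \<times> nat \<Rightarrow> 'a" where "\<And>n. range (x n) \<subseteq> M" "\<And>n. dgm (x n) = S n"
    "\<And>n. coupled p (x n) (x (Suc n)) (c n powr p)"
proof -
  \<comment> \<open>In the pair of stage \<open>n\<close>, \<open>u\<close> represents
    \<open>S n\<close> and \<open>y\<close> is its partner on the side of the previous diagram. By
    \<open>Q\<close>, the next partner differs from \<open>u\<close> only in block
    \<open>Suc n\<close>.\<close>
  define P where "P n = (\<lambda>(y :: nat \<times> nat \<Rightarrow> 'a, u :: nat \<times> nat \<Rightarrow> 'a). range y \<subseteq> M \<and> range u \<subseteq> M \<and> dgm u = S n \<and>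
      (\<forall>k j. n < k \<longrightarrow> u (k, j) \<in> A) \<and> (\<forall>j. 0 < n \<longrightarrow> y (n, j) \<in> A))" for n
  define Q where "Q n = (\<lambda>(y :: nat \<times> nat \<Rightarrow> 'a, u :: nat \<times> nat \<Rightarrow> 'a). \<lambda>(y' :: nat \<times> nat \<Rightarrow> 'a, u' :: nat \<times> nat \<Rightarrow> 'a). (\<forall>k j. k \<noteq> Suc n \<longrightarrow> y' (k, j) = u (k, j)) \<and>
      coupled p y' u' (c n powr p))" for n
  have "\<exists>f. \<forall>n. P n (f n) \<and> Q n (f n) (f (Suc n))"
  proof (rule dependent_nat_choice)
    obtain u\<^sub>0 :: "nat \<Rightarrow> 'a" where u\<^sub>0: "range u\<^sub>0 \<subseteq> M" "dgm u\<^sub>0 = S 0" using ex_dgm[OF S] .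
    let ?u = "\<lambda>(k::nat, j). if k = 0 then u\<^sub>0 j else base"
    have range: "range ?u \<subseteq> M" using range_subsetD[OF u\<^sub>0(1)] by auto
    have "dgm u\<^sub>0 = dgm ?u"
      by (rule dgm_eqI[OF u\<^sub>0(1) range, of "\<lambda>j. (0, j)" UNIV "{0} \<times> UNIV"])
         (auto simp: bij_betw_def inj_on_def split: if_splits)
    then have "P 0 (?u, ?u)" using u\<^sub>0 range by (auto simp: P_def)
    then show "\<exists>x. P 0 x" by blast
  next
    fix x n assume "P n x"
    then obtain y u where x: "x = (y, u)" "range u \<subseteq> M" "dgm u = S n" "\<And>k j. n < k \<Longrightarrow> u (k, j) \<in> A"
      by (cases x) (auto simp: P_def)
    obtain v w :: "nat \<Rightarrow> 'a" where vw: "range v \<subseteq> M" "range w \<subseteq> M" "dgm v = S n" "dgm w = S (Suc n)" "coupled p v w (c n powr p)"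
      using edist_lessE[OF p S S c less] by metis
    have inj: "inj (\<lambda>j. (Suc n, j))" by (simp add: inj_on_def)
    obtain y' u' where y': "range y' \<subseteq> M" "range u' \<subseteq> M" "\<And>i. i \<notin> range (\<lambda>j. (Suc n, j)) \<Longrightarrow> y' i = u i"
      "\<And>j. y' (Suc n, j) \<in> A" "dgm u' = dgm w" "coupled p y' u' (c n powr p)"
      "\<And>i. i \<notin> range (\<lambda>j. (Suc n, j)) \<Longrightarrow> u i \<in> A \<Longrightarrow> u' i = u i"
      using glue[OF x(2) vw(1,2) inj _ _ vw(5)] x(3,4) vw(3) by (metis lessI)
    have "u' (k, j) \<in> A" if "Suc n < k" for k j
    proof -
      have "(k, j) \<notin> range (\<lambda>j. (Suc n, j))" "u (k, j) \<in> A" using that x(4)[of k j] by auto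
      then show ?thesis using y'(7) by metis
    qed
    then have "P (Suc n) (y', u')" using y' vw by (auto simp: P_def)
    moreover have "Q n x (y', u')" using y' x(1) by (auto simp: Q_def)
    ultimately show "\<exists>z. P (Suc n) z \<and> Q n x z" by blast
  qed
  then obtain f where f: "\<And>n. P n (f n)" "\<And>n. Q n (f n) (f (Suc n))" by blast
  define y u where "y n = fst (f n)" and "u n = snd (f n)" for n
  have P: "range (y n) \<subseteq> M" "range (u n) \<subseteq> M" "dgm (u n) = S n" "n < k \<Longrightarrow> u n (k, j) \<in> A" "0 < n \<Longrightarrow> y n (n, j) \<in> A" for n k j
    using f(1)[of n] by (auto simp: P_def y_def u_def split: prod.splits)
  have Q: "k \<noteq> Suc n \<Longrightarrow> y (Suc n) (k, j) = u n (k, j)" "coupled p (y (Suc n)) (u (Suc n)) (c n powr p)" for n k j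
    using f(2)[of n] by (auto simp: Q_def y_def u_def split: prod.splits)
  \<comment> \<open>Before stage \<open>k\<close>, block \<open>k\<close> already has the position
    given by \<open>y k\<close>, from which it first moves; until then it contributes distance
    0.\<close>
  define x where "x n = (\<lambda>(k, j). if k \<le> n then u n (k, j) else y k (k, j))" for n
  have M: "range (x n) \<subseteq> M" for n using P(1,2) by (fastforce simp: x_def)
  show ?thesis
  proof
    show "range (x n) \<subseteq> M" for n by (rule M)
    show "dgm (x n) = S n" for n
    proof -
      have "dgm (x n) = dgm (u n)"
        by (rule dgm_eq_off[OF M P(2)]) (use P(4,5) in \<open>auto simp: x_def split: prod.splits if_splits\<close>)
      then show ?thesis using P(3) by simp
    qed
    show "coupled p (x n) (x (Suc n)) (c n powr p)" for n
    proof (rule coupled_reindex[OF Q(2), of id "{(k, j). k \<le> Suc n}"])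
      fix i :: "nat \<times> nat"
      obtain k j where i: "i = (k, j)" by fastforce
      show "d (x n i) (x (Suc n) i) = d (y (Suc n) (id i)) (u (Suc n) (id i))" if "i \<in> {(k, j). k \<le> Suc n}"
        using that Q(1)[of k n j] by (cases "k = Suc n") (auto simp: i x_def)
      have "y k (k, j) \<in> M" using P(1)[of k] by auto
      then show "d (x n i) (x (Suc n) i) = 0" if "i \<notin> {(k, j). k \<le> Suc n}"
        using that by (auto simp: i x_def)
    qed auto
  qed
qed

text \<open>Pointwise limits exist because a coupling bounds each single distance, and the bounds
  survive since they concern finite sums.\<close>

lemma coupled_chain_limit:
  fixes x :: "nat \<Rightarrow> 'i \<Rightarrow> 'a"
  assumes p: "1 \<le> p" and complete: mcomplete and M: "\<And>n. range (x n) \<subseteq> M"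
    and c: "\<And>n. coupled p (x n) (x (Suc n)) (((1 / 2) ^ Suc n) powr p)"
  obtains y where "range y \<subseteq> M" "\<And>n. coupled p (x n) y ((2 * (1 / 2) ^ n) powr p)"
proof -
  \<comment> \<open>The increments add up to \<open>(1 / 2) ^ n * (1 - (1 / 2) ^ k)\<close>; the
    excess keeps the bound positive at \<open>k = 0\<close>, as \<open>coupled_triangle\<close>
    requires.\<close>
  have step: "coupled p (x n) (x (n + k)) (((1 / 2) ^ n * (2 - (1 / 2) ^ k)) powr p)" for n k
  proof (induction k)
    case 0
    then show ?case using coupled_refl[OF M] by simp
  next
    case (Suc k)
    have "((1 / 2 :: real) ^ k) \<le> 1" by (simp add: power_le_one)
    then have "0 < (1 / 2) ^ n * (2 - (1 / 2 :: real) ^ k)" by simp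
    then have "coupled p (x n) (x (Suc (n + k))) (((1 / 2) ^ n * (2 - (1 / 2) ^ k) + (1 / 2) ^ Suc (n + k)) powr p)"
      using Suc.IH c by (intro coupled_triangle[OF p M M M, of _ _ n "n + k"]) auto
    then show ?case by (simp add: power_add algebra_simps)
  qed
  have chain: "coupled p (x n) (x m) ((2 * (1 / 2) ^ n) powr p)" if "n \<le> m" for n m
  proof -
    have "((1 / 2 :: real) ^ (m - n)) \<le> 1" by (simp add: power_le_one)
    then have "((1 / 2) ^ n * (2 - (1 / 2) ^ (m - n))) powr p \<le> (2 * (1 / 2) ^ n) powr p"
      using p by (intro powr_mono2) auto
    then show ?thesis using step[of n "m - n"] that coupled_mono by fastforce
  qed
  have "\<exists>l. limitin mtopology (\<lambda>n. x n i) l sequentially" for i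
  proof -
    have "MCauchy (\<lambda>n. x n i)"
      unfolding MCauchy_def
    proof (intro conjI allI impI)
      show "range (\<lambda>n. x n i) \<subseteq> M" using M by auto
      fix \<epsilon> :: real assume "0 < \<epsilon>"
      then obtain N where N: "(1 / 2) ^ N < \<epsilon> / 2 / 2" using real_arch_pow_inv[of "\<epsilon> / 2 / 2" "1 / 2"] by auto
      have "d (x n i) (x n' i) < \<epsilon>" if "N \<le> n" "N \<le> n'" for n n'
      proof -
        have "d (x N i) (x n i) \<le> 2 * (1 / 2) ^ N" "d (x N i) (x n' i) \<le> 2 * (1 / 2) ^ N"
          using coupled_dist_le[OF chain p] that by auto
        moreover have "d (x n i) (x n' i) \<le> d (x N i) (x n i) + d (x N i) (x n' i)"
          using triangle[of "x n i" "x N i" "x n' i"] M commute[of "x n i"] by auto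
        ultimately show ?thesis using N by linarith
      qed
      then show "\<exists>N. \<forall>n n'. N \<le> n \<longrightarrow> N \<le> n' \<longrightarrow> d (x n i) (x n' i) < \<epsilon>" by blast
    qed
    then show ?thesis using complete by (simp add: mcomplete_def)
  qed
  then obtain y where y: "\<And>i. limitin mtopology (\<lambda>n. x n i) (y i) sequentially" by metis
  show ?thesis
  proof
    show "range y \<subseteq> M" using y by (auto simp: limit_metric_sequentially)
    show "coupled p (x n) y ((2 * (1 / 2) ^ n) powr p)" for n
      unfolding coupled_def
    proof (intro allI impI)
      fix F :: "'i set" assume F: "finite F"
      have "(\<lambda>m. d (x n i) (x m i)) \<longlonglongrightarrow> d (x n i) (y i)" for i
        using M by (intro limitin_dist_tendsto[OF y]) auto
      then have "(\<lambda>m. \<Sum>i\<in>F. d (x n i) (x m i) powr p) \<longlonglongrightarrow> (\<Sum>i\<in>F. d (x n i) (y i) powr p)"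
        using p by (intro tendsto_sum tendsto_powr' tendsto_const) auto
      moreover have "eventually (\<lambda>m. (\<Sum>i\<in>F. d (x n i) (x m i) powr p) \<le> (2 * (1 / 2) ^ n) powr p) sequentially"
        using eventually_ge_at_top[of n] by (rule eventually_mono) (use chain F in \<open>auto simp: coupled_def\<close>)
      ultimately show "(\<Sum>i\<in>F. d (x n i) (y i) powr p) \<le> (2 * (1 / 2) ^ n) powr p"
        by (rule tendsto_upperbound) simp
    qed
  qed
qed

theorem mcomplete_pdiagrams:
  assumes p: "1 \<le> p" and complete: mcomplete
  shows "Metric_space.mcomplete (pdiagrams p M d A) (pdist p d A)"
proof -
  interpret D: Metric_space "pdiagrams p M d A" "pdist p d A" by (rule Metric_space_pdiagrams[OF p])
  have "\<exists>T. limitin D.mtopology \<sigma> T sequentially" if \<sigma>: "D.MCauchy \<sigma>" for \<sigma>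
  proof -
    have \<sigma>D: "\<sigma> n \<in> pdiagrams p M d A" for n using \<sigma> by (auto simp: D.MCauchy_def)
    have "\<exists>N. \<forall>m m'. N \<le> m \<longrightarrow> N \<le> m' \<longrightarrow> pdist p d A (\<sigma> m) (\<sigma> m') < (1 / 2) ^ Suc n" for n
    proof -
      have "0 < (1 / 2 :: real) ^ Suc n" by simp
      then show ?thesis using \<sigma> unfolding D.MCauchy_def by blast
    qed
    then obtain N where N: "\<And>n m m'. N n \<le> m \<Longrightarrow> N n \<le> m' \<Longrightarrow> pdist p d A (\<sigma> m) (\<sigma> m') < (1 / 2) ^ Suc n"
      by metis
    \<comment> \<open>Strictly increasing and at least \<open>N n\<close>, although \<open>N\<close>
      need not be monotone.\<close>
    define r where "r n = n + (\<Sum>j\<le>n. N j)" for n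
    have r: "strict_mono r" by (rule strict_mono_Suc_iff[THEN iffD2]) (simp add: r_def)
    have rN: "N n \<le> r n" for n using member_le_sum[of n "{..n}" N] by (simp add: r_def trans_le_add2)
    have less: "diag_edist p d A (\<sigma> (r n)) (\<sigma> (r (Suc n))) < ennreal ((1 / 2) ^ Suc n)" for n
    proof -
      have "N n \<le> r (Suc n)" using rN[of n] strict_monoD[OF r, of n "Suc n"] by simp
      then show ?thesis
        unfolding edist_pdist[OF p \<sigma>D \<sigma>D] using N[OF rN[of n], of "r (Suc n)"] by (intro ennreal_lessI) auto
    qed
    obtain x :: "nat \<Rightarrow> nat \<times> nat \<Rightarrow> 'a" where x: "\<And>n. range (x n) \<subseteq> M" "\<And>n. dgm (x n) = \<sigma> (r n)"
      "\<And>n. coupled p (x n) (x (Suc n)) (((1 / 2) ^ Suc n) powr p)"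
      using chain_lift[where S = "\<lambda>n. \<sigma> (r n)" and c = "\<lambda>n. (1 / 2) ^ Suc n", OF p pdiagrams_diagrams[OF \<sigma>D] _ less]
      by auto
    obtain y where y: "range y \<subseteq> M" "\<And>n. coupled p (x n) y ((2 * (1 / 2) ^ n) powr p)"
      using coupled_chain_limit[OF p complete x(1,3)] by blast
    have T: "dgm y \<in> pdiagrams p M d A"
      using \<sigma>D[of "r 0"] x(2)[of 0] by (intro pdiagrams_dgmI[OF p x(1) y(1) _ y(2)[of 0]]) auto
    have le: "pdist p d A (\<sigma> (r n)) (dgm y) \<le> 2 * (1 / 2) ^ n" for n
      using pdist_dgm_le[OF p x(1) y(1) _ y(2)[of n]] x(2) by simp
    have "limitin D.mtopology (\<sigma> \<circ> r) (dgm y) sequentially"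
      unfolding D.limit_metric_sequentially
    proof (intro conjI allI impI T)
      fix \<epsilon> :: real assume "0 < \<epsilon>"
      then obtain n\<^sub>0 where n\<^sub>0: "(1 / 2) ^ n\<^sub>0 < \<epsilon> / 2" using real_arch_pow_inv[of "\<epsilon> / 2" "1 / 2"] by auto
      have "pdist p d A (\<sigma> (r n)) (dgm y) < \<epsilon>" if "n\<^sub>0 \<le> n" for n
      proof -
        have "(1 / 2 :: real) ^ n \<le> (1 / 2) ^ n\<^sub>0" using that by (intro power_decreasing) auto
        then show ?thesis using le[of n] n\<^sub>0 by linarith
      qed
      then show "\<exists>N. \<forall>n\<ge>N. (\<sigma> \<circ> r) n \<in> pdiagrams p M d A \<and> pdist p d A ((\<sigma> \<circ> r) n) (dgm y) < \<epsilon>"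
        using \<sigma>D by auto
    qed
    then show ?thesis using D.MCauchy_convergent_subsequence[OF \<sigma> r] by blast
  qed
  then show ?thesis by (simp add: D.mcomplete_def)
qed

section \<open>Separability\<close>

lemma empty_diagram_in_pdiagrams:
  assumes p: "1 \<le> p"
  shows "empty_diagram M A \<in> pdiagrams p M d A"
proof -
  have "diag_edist p d A (dgm (\<lambda>n::nat. base)) (dgm (\<lambda>n::nat. base)) \<le> ennreal 0"
    by (intro edist_dgm_le[OF p] coupled_refl) auto
  moreover have "empty_diagram M A = dgm (\<lambda>n::nat. base)" by (rule empty_diagram_eq) simp
  ultimately show ?thesis using empty_diagram_diagrams by (simp add: pdiagrams_def)
qed

lemma pdiagrams_coupled_A:
  assumes p: "1 \<le> p" and S: "S \<in> pdiagrams p M d A"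
  obtains u v :: "nat \<Rightarrow> 'a" and e where "range u \<subseteq> M" "range v \<subseteq> A" "dgm u = S" "coupled p u v e"
proof -
  obtain u v :: "nat \<Rightarrow> 'a" where *: "range u \<subseteq> M" "range v \<subseteq> M" "dgm u = S" "dgm v = empty_diagram M A"
    "coupled p u v ((pdist p d A S (empty_diagram M A) + 1) powr p)"
    using pdist_lessE[OF p S empty_diagram_in_pdiagrams[OF p], of "pdist p d A S (empty_diagram M A) + 1"] by auto
  then show ?thesis using that dgm_empty_in[OF *(2,4)] by blast
qed

definition finite_dgm :: "'a list \<Rightarrow> ('a \<Rightarrow> enat) set" where
  "finite_dgm xs = dgm (\<lambda>i. if i < length xs then xs ! i else base)"

lemma finite_dgm_in_pdiagrams:
  assumes p: "1 \<le> p" and xs: "set xs \<subseteq> M"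
  shows "finite_dgm xs \<in> pdiagrams p M d A"
proof -
  let ?u = "\<lambda>i. if i < length xs then xs ! i else base"
  define e where "e = (\<Sum>i<length xs. d base (xs ! i) powr p)"
  have e: "0 \<le> e" unfolding e_def by (intro sum_nonneg) auto
  have range: "range (\<lambda>n::nat. base) \<subseteq> M" "range ?u \<subseteq> M" using xs nth_mem by (auto simp: subset_eq)
  have "coupled p (\<lambda>n::nat. base) ?u e"
    unfolding coupled_def
  proof (intro allI impI)
    fix F :: "nat set" assume F: "finite F"
    have "(\<Sum>i\<in>F. d base (?u i) powr p) = (\<Sum>i\<in>F \<inter> {..<length xs}. d base (?u i) powr p)"
      using F by (intro sum.mono_neutral_right) auto
    also have "\<dots> = (\<Sum>i\<in>F \<inter> {..<length xs}. d base (xs ! i) powr p)" by (intro sum.cong) auto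
    also have "\<dots> \<le> e" unfolding e_def by (intro sum_mono2) auto
    finally show "(\<Sum>i\<in>F. d base (?u i) powr p) \<le> e" .
  qed
  then have "coupled p (\<lambda>n::nat. base) ?u ((e powr (1 / p)) powr p)"
    using p e by (simp add: powr_powr)
  then show ?thesis
    unfolding finite_dgm_def using empty_diagram_eq[of "\<lambda>n::nat. base"] empty_diagram_in_pdiagrams[OF p]
    by (intro pdiagrams_dgmI[OF p range]) auto
qed

lemma coupled_tail:
  fixes u v :: "nat \<Rightarrow> 'a"
  assumes "coupled p u v e" "0 < \<epsilon>"
  obtains N where "\<And>F. finite F \<Longrightarrow> F \<subseteq> {N..} \<Longrightarrow> (\<Sum>i\<in>F. d (u i) (v i) powr p) \<le> \<epsilon>"
proof -
  let ?f = "\<lambda>i. d (u i) (v i) powr p"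
  have sum: "summable ?f"
    using assms(1) by (intro summableI_nonneg_bounded[of _ e]) (auto simp: coupled_def)
  have "eventually (\<lambda>n. suminf ?f - \<epsilon> < sum ?f {..<n}) sequentially"
    using summable_LIMSEQ[OF sum] assms(2) by (intro order_tendstoD) auto
  then obtain N where N: "suminf ?f - \<epsilon> < sum ?f {..<N}" by (auto simp: eventually_sequentially)
  show ?thesis
  proof
    fix F assume F: "finite F" "F \<subseteq> {N..}"
    have "sum ?f {..<N} + sum ?f F = sum ?f ({..<N} \<union> F)" using F by (intro sum.union_disjoint[symmetric]) auto
    also have "\<dots> \<le> suminf ?f" using F by (intro sum_le_suminf[OF sum]) auto
    finally show "sum ?f F \<le> \<epsilon>" using N by linarith
  qed
qed

text \<open>From some index on, moving all points to their partners in \<open>A\<close> costs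
  little, which leaves a finite diagram; its finitely many points then move into
  \<open>C\<close>.\<close>

lemma finite_dgm_dense:
  assumes p: "1 \<le> p" and C: "C \<subseteq> M" "\<And>x r. x \<in> M \<Longrightarrow> 0 < r \<Longrightarrow> \<exists>y\<in>C. d x y < r"
    and S: "S \<in> pdiagrams p M d A" and r: "0 < r"
  obtains xs where "xs \<in> lists C" "pdist p d A S (finite_dgm xs) < r"
proof -
  obtain u v :: "nat \<Rightarrow> 'a" and e\<^sub>0 where uv: "range u \<subseteq> M" "range v \<subseteq> A" "dgm u = S" "coupled p u v e\<^sub>0"
    by (rule pdiagrams_coupled_A[OF p S])
  define e where "e = (r / 2) powr p"
  have e: "0 < e" using r by (simp add: e_def)
  obtain N where N: "\<And>F. finite F \<Longrightarrow> F \<subseteq> {N..} \<Longrightarrow> (\<Sum>i\<in>F. d (u i) (v i) powr p) \<le> e / 2"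
    using coupled_tail[OF uv(4), of "e / 2"] e by auto
  \<comment> \<open>\<open>N\<close> moves of cost at most \<open>\<delta> powr p\<close> stay
    within \<open>e / 2\<close>; the summand 1 keeps the divisor positive for
    \<open>N = 0\<close>.\<close>
  define \<delta> where "\<delta> = (e / (2 * (real N + 1))) powr (1 / p)"
  have \<delta>: "0 < \<delta>" "\<delta> powr p = e / (2 * (real N + 1))" using e p by (auto simp: \<delta>_def powr_powr)
  have "\<exists>y\<in>C. d (u i) y < \<delta>" for i using C(2)[OF range_subsetD[OF uv(1)] \<delta>(1)] by blast
  then obtain c where c: "\<And>i. c i \<in> C" "\<And>i. d (u i) (c i) < \<delta>" by metis
  define w where "w i = (if i < N then c i else v i)" for i
  have wM: "range w \<subseteq> M" using c(1) C(1) subsetD[OF A_subset range_subsetD[OF uv(2)]] by (auto simp: w_def)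
  have "coupled p u w e"
    unfolding coupled_def
  proof (intro allI impI)
    fix F :: "nat set" assume F: "finite F"
    let ?g = "\<lambda>i. d (u i) (w i) powr p"
    have "sum ?g F = sum ?g (F \<inter> {..<N}) + sum ?g (F - {..<N})" using F by (simp add: sum.Int_Diff)
    also have "sum ?g (F \<inter> {..<N}) \<le> (\<Sum>i\<in>F \<inter> {..<N}. \<delta> powr p)"
      using c(2) p by (intro sum_mono powr_mono2) (auto simp: w_def less_imp_le)
    also have "\<dots> \<le> real N * \<delta> powr p"
    proof -
      have "card (F \<inter> {..<N}) \<le> N" using card_mono[of "{..<N}" "F \<inter> {..<N}"] by simp
      then show ?thesis by (simp add: mult_right_mono)
    qed
    also have "\<dots> \<le> e / 2" using e by (simp add: \<delta>(2) divide_simps)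
    also have "sum ?g (F - {..<N}) = (\<Sum>i\<in>F - {..<N}. d (u i) (v i) powr p)" by (intro sum.cong) (auto simp: w_def)
    also have "\<dots> \<le> e / 2" using F by (intro N) auto
    finally show "sum ?g F \<le> e" by simp
  qed
  then have "pdist p d A (dgm u) (dgm w) \<le> r / 2"
    using r by (intro pdist_dgm_le[OF p uv(1) wM]) (auto simp: e_def)
  moreover have "dgm w = finite_dgm (map c [0..<N])"
    unfolding finite_dgm_def
    by (rule dgm_eq_off[OF wM]) (use range_subsetD[OF uv(2)] c(1) C(1) in \<open>auto simp: w_def split: if_splits\<close>)
  ultimately have "pdist p d A S (finite_dgm (map c [0..<N])) < r" using r uv(3) by simp
  moreover have "map c [0..<N] \<in> lists C" using c(1) by auto
  ultimately show ?thesis by (rule that[rotated])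
qed

theorem separable_pdiagrams:
  assumes p: "1 \<le> p" and sep: "separable_space mtopology"
  shows "separable_space (Metric_space.mtopology (pdiagrams p M d A) (pdist p d A))"
proof -
  interpret D: Metric_space "pdiagrams p M d A" "pdist p d A" by (rule Metric_space_pdiagrams[OF p])
  obtain C where C: "countable C" "C \<subseteq> M" "mtopology closure_of C = M"
    using sep by (auto simp: separable_space_def)
  have dense: "\<exists>y\<in>C. d x y < r" if "x \<in> M" "0 < r" for x r
    using C(3) that unfolding metric_closure_of by auto
  have sub: "finite_dgm ` lists C \<subseteq> pdiagrams p M d A"
    using finite_dgm_in_pdiagrams[OF p] C(2) by (auto simp: in_lists_conv_set subset_eq)
  moreover have "D.mtopology closure_of (finite_dgm ` lists C) = pdiagrams p M d A"
  proof (intro equalityI subsetI)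
    fix S assume S: "S \<in> pdiagrams p M d A"
    have "\<exists>T\<in>finite_dgm ` lists C. T \<in> D.mball S r" if r: "0 < r" for r
    proof -
      obtain xs where "xs \<in> lists C" "pdist p d A S (finite_dgm xs) < r"
        using finite_dgm_dense[OF p C(2) dense S r] by blast
      then show ?thesis using S sub by (intro bexI[of _ "finite_dgm xs"]) auto
    qed
    then show "S \<in> D.mtopology closure_of (finite_dgm ` lists C)" using S by (simp add: D.metric_closure_of)
  qed (simp add: D.metric_closure_of)
  ultimately show ?thesis
    using C(1) unfolding separable_space_def by (intro exI[of _ "finite_dgm ` lists C"]) auto
qed

section \<open>The four point inequality for diagrams\<close>

text \<open>Block 0 carries \<open>X\<close>, and block \<open>Suc n\<close> is a supply of points
  of \<open>A\<close> reserved for the coupling with \<open>Y n\<close>. As \<open>glue\<close>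
  alters \<open>x\<^sub>0\<close> only in that block, the altered families combine into a single
  \<open>x\<close>; in foreign blocks \<open>y n\<close> copies \<open>x\<close>, which stays in
  \<open>A\<close> there.\<close>

lemma star_lift:
  assumes p: "1 \<le> p" and X: "X \<in> diagrams M A" and Y: "\<And>n. Y n \<in> diagrams M A" and c: "\<And>n. 0 \<le> c n"
    and less: "\<And>n. diag_edist p d A X (Y n) < ennreal (c n)"
  obtains x :: "nat \<times> nat \<Rightarrow> 'a" and y :: "nat \<Rightarrow> nat \<times> nat \<Rightarrow> 'a" where "range x \<subseteq> M" "\<And>n. range (y n) \<subseteq> M"
    "\<And>n. dgm (y n) = Y n" "\<And>n. coupled p x (y n) (c n powr p)"
proof -
  obtain u :: "nat \<Rightarrow> 'a" where u: "range u \<subseteq> M" "dgm u = X" using ex_dgm[OF X] .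
  define x\<^sub>0 where "x\<^sub>0 = (\<lambda>(k::nat, j). if k = 0 then u j else base)"
  have range: "range x\<^sub>0 \<subseteq> M" using range_subsetD[OF u(1)] by (auto simp: x\<^sub>0_def)
  have "dgm u = dgm x\<^sub>0"
    by (rule dgm_eqI[OF u(1) range, of "\<lambda>j. (0, j)" UNIV "{0} \<times> UNIV"])
       (auto simp: x\<^sub>0_def bij_betw_def inj_on_def split: if_splits)
  then have x\<^sub>0: "dgm x\<^sub>0 = X" using u by simp
  have "\<exists>x' y'. range x' \<subseteq> M \<and> range y' \<subseteq> M \<and> (\<forall>i. i \<notin> range (\<lambda>j. (Suc n, j)) \<longrightarrow> x' i = x\<^sub>0 i) \<and>
      (\<forall>j. x' (Suc n, j) \<in> A) \<and> dgm y' = Y n \<and> coupled p x' y' (c n powr p) \<and>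
      (\<forall>i. i \<notin> range (\<lambda>j. (Suc n, j)) \<longrightarrow> x\<^sub>0 i \<in> A \<longrightarrow> y' i = x\<^sub>0 i)" for n
  proof -
    obtain v w :: "nat \<Rightarrow> 'a" where vw: "range v \<subseteq> M" "range w \<subseteq> M" "dgm v = X" "dgm w = Y n" "coupled p v w (c n powr p)"
      using edist_lessE[OF p X Y c less] by metis
    have inj: "inj (\<lambda>j. (Suc n, j))" by (simp add: inj_on_def)
    have A: "x\<^sub>0 (Suc n, j) \<in> A" for j by (simp add: x\<^sub>0_def)
    show ?thesis
      by (rule glue[OF range vw(1,2) inj A _ vw(5)]) (simp add: x\<^sub>0 vw, metis vw(4))
  qed
  then obtain x' y' where *: "\<And>n. range (x' n) \<subseteq> M" "\<And>n. range (y' n) \<subseteq> M"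
    "\<And>n i. i \<notin> range (\<lambda>j. (Suc n, j)) \<Longrightarrow> x' n i = x\<^sub>0 i" "\<And>n j. x' n (Suc n, j) \<in> A"
    "\<And>n. dgm (y' n) = Y n" "\<And>n. coupled p (x' n) (y' n) (c n powr p)"
    "\<And>n i. i \<notin> range (\<lambda>j. (Suc n, j)) \<Longrightarrow> x\<^sub>0 i \<in> A \<Longrightarrow> y' n i = x\<^sub>0 i"
    by metis
  define x where "x = (\<lambda>(k, j). if k = 0 then x\<^sub>0 (k, j) else x' (k - 1) (k, j))"
  define y where "y n = (\<lambda>(k, j). if k = 0 \<or> k = Suc n then y' n (k, j) else x (k, j))" for n
  have x'0: "x' n (k, j) = x\<^sub>0 (k, j)" if "k \<noteq> Suc n" for n k j using that by (intro *(3)) auto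
  have xA: "x (k, j) \<in> A" if "k \<noteq> 0" for k j using *(4)[of "k - 1" j] that by (simp add: x_def)
  have xM: "range x \<subseteq> M" using range *(1) by (auto simp: x_def range_subsetD)
  have yM: "range (y n) \<subseteq> M" for n using range_subsetD[OF xM] range_subsetD[OF *(2)] by (auto simp: y_def)
  have y'A: "y' n (k, j) \<in> A" if "k \<noteq> 0" "k \<noteq> Suc n" for n k j
  proof -
    have "x\<^sub>0 (k, j) \<in> A" "(k, j) \<notin> range (\<lambda>j. (Suc n, j))" using that by (auto simp: x\<^sub>0_def)
    then show ?thesis using *(7) by metis
  qed
  show ?thesis
  proof
    show "range x \<subseteq> M" "range (y n) \<subseteq> M" for n by (rule xM, rule yM)
    show "dgm (y n) = Y n" for n
    proof -
      have "dgm (y n) = dgm (y' n)"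
        by (rule dgm_eq_off[OF yM *(2)]) (use y'A xA in \<open>auto simp: y_def split: prod.splits if_splits\<close>)
      then show ?thesis using *(5) by simp
    qed
    show "coupled p x (y n) (c n powr p)" for n
    proof (rule coupled_reindex[OF *(6)[of n], of id "{(k, j). k = 0 \<or> k = Suc n}"])
      fix i :: "nat \<times> nat"
      obtain k j where i: "i = (k, j)" by fastforce
      show "d (x i) (y n i) = d (x' n (id i)) (y' n (id i))" if "i \<in> {(k, j). k = 0 \<or> k = Suc n}"
        using that x'0[of 0 n j] by (auto simp: i x_def y_def)
      show "d (x i) (y n i) = 0" if "i \<notin> {(k, j). k = 0 \<or> k = Suc n}"
        using that range_subsetD[OF xM, of i] by (auto simp: i y_def)
    qed auto
  qed
qed

text \<open>The distance is an infimum over couplings, so no pair of representing families is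
  cheaper. The total cost may be infinite, hence a finite set of indices.\<close>

lemma ex_sum_near_pdist:
  fixes u v :: "'i::countable \<Rightarrow> 'a"
  assumes M: "range u \<subseteq> M" "range v \<subseteq> M" and \<epsilon>: "0 < \<epsilon>"
  obtains F where "finite F" "(pdist 2 d A (dgm u) (dgm v))\<^sup>2 - \<epsilon> \<le> (\<Sum>i\<in>F. (d (u i) (v i))\<^sup>2)"
proof (cases "(pdist 2 d A (dgm u) (dgm v))\<^sup>2 - \<epsilon> \<le> 0")
  case True
  then show ?thesis using that[of "{}"] by simp
next
  case False
  define e where "e = (pdist 2 d A (dgm u) (dgm v))\<^sup>2 - \<epsilon>"
  have e: "0 < e" "sqrt e powr 2 = e" using False by (auto simp: e_def powr_numeral)
  have "\<not> coupled 2 u v e"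
  proof
    assume "coupled 2 u v e"
    then have "pdist 2 d A (dgm u) (dgm v) \<le> sqrt e" using e by (intro pdist_dgm_le[OF _ M]) auto
    then have "(pdist 2 d A (dgm u) (dgm v))\<^sup>2 \<le> (sqrt e)\<^sup>2" by (intro power_mono) (auto simp: pdist_def)
    then show False using e \<epsilon> by (simp add: e_def)
  qed
  then obtain F where "finite F" "e < (\<Sum>i\<in>F. d (u i) (v i) powr 2)" by (auto simp: coupled_def not_le)
  then show ?thesis using that[of F] by (simp add: e_def powr_numeral)
qed

theorem four_point_pdiagrams:
  assumes four: four_point_inequality
  shows "Metric_space.four_point_inequality (pdiagrams 2 M d A) (pdist 2 d A)"
proof -
  let ?D = "pdist 2 d A"
  have p: "1 \<le> (2::real)" by simp
  interpret D: Metric_space "pdiagrams 2 M d A" ?D by (rule Metric_space_pdiagrams[OF p])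
  show ?thesis
    unfolding D.four_point_inequality_def
  proof (intro ballI allI impI)
    fix X Y\<^sub>1 Y\<^sub>2 Y\<^sub>3 and l\<^sub>1 l\<^sub>2 l\<^sub>3 :: real
    assume D: "X \<in> pdiagrams 2 M d A" "Y\<^sub>1 \<in> pdiagrams 2 M d A" "Y\<^sub>2 \<in> pdiagrams 2 M d A" "Y\<^sub>3 \<in> pdiagrams 2 M d A"
      and l: "0 \<le> l\<^sub>1" "0 \<le> l\<^sub>2" "0 \<le> l\<^sub>3"
    let ?L = "l\<^sub>1 * l\<^sub>2 * (?D Y\<^sub>1 Y\<^sub>2)\<^sup>2 + l\<^sub>1 * l\<^sub>3 * (?D Y\<^sub>1 Y\<^sub>3)\<^sup>2 + l\<^sub>2 * l\<^sub>3 * (?D Y\<^sub>2 Y\<^sub>3)\<^sup>2"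
    let ?K = "l\<^sub>1 * l\<^sub>2 + l\<^sub>1 * l\<^sub>3 + l\<^sub>2 * l\<^sub>3"
    let ?R = "\<lambda>t. (l\<^sub>1 + l\<^sub>2 + l\<^sub>3) * (l\<^sub>1 * (?D X Y\<^sub>1 + t)\<^sup>2 + l\<^sub>2 * (?D X Y\<^sub>2 + t)\<^sup>2 + l\<^sub>3 * (?D X Y\<^sub>3 + t)\<^sup>2)"
    have approx: "?L - ?K * t \<le> ?R t" if t: "0 < t" for t
    proof -
      define Y where "Y n = (if n = 0 then Y\<^sub>1 else if n = 1 then Y\<^sub>2 else Y\<^sub>3)" for n :: nat
      have YD: "Y n \<in> pdiagrams 2 M d A" for n using D by (simp add: Y_def)
      have pos: "0 \<le> ?D X (Y n) + t" for n using t by (simp add: pdist_def)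
      have "diag_edist 2 d A X (Y n) < ennreal (?D X (Y n) + t)" for n
        unfolding edist_pdist[OF p D(1) YD] using t by (intro ennreal_lessI) (auto simp: pdist_def add_nonneg_pos)
      then obtain x :: "nat \<times> nat \<Rightarrow> 'a" and y :: "nat \<Rightarrow> nat \<times> nat \<Rightarrow> 'a" where xy: "range x \<subseteq> M"
        "\<And>n. range (y n) \<subseteq> M" "\<And>n. dgm (y n) = Y n" "\<And>n. coupled 2 x (y n) ((?D X (Y n) + t) powr 2)"
        using star_lift[where Y = Y and c = "\<lambda>n. ?D X (Y n) + t", OF p pdiagrams_diagrams[OF D(1)] pdiagrams_diagrams[OF YD] pos]
        by metis
      obtain F\<^sub>1\<^sub>2 where F12: "finite F\<^sub>1\<^sub>2" "(?D Y\<^sub>1 Y\<^sub>2)\<^sup>2 - t \<le> (\<Sum>i\<in>F\<^sub>1\<^sub>2. (d (y 0 i) (y 1 i))\<^sup>2)"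
        using ex_sum_near_pdist[OF xy(2)[of 0] xy(2)[of 1] t] xy(3) by (auto simp: Y_def)
      obtain F\<^sub>1\<^sub>3 where F13: "finite F\<^sub>1\<^sub>3" "(?D Y\<^sub>1 Y\<^sub>3)\<^sup>2 - t \<le> (\<Sum>i\<in>F\<^sub>1\<^sub>3. (d (y 0 i) (y 2 i))\<^sup>2)"
        using ex_sum_near_pdist[OF xy(2)[of 0] xy(2)[of 2] t] xy(3) by (auto simp: Y_def)
      obtain F\<^sub>2\<^sub>3 where F23: "finite F\<^sub>2\<^sub>3" "(?D Y\<^sub>2 Y\<^sub>3)\<^sup>2 - t \<le> (\<Sum>i\<in>F\<^sub>2\<^sub>3. (d (y 1 i) (y 2 i))\<^sup>2)"
        using ex_sum_near_pdist[OF xy(2)[of 1] xy(2)[of 2] t] xy(3) by (auto simp: Y_def)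
      \<comment> \<open>One finite set for all three lower bounds: enlarging it only increases those
        sums, and the upper bounds for the distances from \<open>x\<close> hold on every finite
        set.\<close>
      define F where "F = F\<^sub>1\<^sub>2 \<union> F\<^sub>1\<^sub>3 \<union> F\<^sub>2\<^sub>3"
      have F: "finite F" using F12 F13 F23 by (simp add: F_def)
      have big: "(\<Sum>i\<in>G. (d (y m i) (y n i))\<^sup>2) \<le> (\<Sum>i\<in>F. (d (y m i) (y n i))\<^sup>2)" if "G \<subseteq> F" for G m n
        using F that by (intro sum_mono2) auto
      have le: "(\<Sum>i\<in>F. (d (x i) (y n i))\<^sup>2) \<le> (?D X (Y n) + t)\<^sup>2" for n
        using xy(4)[of n] F pos[of n] unfolding coupled_def by (simp add: powr_numeral)
      have "?L - ?K * t = l\<^sub>1 * l\<^sub>2 * ((?D Y\<^sub>1 Y\<^sub>2)\<^sup>2 - t) + l\<^sub>1 * l\<^sub>3 * ((?D Y\<^sub>1 Y\<^sub>3)\<^sup>2 - t) + l\<^sub>2 * l\<^sub>3 * ((?D Y\<^sub>2 Y\<^sub>3)\<^sup>2 - t)"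
        by (simp add: algebra_simps)
      also have "\<dots> \<le> l\<^sub>1 * l\<^sub>2 * (\<Sum>i\<in>F. (d (y 0 i) (y 1 i))\<^sup>2) + l\<^sub>1 * l\<^sub>3 * (\<Sum>i\<in>F. (d (y 0 i) (y 2 i))\<^sup>2)
          + l\<^sub>2 * l\<^sub>3 * (\<Sum>i\<in>F. (d (y 1 i) (y 2 i))\<^sup>2)"
        using l by (intro add_mono mult_left_mono order_trans[OF F12(2) big] order_trans[OF F13(2) big] order_trans[OF F23(2) big])
          (auto simp: F_def)
      also have "\<dots> = (\<Sum>i\<in>F. l\<^sub>1 * l\<^sub>2 * (d (y 0 i) (y 1 i))\<^sup>2 + l\<^sub>1 * l\<^sub>3 * (d (y 0 i) (y 2 i))\<^sup>2 + l\<^sub>2 * l\<^sub>3 * (d (y 1 i) (y 2 i))\<^sup>2)"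
        by (simp add: sum.distrib sum_distrib_left)
      also have "\<dots> \<le> (\<Sum>i\<in>F. (l\<^sub>1 + l\<^sub>2 + l\<^sub>3) * (l\<^sub>1 * (d (x i) (y 0 i))\<^sup>2 + l\<^sub>2 * (d (x i) (y 1 i))\<^sup>2 + l\<^sub>3 * (d (x i) (y 2 i))\<^sup>2))"
        by (intro sum_mono four_point_inequalityD[OF four range_subsetD[OF xy(1)] range_subsetD[OF xy(2)]
            range_subsetD[OF xy(2)] range_subsetD[OF xy(2)] l])
      also have "\<dots> = (l\<^sub>1 + l\<^sub>2 + l\<^sub>3) * (l\<^sub>1 * (\<Sum>i\<in>F. (d (x i) (y 0 i))\<^sup>2) + l\<^sub>2 * (\<Sum>i\<in>F. (d (x i) (y 1 i))\<^sup>2)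
          + l\<^sub>3 * (\<Sum>i\<in>F. (d (x i) (y 2 i))\<^sup>2))"
        by (simp only: sum.distrib sum_distrib_left[symmetric])
      also have "\<dots> \<le> ?R t"
        using l le[of 0] le[of 1] le[of 2] by (intro mult_left_mono add_mono) (auto simp: Y_def)
      finally show ?thesis .
    qed
    have "?L - ?K * 0 \<le> ?R 0"
    proof (rule tendsto_le[of "at_right 0"])
      show "((\<lambda>t. ?L - ?K * t) \<longlongrightarrow> ?L - ?K * 0) (at_right 0)" by (intro tendsto_intros)
      show "(?R \<longlongrightarrow> ?R 0) (at_right 0)" by (intro tendsto_intros)
      show "eventually (\<lambda>t. ?L - ?K * t \<le> ?R t) (at_right 0)"
        using eventually_at_right_less[of 0] by (rule eventually_mono) (rule approx)
    qed simp
    then show "?L \<le> (l\<^sub>1 + l\<^sub>2 + l\<^sub>3) * (l\<^sub>1 * (?D X Y\<^sub>1)\<^sup>2 + l\<^sub>2 * (?D X Y\<^sub>2)\<^sup>2 + l\<^sub>3 * (?D X Y\<^sub>3)\<^sup>2)" by simp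
  qed
qed

end

section \<open>Optimal couplings\<close>

locale proper_metric_pair = metric_pair M d A for M :: "'a set" and d :: "'a \<Rightarrow> 'a \<Rightarrow> real" and A :: "'a set" +
  assumes proper: "proper_space M d"
begin

text \<open>A minimizing sequence stays in \<open>A \<inter> mcball x (m + 1)\<close>, which is
  compact by properness.\<close>

lemma ex_nearest:
  assumes x: "x \<in> M"
  shows "\<exists>a\<in>A. \<forall>b\<in>A. d x a \<le> d x b"
proof -
  define m where "m = (INF a\<in>A. d x a)"
  have bdd: "bdd_below (d x ` A)" by (intro bdd_belowI[of _ 0]) auto
  have lower: "m \<le> d x b" if "b \<in> A" for b unfolding m_def using that by (intro cINF_lower bdd)
  have "\<exists>a\<in>A. d x a < m + 1 / real (Suc n)" for n
  proof -
    have "(INF a\<in>A. d x a) < m + 1 / real (Suc n)" by (simp add: m_def)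
    then show ?thesis using cINF_less_iff[OF nonempty_A bdd] by blast
  qed
  then obtain a where a: "\<And>n. a n \<in> A" "\<And>n. d x (a n) < m + 1 / real (Suc n)" by metis
  have "a n \<in> mcball x (m + 1)" for n
  proof -
    have "1 / real (Suc n) \<le> 1" by simp
    then have "d x (a n) \<le> m + 1" using a(2)[of n] by linarith
    then show ?thesis using x a(1)[of n] A_subset by auto
  qed
  then have range: "range a \<subseteq> A \<inter> mcball x (m + 1)" using a(1) by auto
  have "closedin mtopology (A \<inter> mcball x (m + 1))" by (intro closedin_Int closed_A closedin_mcball)
  moreover have "mbounded (A \<inter> mcball x (m + 1))" using mbounded_subset[OF mbounded_mcball] by blast
  ultimately have "compactin mtopology (A \<inter> mcball x (m + 1))" using proper by (simp add: proper_space_def)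
  then obtain l r where l: "l \<in> A" and r: "strict_mono r" "limitin mtopology (a \<circ> r) l sequentially"
    using range unfolding compactin_sequentially by blast
  have "(\<lambda>n. d x ((a \<circ> r) n)) \<longlonglongrightarrow> d x l"
    using a(1) A_subset x by (intro limitin_dist_tendsto[OF r(2)]) auto
  moreover have "(\<lambda>n. m + 1 / real (Suc (r n))) \<longlonglongrightarrow> m + 0"
    using LIMSEQ_subseq_LIMSEQ[OF LIMSEQ_Suc[OF lim_1_over_n] r(1)] by (intro tendsto_intros) (simp add: comp_def)
  ultimately have "d x l \<le> m + 0"
    using a(2) by (intro LIMSEQ_le) (auto intro: less_imp_le)
  then show ?thesis using l lower by force
qed

definition nearest :: "'a \<Rightarrow> 'a" where
  "nearest x = (SOME a. a \<in> A \<and> (\<forall>b\<in>A. d x a \<le> d x b))"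

definition dist_A :: "'a \<Rightarrow> real" where "dist_A x = d x (nearest x)"

lemma nearest: "x \<in> M \<Longrightarrow> nearest x \<in> A" "x \<in> M \<Longrightarrow> b \<in> A \<Longrightarrow> dist_A x \<le> d x b"
proof -
  have "nearest x \<in> A \<and> (\<forall>b\<in>A. d x (nearest x) \<le> d x b)" if x: "x \<in> M"
  proof -
    have "\<exists>a. a \<in> A \<and> (\<forall>b\<in>A. d x a \<le> d x b)" using ex_nearest[OF x] by (simp only: Bex_def)
    then show ?thesis unfolding nearest_def by (rule someI_ex)
  qed
  then show "x \<in> M \<Longrightarrow> nearest x \<in> A" "x \<in> M \<Longrightarrow> b \<in> A \<Longrightarrow> dist_A x \<le> d x b" by (auto simp: dist_A_def)
qed

lemma dist_A_nonneg [simp]: "0 \<le> dist_A x" by (simp add: dist_A_def)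

lemma dist_A_zero: "x \<in> A \<Longrightarrow> dist_A x = 0"
  using nearest(2)[of x x] A_subset dist_A_nonneg[of x] by force

lemma dist_A_lipschitz: "x \<in> M \<Longrightarrow> y \<in> M \<Longrightarrow> dist_A x \<le> d x y + dist_A y"
  using nearest(2)[of x "nearest y"] triangle[of x y "nearest y"] nearest(1)[of y] A_subset
  by (force simp: dist_A_def)

text \<open>A plan matches some of the points \<open>u i\<close> with points \<open>v j\<close> injectively; all other points of
  both families are sent to the nearest point of \<open>A\<close>.\<close>

definition plan :: "(nat \<Rightarrow> nat option) \<Rightarrow> bool" where
  "plan r \<longleftrightarrow> (\<forall>i i' j. r i = Some j \<and> r i' = Some j \<longrightarrow> i = i')"

definition cost_left :: "real \<Rightarrow> (nat \<Rightarrow> 'a) \<Rightarrow> (nat \<Rightarrow> 'a) \<Rightarrow> (nat \<Rightarrow> nat option) \<Rightarrow> nat \<Rightarrow> real" where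
  "cost_left p u v r i = (case r i of Some j \<Rightarrow> d (u i) (v j) powr p | None \<Rightarrow> dist_A (u i) powr p)"

definition cost_right :: "real \<Rightarrow> (nat \<Rightarrow> 'a) \<Rightarrow> (nat \<Rightarrow> nat option) \<Rightarrow> nat \<Rightarrow> real" where
  "cost_right p v r j = (if Some j \<in> range r then 0 else dist_A (v j) powr p)"

text \<open>Both families stay fixed and only the matching varies, so compactness is a matter of
  relations between natural numbers. A matched pair is charged once, on the left;
  \<open>cost_right\<close> charges the unmatched \<open>v j\<close>.\<close>

definition plan_bounded :: "real \<Rightarrow> (nat \<Rightarrow> 'a) \<Rightarrow> (nat \<Rightarrow> 'a) \<Rightarrow> (nat \<Rightarrow> nat option) \<Rightarrow> real \<Rightarrow> bool" where
  "plan_bounded p u v r e \<longleftrightarrow>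
     (\<forall>F G. finite F \<and> finite G \<longrightarrow> (\<Sum>i\<in>F. cost_left p u v r i) + (\<Sum>j\<in>G. cost_right p v r j) \<le> e)"

text \<open>Each index of the coupling is charged at most once: through \<open>h\<close> if its
  point \<open>u'\<close> is off \<open>A\<close>, through \<open>\<kappa>\<close> if
  \<open>u'\<close> is in \<open>A\<close> and \<open>v'\<close> is not. Where one partner lies in
  \<open>A\<close>, projecting the other to a nearest point is no dearer.\<close>

lemma plan_of_coupling:
  fixes u v u' v' :: "nat \<Rightarrow> 'a"
  assumes p: "1 \<le> p" and M: "range u \<subseteq> M" "range v \<subseteq> M" "range u' \<subseteq> M" "range v' \<subseteq> M"
    and eq: "dgm u = dgm u'" "dgm v' = dgm v" and c: "coupled p u' v' e"
  obtains r where "plan r" "plan_bounded p u v r e"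
proof -
  obtain h where h: "bij_betw h {i. u i \<notin> A} {i. u' i \<notin> A}" "\<And>i. u i \<notin> A \<Longrightarrow> u' (h i) = u i"
    using dgm_eqE[OF M(1,3) eq(1)] by blast
  obtain k where k: "bij_betw k {i. v' i \<notin> A} {j. v j \<notin> A}" "\<And>i. v' i \<notin> A \<Longrightarrow> v (k i) = v' i"
    using dgm_eqE[OF M(4,2) eq(2)] by blast
  define \<kappa> where "\<kappa> = inv_into {i. v' i \<notin> A} k"
  have \<kappa>: "bij_betw \<kappa> {j. v j \<notin> A} {i. v' i \<notin> A}" unfolding \<kappa>_def using k(1) by (rule bij_betw_inv_into)
  have k\<kappa>: "k (\<kappa> j) = j" if "v j \<notin> A" for j
    unfolding \<kappa>_def using k(1) that by (intro bij_betw_inv_into_right) auto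
  have \<kappa>A: "v' (\<kappa> j) \<notin> A" if "v j \<notin> A" for j using bij_betwE[OF \<kappa>] that by auto
  have v\<kappa>: "v' (\<kappa> j) = v j" if "v j \<notin> A" for j using k(2)[OF \<kappa>A[OF that]] k\<kappa>[OF that] by simp
  have hA: "u' (h i) \<notin> A" if "u i \<notin> A" for i using bij_betwE[OF h(1)] that by auto
  have uM: "u i \<in> M" "v i \<in> M" "u' i \<in> M" "v' i \<in> M" for i using M by auto
  define r where "r i = (if u i \<notin> A \<and> v' (h i) \<notin> A then Some (k (h i)) else None)" for i
  have "plan r"
    unfolding plan_def
  proof (intro allI impI)
    fix i i' j assume "r i = Some j \<and> r i' = Some j"
    then have *: "u i \<notin> A" "u i' \<notin> A" "v' (h i) \<notin> A" "v' (h i') \<notin> A" "k (h i) = k (h i')"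
      by (auto simp: r_def split: if_splits)
    then have "h i = h i'" using k(1) by (auto simp: bij_betw_def inj_on_def)
    then show "i = i'" using h(1) * by (auto simp: bij_betw_def inj_on_def)
  qed
  moreover have "plan_bounded p u v r e"
    unfolding plan_bounded_def
  proof (intro allI impI, elim conjE)
    fix F G :: "nat set" assume fin: "finite F" "finite G"
    let ?c = "\<lambda>i. d (u' i) (v' i) powr p"
    define F' where "F' = {i\<in>F. u i \<notin> A}"
    define G' where "G' = {j\<in>G. v j \<notin> A \<and> u' (\<kappa> j) \<in> A}"
    have left: "cost_left p u v r i \<le> (if i \<in> F' then ?c (h i) else 0)" if i: "i \<in> F" for i
    proof (cases "u i \<in> A")
      case True
      then show ?thesis by (simp add: cost_left_def r_def F'_def dist_A_zero)
    next
      case False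
      have "dist_A (u i) powr p \<le> ?c (h i)" if "v' (h i) \<in> A"
        using nearest(2)[OF uM(1)[of i] that] h(2)[OF False] p by (intro powr_mono2) auto
      then show ?thesis
        using False i h(2)[OF False] k(2)[of "h i"] by (auto simp: cost_left_def r_def F'_def)
    qed
    have right: "cost_right p v r j \<le> (if j \<in> G' then ?c (\<kappa> j) else 0)" if j: "j \<in> G" for j
    proof (cases "v j \<in> A")
      case True
      then show ?thesis by (simp add: cost_right_def G'_def dist_A_zero)
    next
      case False
      show ?thesis
      proof (cases "u' (\<kappa> j) \<in> A")
        case True
        have "dist_A (v j) powr p \<le> ?c (\<kappa> j)"
          using nearest(2)[OF uM(2)[of j] True] v\<kappa>[OF False] commute[of "v j"] p by (intro powr_mono2) auto
        then show ?thesis using True False j by (simp add: cost_right_def G'_def)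
      next
        case u': False
        then have "\<kappa> j \<in> h ` {i. u i \<notin> A}" using h(1) by (simp add: bij_betw_def)
        then obtain i where i: "u i \<notin> A" "h i = \<kappa> j" by auto
        then have "r i = Some j" using \<kappa>A[OF False] k\<kappa>[OF False] by (simp add: r_def)
        then have "Some j \<in> range r" by (metis rangeI)
        then show ?thesis by (simp add: cost_right_def)
      qed
    qed
    have "(\<Sum>i\<in>F. cost_left p u v r i) + (\<Sum>j\<in>G. cost_right p v r j)
        \<le> (\<Sum>i\<in>F. if i \<in> F' then ?c (h i) else 0) + (\<Sum>j\<in>G. if j \<in> G' then ?c (\<kappa> j) else 0)"
      by (intro add_mono sum_mono left right)
    also have "(\<Sum>i\<in>F. if i \<in> F' then ?c (h i) else 0) = (\<Sum>i\<in>F'. ?c (h i))"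
      using fin by (intro sum.mono_neutral_cong_right) (auto simp: F'_def)
    also have "(\<Sum>j\<in>G. if j \<in> G' then ?c (\<kappa> j) else 0) = (\<Sum>j\<in>G'. ?c (\<kappa> j))"
      using fin by (intro sum.mono_neutral_cong_right) (auto simp: G'_def)
    also have "(\<Sum>i\<in>F'. ?c (h i)) = sum ?c (h ` F')"
      using h(1) by (subst sum.reindex) (auto simp: F'_def bij_betw_def inj_on_def)
    also have "(\<Sum>j\<in>G'. ?c (\<kappa> j)) = sum ?c (\<kappa> ` G')"
      using \<kappa> by (subst sum.reindex) (auto simp: G'_def bij_betw_def inj_on_def)
    also have "sum ?c (h ` F') + sum ?c (\<kappa> ` G') = sum ?c (h ` F' \<union> \<kappa> ` G')"
    proof (rule sum.union_disjoint[symmetric])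
      show "finite (h ` F')" "finite (\<kappa> ` G')" using fin by (auto simp: F'_def G'_def)
      have "u' x \<notin> A" if "x \<in> h ` F'" for x using that hA by (auto simp: F'_def)
      moreover have "u' x \<in> A" if "x \<in> \<kappa> ` G'" for x using that by (auto simp: G'_def)
      ultimately show "h ` F' \<inter> \<kappa> ` G' = {}" by blast
    qed
    also have "\<dots> \<le> e" using c fin by (auto simp: coupled_def F'_def G'_def)
    finally show "(\<Sum>i\<in>F. cost_left p u v r i) + (\<Sum>j\<in>G. cost_right p v r j) \<le> e" .
  qed
  ultimately show ?thesis by (rule that)
qed

text \<open>Index \<open>Inl i\<close> carries \<open>u i\<close> with its partner or its
  projection. Index \<open>Inr j\<close> carries \<open>v j\<close> with its projection if
  \<open>v j\<close> is unmatched and \<open>base\<close> twice otherwise, so that no point off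
  \<open>A\<close> is lost or repeated.\<close>

lemma coupling_of_plan:
  fixes u v :: "nat \<Rightarrow> 'a"
  assumes M: "range u \<subseteq> M" "range v \<subseteq> M" and r: "plan r" "plan_bounded p u v r e"
  obtains U V :: "nat + nat \<Rightarrow> 'a" where "range U \<subseteq> M" "range V \<subseteq> M" "dgm U = dgm u" "dgm V = dgm v" "coupled p U V e"
proof -
  define U where "U = case_sum u (\<lambda>j. if Some j \<in> range r then base else nearest (v j))"
  define V where "V = case_sum (\<lambda>i. case r i of Some j \<Rightarrow> v j | None \<Rightarrow> nearest (u i)) (\<lambda>j. if Some j \<in> range r then base else v j)"
  have uM: "u i \<in> M" "v i \<in> M" for i using M by auto
  have nA: "nearest (u i) \<in> A" "nearest (v i) \<in> A" for i using nearest(1) uM by auto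
  have nM: "nearest (u i) \<in> M" "nearest (v i) \<in> M" for i using nA A_subset by auto
  show ?thesis
  proof
    show U: "range U \<subseteq> M" using uM nM by (auto simp: U_def split: sum.splits)
    show V: "range V \<subseteq> M" using uM nM by (auto simp: V_def split: sum.splits option.splits)
    show "dgm U = dgm u"
      by (rule dgm_eqI[OF U M(1), of projl "range Inl" UNIV])
         (auto simp: U_def bij_betw_def inj_on_def nA image_image split: sum.splits)
    let ?K = "{Inl i |i. r i \<noteq> None} \<union> {Inr j |j. Some j \<notin> range r}"
    let ?m = "case_sum (\<lambda>i. the (r i)) id :: nat + nat \<Rightarrow> nat"
    have "inj_on ?m ?K"
    proof (rule inj_onI)
      fix a b assume ab: "a \<in> ?K" "b \<in> ?K" "?m a = ?m b"
      then show "a = b" using r(1) by (cases a; cases b) (auto simp: plan_def image_iff, metis+)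
    qed
    moreover have "?m ` ?K = UNIV"
    proof (intro equalityI subsetI)
      fix j show "j \<in> ?m ` ?K"
      proof (cases "Some j \<in> range r")
        case True
        then obtain i where "r i = Some j" by (metis imageE)
        then show ?thesis by (intro image_eqI[of _ _ "Inl i"]) auto
      next
        case False
        then show ?thesis by (intro image_eqI[of _ _ "Inr j"]) auto
      qed
    qed simp
    ultimately have m: "bij_betw ?m ?K UNIV" by (simp add: bij_betw_def)
    show "dgm V = dgm v"
    proof (rule dgm_eqI[OF V M(2) m])
      fix a show "a \<in> ?K \<Longrightarrow> v (?m a) = V a" by (auto simp: V_def)
      show "a \<notin> ?K \<Longrightarrow> V a \<in> A" by (cases a) (auto simp: V_def nA split: option.splits)
    qed simp
    show "coupled p U V e"
      unfolding coupled_def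
    proof (intro allI impI)
      fix H :: "(nat + nat) set" assume H: "finite H"
      have fin: "finite (Inl -` H)" "finite (Inr -` H)" using H by (auto intro: finite_vimageI)
      have "H = Inl ` (Inl -` H) \<union> Inr ` (Inr -` H)"
      proof (intro equalityI subsetI)
        fix a assume "a \<in> H" then show "a \<in> Inl ` (Inl -` H) \<union> Inr ` (Inr -` H)" by (cases a) auto
      qed auto
      then have "(\<Sum>a\<in>H. d (U a) (V a) powr p)
          = (\<Sum>a\<in>Inl ` (Inl -` H) \<union> Inr ` (Inr -` H). d (U a) (V a) powr p)" by simp
      also have "\<dots> = (\<Sum>a\<in>Inl ` (Inl -` H). d (U a) (V a) powr p) + (\<Sum>a\<in>Inr ` (Inr -` H). d (U a) (V a) powr p)"
        using H by (intro sum.union_disjoint) auto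
      also have "(\<Sum>a\<in>Inl ` (Inl -` H). d (U a) (V a) powr p) = (\<Sum>i\<in>Inl -` H. cost_left p u v r i)"
        by (subst sum.reindex) (auto simp: U_def V_def cost_left_def dist_A_def split: option.splits intro!: sum.cong)
      also have "(\<Sum>a\<in>Inr ` (Inr -` H). d (U a) (V a) powr p) = (\<Sum>j\<in>Inr -` H. cost_right p v r j)"
        by (subst sum.reindex) (auto simp: U_def V_def cost_right_def dist_A_def commute intro!: sum.cong)
      also have "(\<Sum>i\<in>Inl -` H. cost_left p u v r i) + (\<Sum>j\<in>Inr -` H. cost_right p v r j) \<le> e"
        using r(2) fin by (auto simp: plan_bounded_def)
      finally show "(\<Sum>a\<in>H. d (U a) (V a) powr p) \<le> e" .
    qed
  qed
qed

section \<open>Compactness of plans\<close>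

lemma finite_far_from_A:
  fixes v :: "nat \<Rightarrow> 'a"
  assumes p: "1 \<le> p" and v: "range v \<subseteq> M" "dgm v \<in> pdiagrams p M d A" and \<delta>: "0 < \<delta>"
  shows "finite {j. \<delta> \<le> dist_A (v j)}"
proof -
  obtain u w :: "nat \<Rightarrow> 'a" and e where uw: "range u \<subseteq> M" "range w \<subseteq> A" "dgm u = dgm v" "coupled p u w e"
    by (rule pdiagrams_coupled_A[OF p v(2)])
  obtain h where h: "bij_betw h {j. v j \<notin> A} {i. u i \<notin> A}" "\<And>j. v j \<notin> A \<Longrightarrow> u (h j) = v j"
    using dgm_eqE[OF v(1) uw(1) uw(3)[symmetric]] by blast
  \<comment> \<open>Half of \<open>\<delta> powr p\<close>, so that a single far point already
    exceeds the bound for the tail.\<close>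
  have "0 < \<delta> powr p / 2" using \<delta> by simp
  then obtain N where N: "\<And>F. finite F \<Longrightarrow> F \<subseteq> {N..} \<Longrightarrow> (\<Sum>i\<in>F. d (u i) (w i) powr p) \<le> \<delta> powr p / 2"
    using coupled_tail[OF uw(4)] by metis
  let ?E = "{j. \<delta> \<le> dist_A (v j)}"
  have out: "v j \<notin> A" if "j \<in> ?E" for j using that dist_A_zero[of "v j"] \<delta> by auto
  have "h ` ?E \<subseteq> {..<N}"
  proof
    fix i assume "i \<in> h ` ?E"
    then obtain j where j: "j \<in> ?E" "i = h j" by auto
    have "u i = v j" using h(2)[OF out[OF j(1)]] j(2) by simp
    then have "\<delta> \<le> d (u i) (w i)"
      using j(1) nearest(2)[OF range_subsetD[OF v(1)] range_subsetD[OF uw(2)], of j i] by simp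
    then have "\<delta> powr p \<le> d (u i) (w i) powr p" using \<delta> p by (intro powr_mono2) auto
    then have "\<not> N \<le> i" using N[of "{i}"] \<open>0 < \<delta> powr p / 2\<close> by auto
    then show "i \<in> {..<N}" by simp
  qed
  then have "finite (h ` ?E)" by (rule finite_subset) simp
  moreover have "inj_on h ?E" using h(1) out by (auto simp: bij_betw_def inj_on_def)
  ultimately show ?thesis by (rule finite_imageD)
qed

text \<open>Plans become functions with values 0 and 1 on the countable set of pairs. A diagonal
  subsequence converges pointwise, and a convergent sequence of zeros and ones is eventually
  constant.\<close>

lemma plan_convergent_subsequence:
  fixes r :: "nat \<Rightarrow> nat \<Rightarrow> nat option"
  obtains k :: "nat \<Rightarrow> nat" where "strict_mono k"
    "\<And>i j. \<exists>b. eventually (\<lambda>n. (r (k n) i = Some j) = b) sequentially"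
proof -
  define f where "f n x = (if r n (fst x) = Some (snd x) then 1 else 0 :: real)" for n x
  have "countable (UNIV :: (nat \<times> nat) set)" "\<And>n x. x \<in> UNIV \<Longrightarrow> norm (f n x) \<le> 1"
    by (auto simp: f_def)
  then obtain k :: "nat \<Rightarrow> nat" where k: "strict_mono k" "\<And>x. x \<in> UNIV \<Longrightarrow> \<exists>l. (\<lambda>n. f (k n) x) \<longlonglongrightarrow> l"
    using function_convergent_subsequence[where f = f and S = UNIV and M = 1] by metis
  have "\<exists>b. eventually (\<lambda>n. (r (k n) i = Some j) = b) sequentially" for i j
  proof -
    obtain l where l: "(\<lambda>n. f (k n) (i, j)) \<longlonglongrightarrow> l" using k(2) by blast
    show ?thesis
    proof (cases "l < 1")
      case True
      then have "eventually (\<lambda>n. f (k n) (i, j) < 1) sequentially" using l by (intro order_tendstoD)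
      then show ?thesis by (intro exI[of _ False]) (auto elim!: eventually_mono simp: f_def)
    next
      case False
      then have "eventually (\<lambda>n. 0 < f (k n) (i, j)) sequentially" using l by (intro order_tendstoD) auto
      then show ?thesis by (intro exI[of _ True]) (auto elim!: eventually_mono simp: f_def split: if_splits)
    qed
  qed
  then show ?thesis using k(1) that by blast
qed

text \<open>If \<open>u i\<close> is unmatched in the limit, then its partners \<open>v j\<close> leave every finite set, so they
  approach \<open>A\<close> and the cost of \<open>u i\<close> does not increase in the limit; likewise for \<open>v j\<close>.
  Replacing \<open>dist_A\<close> by its excess over \<open>\<delta>\<close> makes the comparison with a late stage exact.\<close>

lemma limit_plan:
  fixes u v :: "nat \<Rightarrow> 'a" and r :: "nat \<Rightarrow> nat \<Rightarrow> nat option"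
  assumes p: "1 \<le> p" and M: "range u \<subseteq> M" "range v \<subseteq> M"
    and far: "\<And>\<delta>. 0 < \<delta> \<Longrightarrow> finite {i. \<delta> \<le> dist_A (u i)}" "\<And>\<delta>. 0 < \<delta> \<Longrightarrow> finite {j. \<delta> \<le> dist_A (v j)}"
    and r: "\<And>n. plan (r n)" "\<And>n. plan_bounded p u v (r n) (c n)" and c: "c \<longlonglongrightarrow> e"
    and conv: "\<And>i j. \<exists>b. eventually (\<lambda>n. (r n i = Some j) = b) sequentially"
  obtains s where "plan s" "plan_bounded p u v s e"
proof -
  obtain B where B: "\<And>i j. eventually (\<lambda>n. (r n i = Some j) = B i j) sequentially" using conv by metis
  have uM: "u i \<in> M" "v i \<in> M" for i using M by auto
  have inj1: "j = j'" if "B i j" "B i j'" for i j j'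
  proof -
    have "eventually (\<lambda>n. r n i = Some j \<and> r n i = Some j') sequentially"
      using B[of i j] B[of i j'] by eventually_elim (use that in simp)
    then obtain n where "r n i = Some j" "r n i = Some j'" using eventually_happens' sequentially_bot by blast
    then show ?thesis by (metis option.inject)
  qed
  have inj2: "i = i'" if "B i j" "B i' j" for i i' j
  proof -
    have "eventually (\<lambda>n. r n i = Some j \<and> r n i' = Some j) sequentially"
      using B[of i j] B[of i' j] by eventually_elim (use that in simp)
    then obtain n where "r n i = Some j \<and> r n i' = Some j" using eventually_happens' sequentially_bot by blast
    then show ?thesis using r(1)[of n] unfolding plan_def by blast
  qed
  define s where "s i = (if \<exists>j. B i j then Some (SOME j. B i j) else None)" for i
  have s: "s i = Some j \<longleftrightarrow> B i j" for i j
  proof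
    assume "s i = Some j"
    then show "B i j" by (auto simp: s_def split: if_splits intro: someI)
  next
    assume "B i j"
    moreover from this have "B i (SOME j. B i j)" by (rule someI)
    ultimately show "s i = Some j" using inj1 by (auto simp: s_def)
  qed
  have "plan s" unfolding plan_def using s inj2 by blast
  moreover have "plan_bounded p u v s e"
    unfolding plan_bounded_def
  proof (intro allI impI, elim conjE)
    fix F G :: "nat set" assume fin: "finite F" "finite G"
    define q where "q \<delta> x = (max 0 (dist_A x - \<delta>)) powr p" for \<delta> x
    define a where "a \<delta> i = (case s i of Some j \<Rightarrow> d (u i) (v j) powr p | None \<Rightarrow> q \<delta> (u i))" for \<delta> i
    define b where "b \<delta> j = (if Some j \<in> range s then 0 else q \<delta> (v j))" for \<delta> j
    have q_le: "q \<delta> x \<le> y powr p" if "dist_A x \<le> y + \<delta>" "0 \<le> y" for \<delta> x y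
      unfolding q_def using that p by (intro powr_mono2) auto
    have approx: "(\<Sum>i\<in>F. a \<delta> i) + (\<Sum>j\<in>G. b \<delta> j) \<le> e" if \<delta>: "0 < \<delta>" for \<delta>
    proof (rule tendsto_lowerbound[OF c])
      \<comment> \<open>Points with indices outside \<open>I\<close> and \<open>J\<close> are closer
        than \<delta> to \<open>A\<close>. \<open>I\<close> also contains \<open>F\<close>, so that
        partners outside \<open>I\<close> are not counted twice below.\<close>
      define I J where "I = F \<union> {i. \<delta> \<le> dist_A (u i)}" and "J = {j. \<delta> \<le> dist_A (v j)}"
      have IJ: "finite I" "finite J" using far \<delta> fin by (auto simp: I_def J_def)
      have 1: "eventually (\<lambda>n. \<forall>i\<in>F. \<forall>j\<in>J. (r n i = Some j) = B i j) sequentially"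
        using fin IJ B by (intro eventually_ball_finite ballI) auto
      have 2: "eventually (\<lambda>n. \<forall>j\<in>G. \<forall>i\<in>I. (r n i = Some j) = B i j) sequentially"
        using fin IJ B by (intro eventually_ball_finite ballI) auto
      have 3: "eventually (\<lambda>n. \<forall>i\<in>F. \<forall>j\<in>set_option (s i). (r n i = Some j) = B i j) sequentially"
        using fin B by (intro eventually_ball_finite ballI) auto
      show "eventually (\<lambda>n. (\<Sum>i\<in>F. a \<delta> i) + (\<Sum>j\<in>G. b \<delta> j) \<le> c n) sequentially"
        using 1 2 3
      proof eventually_elim
        case (elim n)
        have left: "a \<delta> i \<le> cost_left p u v (r n) i" if i: "i \<in> F" for i
        proof (cases "s i")
          case (Some j)
          then have "r n i = Some j" using elim(3) i s by auto
          then show ?thesis using Some by (simp add: a_def cost_left_def)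
        next
          case None
          show ?thesis
          proof (cases "r n i")
            case None
            then show ?thesis using \<open>s i = None\<close> q_le[of "u i" "dist_A (u i)" \<delta>] \<delta> by (simp add: a_def cost_left_def)
          next
            case (Some j)
            have "j \<notin> J"
            proof
              assume "j \<in> J"
              then have "B i j" using elim(1) i Some by auto
              then show False using s \<open>s i = None\<close> by (metis option.distinct(1))
            qed
            then have "dist_A (u i) \<le> d (u i) (v j) + \<delta>"
              using dist_A_lipschitz[OF uM(1)[of i] uM(2)[of j]] by (auto simp: J_def)
            then show ?thesis using Some \<open>s i = None\<close> q_le by (simp add: a_def cost_left_def)
          qed
        qed
        \<comment> \<open>\<open>G\<^sub>1\<close> collects what is matched at stage
          \<open>n\<close> but not in the limit. Its cost is paid by the partners
          \<open>\<rho> j\<close>, whose left costs are not among those over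
          \<open>F\<close>.\<close>
        define G\<^sub>1 where "G\<^sub>1 = {j\<in>G. Some j \<notin> range s \<and> Some j \<in> range (r n)}"
        define G\<^sub>2 where "G\<^sub>2 = {j\<in>G. Some j \<notin> range s \<and> Some j \<notin> range (r n)}"
        define \<rho> where "\<rho> j = (SOME i. r n i = Some j)" for j
        have \<rho>: "r n (\<rho> j) = Some j" if "j \<in> G\<^sub>1" for j
        proof -
          have "\<exists>i. r n i = Some j" using that by (auto simp: G\<^sub>1_def)
          then show ?thesis unfolding \<rho>_def by (rule someI_ex)
        qed
        have \<rho>I: "\<rho> j \<notin> I" if j: "j \<in> G\<^sub>1" for j
        proof
          assume "\<rho> j \<in> I"
          then have "B (\<rho> j) j" using elim(2) \<rho>[OF j] j by (auto simp: G\<^sub>1_def)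
          then have "s (\<rho> j) = Some j" using s by simp
          then show False using j rangeI[of s "\<rho> j"] by (simp add: G\<^sub>1_def)
        qed
        have inj: "inj_on \<rho> G\<^sub>1" by (rule inj_onI) (metis \<rho> option.inject)
        have finG: "finite G\<^sub>1" "finite G\<^sub>2" using fin by (auto simp: G\<^sub>1_def G\<^sub>2_def)
        have "(\<Sum>j\<in>G. b \<delta> j) = (\<Sum>j\<in>G\<^sub>1 \<union> G\<^sub>2. b \<delta> j)"
          using fin by (intro sum.mono_neutral_right) (auto simp: G\<^sub>1_def G\<^sub>2_def b_def)
        also have "\<dots> = (\<Sum>j\<in>G\<^sub>1. b \<delta> j) + (\<Sum>j\<in>G\<^sub>2. b \<delta> j)"
          using finG by (intro sum.union_disjoint) (auto simp: G\<^sub>1_def G\<^sub>2_def)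
        also have "(\<Sum>j\<in>G\<^sub>1. b \<delta> j) \<le> (\<Sum>j\<in>G\<^sub>1. cost_left p u v (r n) (\<rho> j))"
        proof (rule sum_mono)
          fix j assume j: "j \<in> G\<^sub>1"
          have "dist_A (u (\<rho> j)) < \<delta>" using \<rho>I[OF j] by (auto simp: I_def)
          then have "dist_A (v j) \<le> d (u (\<rho> j)) (v j) + \<delta>"
            using dist_A_lipschitz[OF uM(2)[of j] uM(1)[of "\<rho> j"]] commute[of "v j"] by simp
          then show "b \<delta> j \<le> cost_left p u v (r n) (\<rho> j)"
            using q_le \<rho>[OF j] j by (simp add: b_def cost_left_def G\<^sub>1_def)
        qed
        also have "(\<Sum>j\<in>G\<^sub>1. cost_left p u v (r n) (\<rho> j)) = (\<Sum>i\<in>\<rho> ` G\<^sub>1. cost_left p u v (r n) i)"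
          using inj by (simp add: sum.reindex)
        also have "(\<Sum>j\<in>G\<^sub>2. b \<delta> j) \<le> (\<Sum>j\<in>G\<^sub>2. cost_right p v (r n) j)"
          using q_le \<delta> by (intro sum_mono) (auto simp: G\<^sub>2_def b_def cost_right_def)
        finally have "(\<Sum>i\<in>F. a \<delta> i) + (\<Sum>j\<in>G. b \<delta> j)
            \<le> (\<Sum>i\<in>F. cost_left p u v (r n) i) + (\<Sum>i\<in>\<rho> ` G\<^sub>1. cost_left p u v (r n) i) + (\<Sum>j\<in>G\<^sub>2. cost_right p v (r n) j)"
          using sum_mono[of F "a \<delta>" "cost_left p u v (r n)", OF left] by linarith
        also have "(\<Sum>i\<in>F. cost_left p u v (r n) i) + (\<Sum>i\<in>\<rho> ` G\<^sub>1. cost_left p u v (r n) i)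
            = (\<Sum>i\<in>F \<union> \<rho> ` G\<^sub>1. cost_left p u v (r n) i)"
          using fin finG \<rho>I by (intro sum.union_disjoint[symmetric]) (auto simp: I_def)
        also have "(\<Sum>i\<in>F \<union> \<rho> ` G\<^sub>1. cost_left p u v (r n) i) + (\<Sum>j\<in>G\<^sub>2. cost_right p v (r n) j) \<le> c n"
          using r(2)[of n] fin finG by (auto simp: plan_bounded_def)
        finally show ?case .
      qed
    qed simp
    have q_lim: "((\<lambda>\<delta>. q \<delta> x) \<longlongrightarrow> dist_A x powr p) (at_right 0)" for x
    proof -
      have "((\<lambda>\<delta>. (max 0 (dist_A x - \<delta>)) powr p) \<longlongrightarrow> (max 0 (dist_A x - 0)) powr p) (at_right 0)"
        using p by (intro tendsto_powr' tendsto_intros) auto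
      then show ?thesis by (simp add: q_def)
    qed
    have "((\<lambda>\<delta>. (\<Sum>i\<in>F. a \<delta> i) + (\<Sum>j\<in>G. b \<delta> j)) \<longlongrightarrow> (\<Sum>i\<in>F. cost_left p u v s i) + (\<Sum>j\<in>G. cost_right p v s j)) (at_right 0)"
    proof (intro tendsto_add tendsto_sum)
      show "((\<lambda>\<delta>. a \<delta> i) \<longlongrightarrow> cost_left p u v s i) (at_right 0)" for i
        unfolding a_def cost_left_def by (cases "s i") (auto intro: q_lim)
      show "((\<lambda>\<delta>. b \<delta> j) \<longlongrightarrow> cost_right p v s j) (at_right 0)" for j
        unfolding b_def cost_right_def by (auto intro: q_lim)
    qed
    then show "(\<Sum>i\<in>F. cost_left p u v s i) + (\<Sum>j\<in>G. cost_right p v s j) \<le> e"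
    proof (rule tendsto_upperbound)
      show "eventually (\<lambda>\<delta>. (\<Sum>i\<in>F. a \<delta> i) + (\<Sum>j\<in>G. b \<delta> j) \<le> e) (at_right 0)"
        using eventually_at_right_less[of 0] by (rule eventually_mono) (rule approx)
    qed simp
  qed
  ultimately show ?thesis by (rule that)
qed

lemma ex_optimal_coupling:
  assumes p: "1 \<le> p" and ST: "S \<in> pdiagrams p M d A" "T \<in> pdiagrams p M d A"
  obtains U V :: "nat + nat \<Rightarrow> 'a" where "range U \<subseteq> M" "range V \<subseteq> M" "dgm U = S" "dgm V = T"
    "coupled p U V (pdist p d A S T powr p)"
proof -
  let ?L = "pdist p d A S T"
  define c where "c n = (?L + 1 / real (Suc n)) powr p" for n
  obtain u v :: "nat \<Rightarrow> 'a" where uv: "range u \<subseteq> M" "dgm u = S" "range v \<subseteq> M" "dgm v = T"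
    using ex_dgm ST pdiagrams_diagrams by metis
  have "\<exists>r. plan r \<and> plan_bounded p u v r (c n)" for n
  proof -
    have "?L < ?L + 1 / real (Suc n)" by simp
    then obtain u' v' :: "nat \<Rightarrow> 'a" where "range u' \<subseteq> M" "range v' \<subseteq> M" "dgm u' = S" "dgm v' = T" "coupled p u' v' (c n)"
      using pdist_lessE[OF p ST] unfolding c_def by metis
    then show ?thesis using plan_of_coupling[OF p uv(1,3), of u' v' "c n"] uv by metis
  qed
  then obtain r where r: "\<And>n. plan (r n)" "\<And>n. plan_bounded p u v (r n) (c n)" by metis
  obtain k :: "nat \<Rightarrow> nat" where k: "strict_mono k"
    "\<And>i j. \<exists>b. eventually (\<lambda>n. (r (k n) i = Some j) = b) sequentially"
    using plan_convergent_subsequence[of r] by blast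
  have L0: "0 \<le> ?L" by (simp add: pdist_def)
  have "(\<lambda>n. ?L + 1 / real (Suc n)) \<longlonglongrightarrow> ?L + 0"
    using LIMSEQ_Suc[OF lim_1_over_n] by (intro tendsto_intros)
  then have "c \<longlonglongrightarrow> (?L + 0) powr p"
    unfolding c_def using p L0 by (intro tendsto_powr' tendsto_const) auto
  then have "(\<lambda>n. c (k n)) \<longlonglongrightarrow> ?L powr p"
    using LIMSEQ_subseq_LIMSEQ[of c _ k] k(1) by (simp add: comp_def)
  then obtain s where "plan s" "plan_bounded p u v s (?L powr p)"
    using limit_plan[OF p uv(1,3) finite_far_from_A[OF p uv(1)] finite_far_from_A[OF p uv(3)], of "\<lambda>n. r (k n)" "\<lambda>n. c (k n)"]
      uv ST r k(2) by metis
  from coupling_of_plan[OF uv(1,3) this] show ?thesis using uv that by metis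
qed

section \<open>Geodesics of diagrams\<close>

theorem geodesic_pdiagrams:
  assumes p: "1 \<le> p" and geo: "geodesic_space M d"
  shows "geodesic_space (pdiagrams p M d A) (pdist p d A)"
  unfolding geodesic_space_def
proof (intro ballI)
  fix S T assume ST: "S \<in> pdiagrams p M d A" "T \<in> pdiagrams p M d A"
  interpret D: Metric_space "pdiagrams p M d A" "pdist p d A" by (rule Metric_space_pdiagrams[OF p])
  let ?L = "pdist p d A S T"
  obtain U V :: "nat + nat \<Rightarrow> 'a" where UV: "range U \<subseteq> M" "range V \<subseteq> M" "dgm U = S" "dgm V = T"
    "coupled p U V (?L powr p)"
    by (rule ex_optimal_coupling[OF p ST])
  have "\<exists>\<gamma>. unit_speed (d (U i) (V i)) \<gamma> \<and> \<gamma> 0 = U i \<and> \<gamma> (d (U i) (V i)) = V i" for i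
  proof -
    obtain g where "minimizing_geodesic M d (U i) (V i) g"
      using geo range_subsetD[OF UV(1)] range_subsetD[OF UV(2)] unfolding geodesic_space_def by metis
    then show ?thesis using minimizing_geodesic_unit_speed by metis
  qed
  then obtain \<gamma> where \<gamma>: "\<And>i. unit_speed (d (U i) (V i)) (\<gamma> i)" "\<And>i. \<gamma> i 0 = U i" "\<And>i. \<gamma> i (d (U i) (V i)) = V i"
    by metis
  \<comment> \<open>Every pair is joined by its own geodesic, run through in unit time; all
    distances then scale by the common factor \<open>t - s\<close>, and so does the
    coupling.\<close>
  define x where "x t i = \<gamma> i (t * d (U i) (V i))" for t i
  have mem: "0 \<le> t * d (U i) (V i)" "t * d (U i) (V i) \<le> d (U i) (V i)" if "0 \<le> t" "t \<le> 1" for t i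
    using that by (auto simp: mult_left_le_one_le)
  have xM: "range (x t) \<subseteq> M" if "0 \<le> t" "t \<le> 1" for t
    using unit_speed_in[OF \<gamma>(1) mem[OF that]] by (auto simp: x_def)
  have x01: "x 0 = U" "x 1 = V" using \<gamma>(2,3) by (auto simp: x_def)
  have c: "coupled p (x s) (x t) (((t - s) * ?L) powr p)" if st: "0 \<le> s" "s \<le> t" "t \<le> 1" for s t
    unfolding coupled_def
  proof (intro allI impI)
    fix F :: "(nat + nat) set" assume F: "finite F"
    have "d (x s i) (x t i) = (t - s) * d (U i) (V i)" for i
    proof -
      have "d (x s i) (x t i) = \<bar>s * d (U i) (V i) - t * d (U i) (V i)\<bar>"
        unfolding x_def using mem st by (intro unit_speed_dist[OF \<gamma>(1)]) auto
      also have "\<dots> = (t - s) * d (U i) (V i)"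
        using st by (simp add: left_diff_distrib[symmetric] abs_mult)
      finally show ?thesis .
    qed
    then have "(\<Sum>i\<in>F. d (x s i) (x t i) powr p) = (t - s) powr p * (\<Sum>i\<in>F. d (U i) (V i) powr p)"
      using st by (simp add: powr_mult sum_distrib_left)
    also have "\<dots> \<le> (t - s) powr p * ?L powr p"
      using UV(5) F by (intro mult_left_mono) (auto simp: coupled_def)
    also have "\<dots> = ((t - s) * ?L) powr p" using st by (simp add: powr_mult)
    finally show "(\<Sum>i\<in>F. d (x s i) (x t i) powr p) \<le> ((t - s) * ?L) powr p" .
  qed
  define g where "g t = dgm (x t)" for t
  have ends: "g 0 = S" "g 1 = T" using x01 UV by (auto simp: g_def)
  have gD: "g t \<in> pdiagrams p M d A" if t: "0 \<le> t" "t \<le> 1" for t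
    unfolding g_def
    using c[of 0 t] t ends ST xM by (intro pdiagrams_dgmI[OF p xM[of 0] xM[OF t], of "t * ?L"]) (auto simp: g_def)
  have le: "pdist p d A (g s) (g t) \<le> (t - s) * ?L" if st: "0 \<le> s" "s \<le> t" "t \<le> 1" for s t
    unfolding g_def using c[OF st] st by (intro pdist_dgm_le[OF p xM xM]) auto
  \<comment> \<open>The upper bounds for the three pieces between \<open>S\<close>,
    \<open>g s\<close>, \<open>g t\<close> and \<open>T\<close> add up to \<open>?L\<close>, so none
    of them can be strict.\<close>
  have eq: "pdist p d A (g s) (g t) = (t - s) * pdist p d A (g 0) (g 1)" if st: "0 \<le> s" "s \<le> t" "t \<le> 1" for s t
  proof -
    have "?L \<le> pdist p d A S (g s) + pdist p d A (g s) T"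
      using ST gD st by (intro D.triangle) auto
    also have "pdist p d A (g s) T \<le> pdist p d A (g s) (g t) + pdist p d A (g t) T"
      using ST gD st by (intro D.triangle) auto
    finally have "?L \<le> pdist p d A (g 0) (g s) + pdist p d A (g s) (g t) + pdist p d A (g t) (g 1)"
      unfolding ends by simp
    also have "\<dots> \<le> (s - 0) * ?L + pdist p d A (g s) (g t) + (1 - t) * ?L"
      using st by (intro add_mono le) auto
    finally have "(t - s) * ?L \<le> pdist p d A (g s) (g t)" by (simp add: algebra_simps)
    then show ?thesis using le[OF st] ends by simp
  qed
  have "minimizing_geodesic (pdiagrams p M d A) (pdist p d A) (g 0) (g 1) g"
    by (rule D.constant_speed_minimizing_geodesic[OF gD eq])
  then show "\<exists>g. minimizing_geodesic (pdiagrams p M d A) (pdist p d A) S T g" unfolding ends by blast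
qed

end

theorem theorem2:
  fixes M :: "'a set" and d :: "'a \<Rightarrow> 'a \<Rightarrow> real" and A :: "'a set" and p :: real
  assumes "metric_pair M d A" and "1 \<le> p"
  shows "(Metric_space.mcomplete M d \<longrightarrow>
            Metric_space.mcomplete (pdiagrams p M d A) (pdist p d A)) \<and>
         (separable_space (Metric_space.mtopology M d) \<longrightarrow>
            separable_space (Metric_space.mtopology (pdiagrams p M d A) (pdist p d A))) \<and>
         (proper_space M d \<and> geodesic_space M d \<longrightarrow>
            geodesic_space (pdiagrams p M d A) (pdist p d A)) \<and>
         (proper_space M d \<and> alexandrov_nonneg M d \<longrightarrow>
            alexandrov_nonneg (pdiagrams 2 M d A) (pdist 2 d A))"
proof -
  interpret metric_pair M d A by fact
  \<comment> \<open>For a general exponent, because (3) concerns \<open>p\<close> and (4) concerns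
    2.\<close>
  have geo: "geodesic_space (pdiagrams q M d A) (pdist q d A)"
    if "1 \<le> q" "proper_space M d" "geodesic_space M d" for q
  proof -
    interpret proper_metric_pair M d A by unfold_locales fact
    show ?thesis using that by (intro geodesic_pdiagrams)
  qed
  have "alexandrov_nonneg (pdiagrams 2 M d A) (pdist 2 d A)"
    if proper: "proper_space M d" and alex: "alexandrov_nonneg M d"
  proof -
    interpret D: Metric_space "pdiagrams 2 M d A" "pdist 2 d A" by (rule Metric_space_pdiagrams) simp
    interpret locally_nonneg_curved M d by (rule alexandrov_locally_nonneg_curved[OF alex])
    have "mcomplete" "geodesic_space M d" using alex by (auto simp: alexandrov_nonneg_def)
    then show ?thesis
      using mcomplete_pdiagrams[of 2] geo[of 2] proper four_point_pdiagrams[OF four_point[OF proper]]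
      by (intro D.four_point_alexandrov) auto
  qed
  then show ?thesis
    using mcomplete_pdiagrams[OF assms(2)] separable_pdiagrams[OF assms(2)] geo[OF assms(2)] by blast
qed

end
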